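(* Let $(M^3,g)$ be the Anderson manifold (defined in the context) and let $\nu>0$. The Cauchy problem for the (modified) Navier-Stokes equations on $(M^3,g)$, $$\begin{cases}\partial_t u+\nabla_u u-\nu\,\mathcal{L}u+\nabla p=0,\\ \mathrm{div}\,u=0,\\ u(0,x)=u_0(x),\end{cases}$$ where $\mathcal{L}$ is the Hodge Laplacian with the sign convention $\mathcal{L}=-(dd^*+d^*d)$, is ill-posed in the following sense: there are smooth initial conditions $u_0$ for which there exist infinitely many distinct smooth Leray-Hopf solutions $u$ (each with some pressure function $p$).
   Context: The Anderson manifold $(M^3,g)$. Let $H=\{z=x+iy\in\mathbb{C}: x^2+y^2<1,\ x>0\}$, equipped with the hyperbolic metric of sectional curvature $-a^2$, $ds_a^2=\dfrac{4(dx^2+dy^2)}{a^2(1-|z|^2)^2}$, where $a=2$ (so $ds_2^2=\dfrac{dx^2+dy^2}{(1-|z|^2)^2}$). Let $L$ be the line segment from $(0,-1)$ to $(0,1)$ and let $\rho_a(z)=\frac1a\,\mathrm{arcsinh}\!\left(\frac{2x}{1-|z|^2}\right)$ be the $ds_a^2$-distance from $z\in H$ to $L$. Put $f(z)=\sinh(\rho_a(z))$. The warped product $H\times_f S^1$, with metric $$g=\frac{4(dx^2+dy^2)}{a^2(1-|z|^2)^2}+f^2\,d\theta^2$$ ($\theta$ the standard angular coordinate on $S^1$, of period $2\pi$), extends smoothly across $L$, where $f=0$ and the circle factor collapses to a point. The resulting complete Riemannian three-manifold, diffeomorphic to $\mathbb{R}^3$, is $(M^3,g)$. Here $u$ is a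 time-dependent vector field on $M$, $t\in[0,\infty)$, $p$ is a time-dependent real-valued function on $M$, $\nabla_u u$ uses the Levi-Civita connection, $\nabla p$ is the gradient, and $d^*$ is the formal adjoint of the exterior derivative $d$, with vector fields identified with $1$-forms via $g$. A solution $u$ is of Leray-Hopf type if $$u\in L^\infty\big([0,\infty),L^2(TM)\big)\cap L^2\big([0,\infty),\dot H^1(TM)\big),$$ where $\|u\|_{\dot H^1}=\|\nabla u\|_{L^2}$, and for all $t\ge 0$ $$\|u(t,\cdot)\|_{L^2}^2+4\int_0^t\|\mathrm{Def}(u(s,\cdot))\|_{L^2}^2\,ds\le\|u_0\|_{L^2}^2,$$ where $\mathrm{Def}(u)=\frac12\big(\nabla u+(\nabla u)^t\big)$ is the deformation tensor. *)

theory Defs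
  imports "HOL-Analysis.Analysis"
begin

section \<open>Smooth maps\<close>

text \<open>For open sets \<open>S\<close> in finite-dimensional spaces, \<open>Ck_on k S f\<close> says that
  \<open>f\<close> is of class \<open>C\<^sup>k\<close> on \<open>S\<close>.\<close>

primrec Ck_on :: "nat \<Rightarrow> 'a::real_normed_vector set \<Rightarrow> ('a \<Rightarrow> 'b::real_normed_vector) \<Rightarrow> bool"
  where
    "Ck_on 0 S f \<longleftrightarrow> continuous_on S f"
  | "Ck_on (Suc k) S f \<longleftrightarrow> (\<forall>x\<in>S. f differentiable (at x)) \<and>
       (\<forall>v. Ck_on k S (\<lambda>x. frechet_derivative f (at x) v))"

text \<open>Smoothness on a set that need not be open (such as \<open>[0,\<infinity>) \<times> M\<close>, which has the
  boundary \<open>t = 0\<close>) means having a smooth extension to an open neighbourhood. Only the values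
  of \<open>f\<close> on \<open>S\<close> matter.\<close>

definition smooth_on :: "'a::real_normed_vector set \<Rightarrow> ('a \<Rightarrow> 'b::real_normed_vector) \<Rightarrow> bool"
  where "smooth_on S f \<longleftrightarrow>
    (\<exists>T h. open T \<and> S \<subseteq> T \<and> (\<forall>k. Ck_on k T h) \<and> (\<forall>x\<in>S. h x = f x))"

definition test_on :: "'a::real_normed_vector set \<Rightarrow> ('a \<Rightarrow> 'b::real_normed_vector) \<Rightarrow> bool"
  where "test_on M \<phi> \<longleftrightarrow>
    smooth_on M \<phi> \<and> (\<exists>K. compact K \<and> K \<subseteq> M \<and> (\<forall>x\<in>M - K. \<phi> x = 0))"


section \<open>Riemannian geometry in a global chart\<close>

text \<open>A manifold covered by one chart is an open set \<open>M\<close> of \<open>real ^ 'n\<close>, and a Riemannian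
  metric is the matrix field \<open>g\<close> with \<open>g x $ i $ j = g\<^sub>i\<^sub>j(x)\<close>. Vector fields and
  1-forms are given by their components \<open>u\<^sup>i\<close> and \<open>\<alpha>\<^sub>i\<close> in the coordinate
  frame and coframe, covariant 2-tensors (in particular 2-forms) by the matrix of their components.
  Nothing below depends on the values of these fields outside \<open>M\<close>.\<close>

definition partial :: "'n::finite \<Rightarrow> (real^'n \<Rightarrow> real) \<Rightarrow> real^'n \<Rightarrow> real"
  where "partial i f x = frechet_derivative f (at x) (axis i 1)"

definition vol :: "(real^'n) set \<Rightarrow> (real^'n \<Rightarrow> real^'n^'n) \<Rightarrow> (real^'n::finite) measure"
  where "vol M g = density lborel (\<lambda>x. indicator M x * ennreal (sqrt (det (g x))))"

definition vec_inner :: "(real^'n \<Rightarrow> real^'n^'n) \<Rightarrow> real^'n::finite \<Rightarrow> real^'n \<Rightarrow> real^'n \<Rightarrow> real"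
  where "vec_inner g x v w = (\<Sum>i\<in>UNIV. \<Sum>j\<in>UNIV. g x $ i $ j * v $ i * w $ j)"

definition cov_inner :: "(real^'n \<Rightarrow> real^'n^'n) \<Rightarrow> real^'n::finite \<Rightarrow> real^'n \<Rightarrow> real^'n \<Rightarrow> real"
  where "cov_inner g x \<alpha> \<beta> =
    (\<Sum>i\<in>UNIV. \<Sum>j\<in>UNIV. matrix_inv (g x) $ i $ j * \<alpha> $ i * \<beta> $ j)"

definition tensor_inner ::
    "(real^'n \<Rightarrow> real^'n^'n) \<Rightarrow> real^'n::finite \<Rightarrow> real^'n^'n \<Rightarrow> real^'n^'n \<Rightarrow> real"
  where "tensor_inner g x A B = (\<Sum>i\<in>UNIV. \<Sum>j\<in>UNIV. \<Sum>k\<in>UNIV. \<Sum>l\<in>UNIV.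
    matrix_inv (g x) $ i $ k * matrix_inv (g x) $ j $ l * A $ i $ j * B $ k $ l)"

definition flat :: "(real^'n \<Rightarrow> real^'n^'n) \<Rightarrow> (real^'n::finite \<Rightarrow> real^'n) \<Rightarrow> real^'n \<Rightarrow> real^'n"
  where "flat g u x = g x *v u x"

definition sharp :: "(real^'n \<Rightarrow> real^'n^'n) \<Rightarrow> (real^'n::finite \<Rightarrow> real^'n) \<Rightarrow> real^'n \<Rightarrow> real^'n"
  where "sharp g \<alpha> x = matrix_inv (g x) *v \<alpha> x"

text \<open>\<open>christoffel g k i j x\<close> is \<open>\<Gamma>\<^sup>k\<^sub>i\<^sub>j(x)\<close> for the Levi-Civita connection.\<close>

definition christoffel ::
    "(real^'n \<Rightarrow> real^'n^'n) \<Rightarrow> 'n::finite \<Rightarrow> 'n \<Rightarrow> 'n \<Rightarrow> real^'n \<Rightarrow> real"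
  where "christoffel g k i j x = (1/2) * (\<Sum>l\<in>UNIV. matrix_inv (g x) $ k $ l *
    (partial i (\<lambda>y. g y $ j $ l) x + partial j (\<lambda>y. g y $ i $ l) x
      - partial l (\<lambda>y. g y $ i $ j) x))"

text \<open>\<open>nabla g u i k x\<close> is \<open>\<nabla>\<^sub>i u\<^sup>k (x)\<close>.\<close>

definition nabla ::
    "(real^'n \<Rightarrow> real^'n^'n) \<Rightarrow> (real^'n::finite \<Rightarrow> real^'n) \<Rightarrow> 'n \<Rightarrow> 'n \<Rightarrow> real^'n \<Rightarrow> real"
  where "nabla g u i k x =
    partial i (\<lambda>y. u y $ k) x + (\<Sum>j\<in>UNIV. christoffel g k i j x * u x $ j)"

definition cov_deriv ::
    "(real^'n \<Rightarrow> real^'n^'n) \<Rightarrow> (real^'n::finite \<Rightarrow> real^'n) \<Rightarrow> (real^'n \<Rightarrow> real^'n) \<Rightarrow> real^'n \<Rightarrow> real^'n"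
  where "cov_deriv g v u x = (\<chi> k. \<Sum>i\<in>UNIV. v x $ i * nabla g u i k x)"

definition divergence ::
    "(real^'n \<Rightarrow> real^'n^'n) \<Rightarrow> (real^'n::finite \<Rightarrow> real^'n) \<Rightarrow> real^'n \<Rightarrow> real"
  where "divergence g u x = (\<Sum>k\<in>UNIV. nabla g u k k x)"

text \<open>The covariant derivative as a covariant 2-tensor, \<open>(\<nabla>u)\<^sub>i\<^sub>j = g\<^sub>j\<^sub>k \<nabla>\<^sub>i u\<^sup>k\<close>.
  After lowering the index the metric transpose of \<open>\<nabla>u\<close> is the matrix transpose, and the
  pointwise tensor norm is unchanged.\<close>

definition nabla_flat ::
    "(real^'n \<Rightarrow> real^'n^'n) \<Rightarrow> (real^'n::finite \<Rightarrow> real^'n) \<Rightarrow> real^'n \<Rightarrow> real^'n^'n"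
  where "nabla_flat g u x = (\<chi> i j. \<Sum>k\<in>UNIV. g x $ j $ k * nabla g u i k x)"

definition deformation ::
    "(real^'n \<Rightarrow> real^'n^'n) \<Rightarrow> (real^'n::finite \<Rightarrow> real^'n) \<Rightarrow> real^'n \<Rightarrow> real^'n^'n"
  where "deformation g u x = (1/2) *\<^sub>R (nabla_flat g u x + transpose (nabla_flat g u x))"

definition ext_d0 :: "(real^'n::finite \<Rightarrow> real) \<Rightarrow> real^'n \<Rightarrow> real^'n"
  where "ext_d0 f x = (\<chi> i. partial i f x)"

definition ext_d1 :: "(real^'n::finite \<Rightarrow> real^'n) \<Rightarrow> real^'n \<Rightarrow> real^'n^'n"
  where "ext_d1 \<alpha> x =
    (\<chi> i j. partial i (\<lambda>y. \<alpha> y $ j) x - partial j (\<lambda>y. \<alpha> y $ i) x)"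

definition grad ::
    "(real^'n \<Rightarrow> real^'n^'n) \<Rightarrow> (real^'n::finite \<Rightarrow> real) \<Rightarrow> real^'n \<Rightarrow> real^'n"
  where "grad g p = sharp g (ext_d0 p)"

text \<open>The formal adjoint of the exterior derivative, as a relation: \<open>is_codiff1 M g \<alpha> a\<close> and
  \<open>is_codiff2 M g \<beta> \<gamma>\<close> say that \<open>a = d\<^sup>*\<alpha>\<close> and \<open>\<gamma> = d\<^sup>*\<beta>\<close> on \<open>M\<close>, for a 1-form
  \<open>\<alpha>\<close> and a 2-form \<open>\<beta>\<close>. The smooth function \<open>a\<close> and 1-form \<open>\<gamma>\<close> are determined on \<open>M\<close>
  by these identities. The factor 1/2 turns the tensor inner product into the one on 2-forms, for
  which the \<open>e\<^sup>i \<and> e\<^sup>j\<close> with \<open>i < j\<close> are orthonormal if the \<open>e\<^sup>i\<close> are.\<close>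

definition is_codiff1 ::
    "(real^'n) set \<Rightarrow> (real^'n \<Rightarrow> real^'n^'n) \<Rightarrow> (real^'n::finite \<Rightarrow> real^'n) \<Rightarrow> (real^'n \<Rightarrow> real) \<Rightarrow> bool"
  where "is_codiff1 M g \<alpha> a \<longleftrightarrow> smooth_on M a \<and>
    (\<forall>\<phi>. test_on M \<phi> \<longrightarrow>
      (\<integral>x. cov_inner g x (ext_d0 \<phi> x) (\<alpha> x) \<partial>vol M g) = (\<integral>x. \<phi> x * a x \<partial>vol M g))"

definition is_codiff2 ::
    "(real^'n) set \<Rightarrow> (real^'n \<Rightarrow> real^'n^'n) \<Rightarrow> (real^'n::finite \<Rightarrow> real^'n^'n) \<Rightarrow> (real^'n \<Rightarrow> real^'n) \<Rightarrow> bool"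
  where "is_codiff2 M g \<beta> \<gamma> \<longleftrightarrow> smooth_on M \<gamma> \<and>
    (\<forall>\<psi>. test_on M \<psi> \<longrightarrow>
      (\<integral>x. (1/2) * tensor_inner g x (ext_d1 \<psi> x) (\<beta> x) \<partial>vol M g) =
      (\<integral>x. cov_inner g x (\<psi> x) (\<gamma> x) \<partial>vol M g))"

text \<open>\<open>is_hodge_laplacian M g u w\<close>: on \<open>M\<close>, \<open>w\<close> is the vector field corresponding to
  \<open>-(dd\<^sup>* + d\<^sup>*d)\<close> applied to the 1-form of \<open>u\<close>.\<close>

definition is_hodge_laplacian ::
    "(real^'n) set \<Rightarrow> (real^'n \<Rightarrow> real^'n^'n) \<Rightarrow> (real^'n::finite \<Rightarrow> real^'n) \<Rightarrow> (real^'n \<Rightarrow> real^'n) \<Rightarrow> bool"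
  where "is_hodge_laplacian M g u w \<longleftrightarrow>
    (\<exists>a \<gamma>. is_codiff1 M g (flat g u) a \<and> is_codiff2 M g (ext_d1 (flat g u)) \<gamma> \<and>
      (\<forall>x\<in>M. w x = sharp g (\<lambda>y. - (ext_d0 a y + \<gamma> y)) x))"


section \<open>The Navier-Stokes equations and Leray-Hopf solutions\<close>

text \<open>At \<open>t = 0\<close> the time derivative is the one-sided one.\<close>

definition navier_stokes ::
    "(real^'n) set \<Rightarrow> (real^'n \<Rightarrow> real^'n^'n) \<Rightarrow> real \<Rightarrow> (real^'n::finite \<Rightarrow> real^'n) \<Rightarrow>
     (real \<Rightarrow> real^'n \<Rightarrow> real^'n) \<Rightarrow> (real \<Rightarrow> real^'n \<Rightarrow> real) \<Rightarrow> bool"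
  where "navier_stokes M g \<nu> u0 u p \<longleftrightarrow>
    (\<forall>t\<ge>0. \<exists>w. is_hodge_laplacian M g (u t) w \<and>
      (\<forall>x\<in>M. vector_derivative (\<lambda>s. u s x) (at t within {0..}) + cov_deriv g (u t) (u t) x
        - \<nu> *\<^sub>R w x + grad g (p t) x = 0)) \<and>
    (\<forall>t\<ge>0. \<forall>x\<in>M. divergence g (u t) x = 0) \<and>
    (\<forall>x\<in>M. u 0 x = u0 x)"

text \<open>Squared \<open>L\<^sup>2\<close> norms of vector fields and of covariant 2-tensors, with value \<open>\<infinity>\<close> if
  the field is not square integrable.\<close>

definition L2_sq_vec ::
    "(real^'n) set \<Rightarrow> (real^'n \<Rightarrow> real^'n^'n) \<Rightarrow> (real^'n::finite \<Rightarrow> real^'n) \<Rightarrow> ennreal"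
  where "L2_sq_vec M g u = (\<integral>\<^sup>+x. ennreal (vec_inner g x (u x) (u x)) \<partial>vol M g)"

definition L2_sq_tensor ::
    "(real^'n) set \<Rightarrow> (real^'n \<Rightarrow> real^'n^'n) \<Rightarrow> (real^'n::finite \<Rightarrow> real^'n^'n) \<Rightarrow> ennreal"
  where "L2_sq_tensor M g A = (\<integral>\<^sup>+x. ennreal (tensor_inner g x (A x) (A x)) \<partial>vol M g)"

text \<open>The first two conditions are \<open>u \<in> L\<^sup>\<infinity>([0,\<infinity>), L\<^sup>2)\<close> and \<open>u \<in> L\<^sup>2([0,\<infinity>), H\<^sup>1)\<close> (the
  homogeneous space) for smooth \<open>u\<close>, where measurability is automatic. Finiteness of the norm of
  \<open>u0\<close> is required explicitly so that the energy inequality cannot hold as \<open>\<infinity> \<le> \<infinity>\<close>.\<close>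

definition leray_hopf ::
    "(real^'n) set \<Rightarrow> (real^'n \<Rightarrow> real^'n^'n) \<Rightarrow> (real^'n::finite \<Rightarrow> real^'n) \<Rightarrow>
     (real \<Rightarrow> real^'n \<Rightarrow> real^'n) \<Rightarrow> bool"
  where "leray_hopf M g u0 u \<longleftrightarrow>
    (\<exists>C::real. AE t in lborel. t \<ge> 0 \<longrightarrow> L2_sq_vec M g (u t) \<le> ennreal C) \<and>
    (\<integral>\<^sup>+t\<in>{0..}. L2_sq_tensor M g (nabla_flat g (u t)) \<partial>lborel) < \<infinity> \<and>
    L2_sq_vec M g u0 < \<infinity> \<and>
    (\<forall>t\<ge>0. L2_sq_vec M g (u t)
        + 4 * (\<integral>\<^sup>+s\<in>{0..t}. L2_sq_tensor M g (deformation g (u s)) \<partial>lborel)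
      \<le> L2_sq_vec M g u0)"


section \<open>The Anderson manifold\<close>

text \<open>Rotating the half disc \<open>H \<union> L\<close> about \<open>L\<close> identifies the manifold with the open unit ball
  of \<open>\<real>\<^sup>3\<close>: the point \<open>(x + iy, \<theta>)\<close> of \<open>H \<times> S\<^sup>1\<close> becomes
  \<open>(x cos \<theta>, x sin \<theta>, y)\<close>, and \<open>L\<close>, where the circle collapses, becomes the
  part of the third axis in the ball.\<close>

definition anderson :: "(real^3) set"
  where "anderson = ball 0 1"

definition anderson_a :: real
  where "anderson_a = 2"

definition anderson_rho :: "real \<Rightarrow> real \<Rightarrow> real"
  where "anderson_rho x y = (1 / anderson_a) * arsinh (2 * x / (1 - (x\<^sup>2 + y\<^sup>2)))"

definition anderson_warp :: "real \<Rightarrow> real \<Rightarrow> real"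
  where "anderson_warp x y = sinh (anderson_rho x y)"

text \<open>The metric at \<open>q\<close> applied to \<open>v\<close> and \<open>w\<close>. Away from \<open>L\<close> it is the warped product
  metric, where \<open>dx\<close>, \<open>dy\<close>, \<open>d\<theta>\<close> are expressed in the coordinates of the ball. On
  \<open>L\<close> it is the continuous extension: the difference of the warped product metric and the conformal
  metric \<open>4 |dq|\<^sup>2 / (a\<^sup>2 (1 - |q|\<^sup>2)\<^sup>2)\<close> is
  \<open>x\<^sup>-\<^sup>4 (f\<^sup>2 - 4 x\<^sup>2 / (a\<^sup>2 (1 - |q|\<^sup>2)\<^sup>2)) (q\<^sub>1 dq\<^sub>2 - q\<^sub>2 dq\<^sub>1)\<^sup>2\<close>,
  whose coefficient is a smooth function across \<open>L\<close> and whose last factor vanishes on \<open>L\<close>.\<close>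

definition anderson_form :: "real^3 \<Rightarrow> real^3 \<Rightarrow> real^3 \<Rightarrow> real"
  where "anderson_form q v w =
    (let x = sqrt ((q$1)\<^sup>2 + (q$2)\<^sup>2);
         y = q$3;
         c = 4 / (anderson_a\<^sup>2 * (1 - (x\<^sup>2 + y\<^sup>2))\<^sup>2);
         dx = (\<lambda>v::real^3. (q$1 * v$1 + q$2 * v$2) / x);
         dy = (\<lambda>v::real^3. v$3);
         d\<theta> = (\<lambda>v::real^3. (q$1 * v$2 - q$2 * v$1) / x\<^sup>2)
     in if x = 0 then c * (v \<bullet> w)
        else c * (dx v * dx w + dy v * dy w) + (anderson_warp x y)\<^sup>2 * (d\<theta> v * d\<theta> w))"

definition anderson_metric :: "real^3 \<Rightarrow> real^3^3"
  where "anderson_metric q = (\<chi> i j. anderson_form q (axis i 1) (axis j 1))"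

text \<open>The pullback of the metric along \<open>(x, y, \<theta>) \<mapsto> (x cos \<theta>, x sin \<theta>, y)\<close> is the
  warped product metric; \<open>v\<close> is the image of the tangent vector with components
  \<open>x', y', \<theta>'\<close>.\<close>

lemma anderson_metric_polar:
  fixes x y \<theta> x' y' \<theta>' :: real
  assumes "x > 0"
  defines "q \<equiv> vector [x * cos \<theta>, x * sin \<theta>, y] :: real^3"
    and "v \<equiv> vector [x' * cos \<theta> - x * \<theta>' * sin \<theta>, x' * sin \<theta> + x * \<theta>' * cos \<theta>, y'] :: real^3"
  shows "vec_inner anderson_metric q v v =
    4 * (x'\<^sup>2 + y'\<^sup>2) / (anderson_a\<^sup>2 * (1 - (x\<^sup>2 + y\<^sup>2))\<^sup>2) + (anderson_warp x y)\<^sup>2 * \<theta>'\<^sup>2"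
proof -
  define s c where "s = sin \<theta>" and "c = cos \<theta>"
  have sc: "s * s + c * c = 1" unfolding s_def c_def
    using sin_cos_squared_add[of \<theta>] by (simp add: power2_eq_square)
  have "(x * c)\<^sup>2 + (x * s)\<^sup>2 = x\<^sup>2 * (s * s + c * c)" by (simp add: power2_eq_square algebra_simps)
  then have r: "(x * c)\<^sup>2 + (x * s)\<^sup>2 = x\<^sup>2" by (simp add: sc)
  have dx: "(x * c * (x' * c - x * \<theta>' * s) + x * s * (x' * s + x * \<theta>' * c)) / x = x'"
  proof -
    have "x * c * (x' * c - x * \<theta>' * s) + x * s * (x' * s + x * \<theta>' * c) = x * x' * (s * s + c * c)" by (simp add: algebra_simps)
    then show ?thesis using assms(1) by (simp add: sc)
  qed
  have dt: "(x * c * (x' * s + x * \<theta>' * c) - x * s * (x' * c - x * \<theta>' * s)) / x\<^sup>2 = \<theta>'"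
  proof -
    have "x * c * (x' * s + x * \<theta>' * c) - x * s * (x' * c - x * \<theta>' * s) = x^2 * \<theta>' * (s * s + c * c)" by (simp add: algebra_simps power2_eq_square)
    then show ?thesis using assms(1) by (simp add: sc)
  qed
  have bil: "vec_inner anderson_metric q v v = anderson_form q v v"
    unfolding vec_inner_def anderson_metric_def anderson_form_def Let_def
    by (simp add: sum_3 axis_def inner_vec_def add_divide_distrib diff_divide_distrib algebra_simps)
  show ?thesis unfolding bil unfolding anderson_form_def Let_def q_def v_def vector_3
    unfolding s_def[symmetric] c_def[symmetric] using assms(1)
    by (simp add: r dx dt power2_eq_square[symmetric])
qed

end

theory Submission
  imports Defs "HOL-Complex_Analysis.Cauchy_Integral_Formula"
begin

text \<open>If \<open>F\<close> is a harmonic function on \<open>M\<close>, then the fields \<open>u(t, x) = exp (-Ct) \<nabla>F(x)\<close> solve the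
  equations for every constant \<open>C\<close>. Their Hodge Laplacian vanishes, since they are curl free and
  divergence free; the time derivative is a gradient; and so is the convective term, which is the
  gradient of \<open>|u|\<^sup>2/2\<close>. Both are absorbed in the pressure. All these solutions have the same initial
  value \<open>\<nabla>F\<close>, and the energy inequality holds as soon as \<open>C \<ge> 2 \<parallel>Hess F\<parallel>\<^sup>2 / \<parallel>\<nabla>F\<parallel>\<^sup>2\<close>
  (\<open>decay_leray_hopf\<close>). The point is therefore that \<open>M\<close>, unlike Euclidean space, carries a harmonic
  function whose gradient is nonzero and square integrable together with its covariant derivative.

  The function is sought among the functions that are invariant under rotation about \<open>L\<close>. The
  conformal map \<open>artanh\<close> from the half disc to a strip, with coordinates \<open>s\<close> and \<open>\<tau> \<in> [0, \<pi>/4)\<close>,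
  turns the warping function into \<open>sin \<tau> / sqrt (cos 2\<tau>)\<close>, and with \<open>r = sin\<^sup>2 \<tau>\<close> the function \<open>F\<close> is
  harmonic if \<open>4r(1-r)(1-2r) F\<^sub>r\<^sub>r + (4-10r+8r\<^sup>2) F\<^sub>r + (1-2r) F\<^sub>s\<^sub>s = 0\<close>. This is solved by
  \<open>F = \<Sum>n. (-1)\<^sup>n a\<^sub>n(r) G\<^sup>(\<^sup>2\<^sup>n\<^sup>)(s)\<close>, where \<open>G(s) = exp (-s\<^sup>2)\<close>, \<open>a\<^sub>0 = 1\<close>, and \<open>a\<^sub>n\<^sub>+\<^sub>1\<close> arises from \<open>a\<^sub>n\<close> by
  two integrations from the axis \<open>r = 0\<close>. The functions \<open>a\<^sub>n\<close> are holomorphic near \<open>[0, 1/2)\<close>, which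
  gives smoothness across the axis. They and their first derivatives are at most \<open>K\<^sup>n/(2n)!\<close> up to a
  constant factor, uniformly up to the boundary \<open>r = 1/2\<close>, where the second derivatives grow at most
  like \<open>1/(1-2r)\<close> (\<open>mode_bound\<close>, \<open>real_mode_bound_uniform\<close>, \<open>real_mode_bound_second\<close>). Cauchy's
  inequality for \<open>G\<close> makes the series converge (\<open>strip_sol_has_derivative\<close>) and decay faster than
  any exponential as \<open>s\<close> tends to \<open>\<plusminus>\<infinity>\<close>, that is, at the end points of \<open>L\<close>.

  Let \<open>D = 1 - |q|\<^sup>2\<close> on the unit ball. The Euclidean gradient of \<open>F\<close> is bounded, so the Riemannian
  length of \<open>\<nabla>F\<close> is at most of order \<open>D\<close>; the same holds for its covariant derivative
  (\<open>mten_bound\<close>). Away from the end points of \<open>L\<close>, where the decay of \<open>F\<close> takes over, the volume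
  density is of order \<open>D\<^sup>-\<^sup>5\<^sup>/\<^sup>2\<close>, and \<open>D\<^sup>-\<^sup>1\<^sup>/\<^sup>2\<close> is integrable over the ball, so both energies are finite
  (\<open>gfield_energy\<close>). That \<open>F\<close> is harmonic in the weak sense used for the codifferential follows from
  the pointwise equation \<open>pot_pde\<close> and integration by parts (\<open>is_codiff1_gfield\<close>).\<close>

section \<open>Calculus of differentiable maps\<close>

lemma Ck_on_cong:
  assumes "open S" "\<And>x. x \<in> S \<Longrightarrow> f x = g x"
  shows "Ck_on k S f \<longleftrightarrow> Ck_on k S g"
proof -
  have "Ck_on k S f \<Longrightarrow> Ck_on k S g" if "\<And>x. x \<in> S \<Longrightarrow> f x = g x" for f g :: "'a \<Rightarrow> 'b"
    using that
  proof (induction k arbitrary: f g)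
    case 0
    then show ?case by (metis Ck_on.simps(1) continuous_on_cong)
  next
    case (Suc k)
    have fd: "(g has_derivative frechet_derivative f (at x)) (at x)" if "x \<in> S" for x
    proof -
      have "(f has_derivative frechet_derivative f (at x)) (at x)"
        using Suc.prems(1) that by (simp add: frechet_derivative_works)
      then show ?thesis
        by (rule has_derivative_transform_within_open[OF _ \<open>open S\<close> that Suc.prems(2)])
    qed
    then have eq: "frechet_derivative g (at x) = frechet_derivative f (at x)" if "x \<in> S" for x
      using frechet_derivative_at that by metis
    have "Ck_on k S (\<lambda>x. frechet_derivative g (at x) v)" for v
      by (rule Suc.IH[of "\<lambda>x. frechet_derivative f (at x) v"]) (use Suc.prems eq in auto)
    then show ?case using fd by (auto simp: differentiable_def)
  qed
  then show ?thesis using assms by metis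
qed

lemma Ck_on_SucI:
  assumes "open S" "\<And>x. x \<in> S \<Longrightarrow> (f has_derivative f' x) (at x)"
    and "\<And>v. Ck_on k S (\<lambda>x. f' x v)"
  shows "Ck_on (Suc k) S f"
proof -
  have "frechet_derivative f (at x) = f' x" if "x \<in> S" for x
    using frechet_derivative_at assms(2) that by metis
  then have "Ck_on k S (\<lambda>x. frechet_derivative f (at x) v)" for v
    using Ck_on_cong[OF assms(1), of "\<lambda>x. frechet_derivative f (at x) v" "\<lambda>x. f' x v"] assms(3) by simp
  then show ?thesis using assms(2) by (auto simp: differentiable_def)
qed

lemma Ck_on_Suc_has_derivative:
  "Ck_on (Suc k) S f \<Longrightarrow> x \<in> S \<Longrightarrow> (f has_derivative frechet_derivative f (at x)) (at x)"
  by (simp add: frechet_derivative_works)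

lemma Ck_on_SucD: "Ck_on (Suc k) S f \<Longrightarrow> Ck_on k S f"
proof (induction k arbitrary: f)
  case 0
  then show ?case
    by (auto simp: continuous_on_eq_continuous_within dest!: differentiable_imp_continuous_within
        intro: continuous_within_subset)
next
  case (Suc k)
  then show ?case by simp
qed

lemma Ck_on_subset: "Ck_on k T f \<Longrightarrow> S \<subseteq> T \<Longrightarrow> Ck_on k S f"
  by (induction k arbitrary: f) (auto intro: continuous_on_subset)

lemma Ck_on_const: "open S \<Longrightarrow> Ck_on k S (\<lambda>x. c)"
  by (induction k arbitrary: c) (auto intro!: Ck_on_SucI[where f'="\<lambda>x v. 0"] simp del: Ck_on.simps(2))

lemma Ck_on_bounded_linear_image:
  assumes "bounded_linear L" "open S"
  shows "Ck_on k S f \<Longrightarrow> Ck_on k S (\<lambda>x. L (f x))"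
proof (induction k arbitrary: f)
  case 0
  then show ?case using assms by (simp add: bounded_linear.continuous_on)
next
  case (Suc k)
  have "Ck_on k S (\<lambda>x. L (frechet_derivative f (at x) v))" for v
    by (rule Suc.IH) (use Suc.prems in auto)
  then show ?case
    using bounded_linear.has_derivative[OF assms(1) Ck_on_Suc_has_derivative[OF Suc.prems]]
    by (intro Ck_on_SucI[OF assms(2)]) auto
qed

lemma Ck_on_add:
  assumes "open S"
  shows "Ck_on k S f \<Longrightarrow> Ck_on k S g \<Longrightarrow> Ck_on k S (\<lambda>x. f x + g x)"
proof (induction k arbitrary: f g)
  case 0
  then show ?case by (simp add: continuous_on_add)
next
  case (Suc k)
  have "Ck_on k S (\<lambda>x. frechet_derivative f (at x) v + frechet_derivative g (at x) v)" for v
    by (rule Suc.IH) (use Suc.prems in auto)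
  then show ?case
    using has_derivative_add[OF Ck_on_Suc_has_derivative[OF Suc.prems(1)] Ck_on_Suc_has_derivative[OF Suc.prems(2)]]
    by (intro Ck_on_SucI[OF assms]) auto
qed

lemma Ck_on_bilinear:
  assumes "bounded_bilinear h" "open S"
  shows "Ck_on k S f \<Longrightarrow> Ck_on k S g \<Longrightarrow> Ck_on k S (\<lambda>x. h (f x) (g x))"
proof (induction k arbitrary: f g)
  case 0
  then show ?case using assms by (simp add: bounded_bilinear.continuous_on)
next
  case (Suc k)
  have "Ck_on k S (\<lambda>x. h (f x) (frechet_derivative g (at x) v) + h (frechet_derivative f (at x) v) (g x))" for v
    by (intro Ck_on_add[OF assms(2)] Suc.IH)
      (use Suc.prems Ck_on_SucD in auto)
  then show ?case
    using bounded_bilinear.FDERIV[OF assms(1) Ck_on_Suc_has_derivative[OF Suc.prems(1)] Ck_on_Suc_has_derivative[OF Suc.prems(2)]]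
    by (intro Ck_on_SucI[OF assms(2)]) auto
qed

lemma Ck_on_compose_linear:
  assumes "bounded_linear L" "open S" "open T" "L ` T \<subseteq> S"
  shows "Ck_on k S f \<Longrightarrow> Ck_on k T (\<lambda>x. f (L x))"
proof (induction k arbitrary: f)
  case 0
  then show ?case
    using continuous_on_compose2[of S f T L] assms by (simp add: linear_continuous_on)
next
  case (Suc k)
  have "Ck_on k T (\<lambda>x. frechet_derivative f (at (L x)) (L v))" for v
    by (rule Suc.IH) (use Suc.prems in auto)
  moreover have "((\<lambda>x. f (L x)) has_derivative (\<lambda>v. frechet_derivative f (at (L x)) (L v))) (at x)"
    if "x \<in> T" for x
    using has_derivative_compose[OF bounded_linear_imp_has_derivative[OF assms(1)] Ck_on_Suc_has_derivative[OF Suc.prems]]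
      assms(4) that by blast
  ultimately show ?case by (intro Ck_on_SucI[OF assms(3)]) auto
qed

lemma Ck_on_powr:
  fixes f :: "'a::real_normed_vector \<Rightarrow> real"
  assumes "open S" "\<And>x. x \<in> S \<Longrightarrow> f x > 0"
  shows "Ck_on k S f \<Longrightarrow> Ck_on k S (\<lambda>x. f x powr p)"
proof (induction k arbitrary: p)
  case 0
  then show ?case using assms(2) by (auto intro!: continuous_intros simp: less_imp_neq[symmetric])
next
  case (Suc k)
  have "Ck_on k S (\<lambda>x. (p * (f x powr (p - 1))) * frechet_derivative f (at x) v)" for v
    using Suc
    by (intro Ck_on_bilinear[OF bounded_bilinear_mult assms(1)] Ck_on_const[OF assms(1)] Suc.IH) (auto dest: Ck_on_SucD simp del: Ck_on.simps(2), simp)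
  moreover have "((\<lambda>x. f x powr p) has_derivative (\<lambda>v. (p * (f x powr (p - 1))) * frechet_derivative f (at x) v)) (at x)"
    if "x \<in> S" for x
  proof -
    have "((\<lambda>z. z powr p) has_derivative (\<lambda>h. (p * (f x powr (p - 1))) * h)) (at (f x))"
      using has_real_derivative_powr[OF assms(2)[OF that], of p] by (simp add: has_field_derivative_def)
    from has_derivative_compose[OF Ck_on_Suc_has_derivative[OF Suc.prems that] this]
    show ?thesis .
  qed
  ultimately show ?case by (intro Ck_on_SucI[OF assms(1)]) auto
qed

lemma Ck_on_ln:
  fixes f :: "'a::real_normed_vector \<Rightarrow> real"
  assumes "open S" "\<And>x. x \<in> S \<Longrightarrow> f x > 0" "Ck_on k S f"
  shows "Ck_on k S (\<lambda>x. ln (f x))"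
proof (cases k)
  case 0
  then show ?thesis using assms by (auto intro!: continuous_intros simp: less_imp_neq[symmetric])
next
  case (Suc j)
  have "Ck_on j S (\<lambda>x. (f x powr (-1)) * frechet_derivative f (at x) v)" for v
    using assms Suc
    by (intro Ck_on_bilinear[OF bounded_bilinear_mult assms(1)] Ck_on_powr[OF assms(1)])
      (auto dest: Ck_on_SucD simp del: Ck_on.simps(2), simp)
  moreover have "((\<lambda>x. ln (f x)) has_derivative (\<lambda>v. (f x powr (-1)) * frechet_derivative f (at x) v)) (at x)"
    if "x \<in> S" for x
  proof -
    have "(ln has_derivative (\<lambda>h. (f x powr (-1)) * h)) (at (f x))"
      using DERIV_ln[OF assms(2)[OF that]] assms(2)[OF that]
      by (simp add: has_field_derivative_def powr_minus)
    moreover have "(f has_derivative frechet_derivative f (at x)) (at x)"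
      using assms Suc that Ck_on_Suc_has_derivative by blast
    ultimately show ?thesis using has_derivative_compose by fastforce
  qed
  ultimately show ?thesis unfolding Suc by (intro Ck_on_SucI[OF assms(1)]) auto
qed

lemma Ck_on_vec:
  fixes f :: "'a::real_normed_vector \<Rightarrow> real^'n"
  assumes "open S" "\<And>i. Ck_on k S (\<lambda>x. f x $ i)"
  shows "Ck_on k S f"
proof -
  have "Ck_on k S (\<lambda>x. \<Sum>i\<in>A. (f x $ i) *\<^sub>R axis i (1::real))" if "finite A" for A
    using that
  proof (induction A)
    case empty
    show ?case using Ck_on_const[OF assms(1)] by simp
  next
    case (insert i A)
    then show ?case
      using Ck_on_add[OF assms(1) Ck_on_bounded_linear_image[OF bounded_linear_scaleR_left assms(1) assms(2)]] by simp
  qed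
  from this[of UNIV] have "Ck_on k S (\<lambda>x. \<Sum>i\<in>UNIV. (f x $ i) *\<^sub>R axis i (1::real))" by simp
  moreover have "(\<Sum>i\<in>UNIV. (f x $ i) *\<^sub>R axis i (1::real)) = f x" for x
    using basis_expansion[of "f x"] by (simp add: scalar_mult_eq_scaleR)
  ultimately show ?thesis by simp
qed

text \<open>A family of functions that contains the partial derivatives of its members is smooth: each
  differentiation of a composition leads back to the family, so one induction on the order serves
  all members at once.\<close>

lemma Ck_on_two_variable_family:
  fixes \<Psi> :: "nat \<Rightarrow> nat \<Rightarrow> real \<times> real \<Rightarrow> real" and s r :: "'a::real_normed_vector \<Rightarrow> real"
  assumes "open S"
    and \<Psi>: "\<And>i j z. z \<in> T \<Longrightarrow> (\<Psi> i j has_derivative (\<lambda>h. \<Psi> (Suc i) j z * fst h + \<Psi> i (Suc j) z * snd h)) (at z)"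
    and T: "\<And>x. x \<in> S \<Longrightarrow> (s x, r x) \<in> T"
    and sm: "\<And>k. Ck_on k S s" "\<And>k. Ck_on k S r"
  shows "Ck_on k S (\<lambda>x. \<Psi> i j (s x, r x))"
proof -
  have der: "((\<lambda>x. \<Psi> i j (s x, r x)) has_derivative
       (\<lambda>v. \<Psi> (Suc i) j (s x, r x) * frechet_derivative s (at x) v + \<Psi> i (Suc j) (s x, r x) * frechet_derivative r (at x) v)) (at x)"
    if "x \<in> S" for x i j
    using has_derivative_compose[OF has_derivative_Pair[OF Ck_on_Suc_has_derivative[OF sm(1) that] Ck_on_Suc_has_derivative[OF sm(2) that]] \<Psi>[OF T[OF that]]]
    by simp
  show ?thesis
  proof (induction k arbitrary: i j)
    case 0
    show ?case
      by (auto simp: continuous_on_eq_continuous_within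
          intro!: continuous_at_imp_continuous_at_within has_derivative_continuous[OF der])
  next
    case (Suc k)
    have d: "Ck_on k S (\<lambda>x. frechet_derivative s (at x) v)" "Ck_on k S (\<lambda>x. frechet_derivative r (at x) v)" for v
      using sm[of "Suc k"] by auto
    show ?case
      by (intro Ck_on_SucI[OF assms(1) der] Ck_on_add[OF assms(1)] Ck_on_bilinear[OF bounded_bilinear_mult assms(1)] Suc.IH d)
  qed
qed

section \<open>Separated solutions near the axis\<close>

text \<open>The primitive of \<open>f\<close> that vanishes at 0 is \<open>z * ray_average f z\<close>. Written in this way it can
  be divided by \<open>z\<close>.\<close>

definition ray_average :: "(complex \<Rightarrow> complex) \<Rightarrow> complex \<Rightarrow> complex" where
  "ray_average f z = integral {0..1::real} (\<lambda>x. f (of_real x * z))"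

lemma ray_in_ball:
  fixes z :: complex
  assumes "z \<in> ball 0 r" "x \<in> {0..1::real}"
  shows "of_real x * z \<in> ball 0 r"
proof -
  have "\<bar>x\<bar> * cmod z \<le> 1 * cmod z" using assms(2) by (intro mult_right_mono) auto
  then show ?thesis using assms(1) by (simp add: norm_mult)
qed

lemma continuous_on_ray:
  fixes z :: complex
  assumes "f holomorphic_on ball 0 r" "z \<in> ball 0 r"
  shows "continuous_on {0..1::real} (\<lambda>x. f (of_real x * z))"
  by (rule continuous_on_compose2[OF holomorphic_on_imp_continuous_on[OF assms(1)]])
    (use ray_in_ball[OF assms(2)] in \<open>auto intro!: continuous_intros\<close>)

lemma ray_average_holomorphic:
  assumes f: "f holomorphic_on ball 0 r"
  shows "ray_average f holomorphic_on ball 0 r"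
proof -
  have "(\<lambda>z. integral (cbox 0 1) (\<lambda>x::real. f (of_real x * z))) holomorphic_on ball 0 r"
  proof (rule leibniz_rule_holomorphic[where fx="\<lambda>z x. deriv f (of_real x * z) * of_real x"])
    fix z :: complex and x :: real assume z: "z \<in> ball 0 r" and x: "x \<in> cbox 0 1"
    have "(f has_field_derivative deriv f (of_real x * z)) (at (of_real x * z))"
      using holomorphic_derivI[OF f open_ball ray_in_ball[OF z]] x by simp
    then have "((\<lambda>z. f (of_real x * z)) has_field_derivative deriv f (of_real x * z) * of_real x) (at z)"
      by (rule DERIV_chain2) (auto intro!: derivative_eq_intros)
    then show "((\<lambda>z. f (of_real x * z)) has_field_derivative deriv f (of_real x * z) * of_real x) (at z within ball 0 r)"
      by (rule has_field_derivative_at_within)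
  next
    fix z :: complex assume "z \<in> ball 0 r"
    then show "(\<lambda>x::real. f (of_real x * z)) integrable_on cbox 0 1"
      using continuous_on_ray[OF f] by (intro integrable_continuous) auto
  next
    have "deriv f holomorphic_on ball 0 r" using f by (simp add: holomorphic_deriv)
    then have c: "continuous_on (ball 0 r) (deriv f)" by (rule holomorphic_on_imp_continuous_on)
    have "continuous_on (ball 0 r \<times> cbox (0::real) 1) (\<lambda>p. deriv f (of_real (snd p) * fst p))"
    proof (rule continuous_on_compose2[OF c])
      show "continuous_on (ball 0 r \<times> cbox (0::real) 1) (\<lambda>p. of_real (snd p) * fst p :: complex)"
        by (intro continuous_intros)
      show "(\<lambda>p. of_real (snd p) * fst p) ` (ball 0 r \<times> cbox (0::real) 1) \<subseteq> ball (0::complex) r"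
        using ray_in_ball by fastforce
    qed
    then have "continuous_on (ball 0 r \<times> cbox (0::real) 1) (\<lambda>p. deriv f (of_real (snd p) * fst p) * of_real (snd p))"
      by (intro continuous_intros)
    then show "continuous_on (ball 0 r \<times> cbox (0::real) 1) (\<lambda>(z, x). deriv f (of_real x * z) * of_real x)"
      by (simp add: case_prod_unfold)
  qed auto
  then show ?thesis by (simp add: ray_average_def[abs_def])
qed

lemma DERIV_mult_ray_average:
  assumes f: "f holomorphic_on ball 0 r" and z: "z \<in> ball 0 r"
  shows "((\<lambda>z. z * ray_average f z) has_field_derivative f z) (at z)"
proof -
  obtain P where "\<And>z. z \<in> ball 0 r \<Longrightarrow> (P has_field_derivative f z) (at z within ball 0 r)"
    using holomorphic_convex_primitive'[OF convex_ball open_ball f] by blast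
  then have P: "\<And>z. z \<in> ball 0 r \<Longrightarrow> (P has_field_derivative f z) (at z)"
    using at_within_open[OF _ open_ball] by metis
  have eq: "w * ray_average f w = P w - P 0" if w: "w \<in> ball 0 r" for w
  proof -
    have "((\<lambda>x. f (of_real x * w) * w) has_integral P (of_real 1 * w) - P (of_real 0 * w)) {0..1::real}"
    proof (rule fundamental_theorem_of_calculus)
      fix x :: real assume x: "x \<in> {0..1}"
      have "((\<lambda>x. of_real x * w) has_vector_derivative w) (at x within {0..1})"
        by (auto intro!: derivative_eq_intros)
      from field_vector_diff_chain_within[OF this has_field_derivative_at_within[OF P[OF ray_in_ball[OF w x]]]]
      show "((\<lambda>x. P (of_real x * w)) has_vector_derivative f (of_real x * w) * w) (at x within {0..1})"
        by (simp add: o_def mult.commute)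
    qed auto
    then have "integral {0..1::real} (\<lambda>x. f (of_real x * w) * w) = P w - P 0" by (auto dest: integral_unique)
    then show ?thesis by (simp add: ray_average_def mult.commute)
  qed
  have "((\<lambda>z. P z - P 0) has_field_derivative f z) (at z)"
    using P[OF z] by (auto intro!: derivative_eq_intros)
  then show ?thesis
    by (rule has_field_derivative_transform_within_open[OF _ open_ball z]) (simp add: eq)
qed

text \<open>Averaging \<open>x ^ n\<close> over the unit interval gains the factor \<open>1 / (n + 1)\<close>; these factors make
  the sequence of separated solutions decay factorially.\<close>

lemma norm_ray_average_le:
  assumes f: "f holomorphic_on ball 0 r" and z: "z \<in> ball 0 r"
    and b: "\<And>x. x \<in> {0..1::real} \<Longrightarrow> cmod (f (of_real x * z)) \<le> B * x ^ n"
  shows "cmod (ray_average f z) \<le> B / (real n + 1)"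
proof -
  have i: "((\<lambda>x. B * x ^ n) has_integral B * (1 ^ Suc n / Suc n) - B * (0 ^ Suc n / Suc n)) {0..1::real}"
    by (rule fundamental_theorem_of_calculus)
      (auto intro!: derivative_eq_intros simp: has_real_derivative_iff_has_vector_derivative[symmetric] simp del: power_Suc)
  have "cmod (ray_average f z) \<le> integral {0..1} (\<lambda>x. B * x ^ n)"
    unfolding ray_average_def
    by (rule integral_norm_bound_integral)
      (use i continuous_on_ray[OF f z] b in \<open>auto intro: integrable_continuous_interval simp: has_integral_integrable\<close>)
  also have "\<dots> = B / (real n + 1)" using integral_unique[OF i] by simp
  finally show ?thesis .
qed

text \<open>The two integrating factors of the operator \<open>4z(1-z)(1-2z) d\<^sup>2/dz\<^sup>2 + (4-10z+8z\<^sup>2) d/dz\<close>: up to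
  the factor \<open>1-2z\<close> it sends \<open>a\<close> to \<open>weight_in\<^sup>-\<^sup>1 d/dz (4z weight_out\<^sup>-\<^sup>1 da/dz)\<close>.\<close>

definition weight_out :: "complex \<Rightarrow> complex" where
  "weight_out z = csqrt (1 - 2 * z) / csqrt (1 - z)"

definition weight_in :: "complex \<Rightarrow> complex" where
  "weight_in z = 1 / (csqrt (1 - 2 * z) * csqrt (1 - z))"

lemma half_disc_slit:
  assumes "z \<in> ball 0 (1/2)"
  shows "1 - 2 * z \<notin> \<real>\<^sub>\<le>\<^sub>0" "1 - z \<notin> \<real>\<^sub>\<le>\<^sub>0" "csqrt (1 - 2 * z) \<noteq> 0" "csqrt (1 - z) \<noteq> 0"
    "1 - 2 * z \<noteq> 0" "1 - z \<noteq> 0"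
proof -
  have "Re z < 1/2" using assms complex_Re_le_cmod[of z] by simp
  then show a: "1 - 2 * z \<notin> \<real>\<^sub>\<le>\<^sub>0" "1 - z \<notin> \<real>\<^sub>\<le>\<^sub>0" by (auto simp: complex_nonpos_Reals_iff)
  then show b: "1 - 2 * z \<noteq> 0" "1 - z \<noteq> 0" by auto
  then show "csqrt (1 - 2 * z) \<noteq> 0" "csqrt (1 - z) \<noteq> 0" by auto
qed

lemma weight_holomorphic:
  "weight_out holomorphic_on ball 0 (1/2)" "weight_in holomorphic_on ball 0 (1/2)"
  unfolding weight_out_def[abs_def] weight_in_def[abs_def]
  using half_disc_slit by (auto intro!: holomorphic_intros)

lemma weight_out_times_in:
  "z \<in> ball 0 (1/2) \<Longrightarrow> weight_out z * weight_in z = 1 / (1 - z)"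
  using half_disc_slit[of z] power2_csqrt[of "1 - z"]
  by (simp add: weight_out_def weight_in_def power2_eq_square)

lemma DERIV_weight_out:
  assumes "z \<in> ball 0 (1/2)"
  shows "(weight_out has_field_derivative weight_out z * (1 / (2 * (1 - z)) - 1 / (1 - 2 * z))) (at z)"
proof -
  note h = half_disc_slit[OF assms]
  define p q where "p = csqrt (1 - 2 * z)" and "q = csqrt (1 - z)"
  have pq: "1 - 2 * z = p\<^sup>2" "1 - z = q\<^sup>2" "p \<noteq> 0" "q \<noteq> 0" using h by (auto simp: p_def q_def)
  have "(weight_out has_field_derivative
      ((- 2 * (1 / (2 * csqrt (1 - 2 * z)))) * csqrt (1 - z) - csqrt (1 - 2 * z) * (- (1 / (2 * csqrt (1 - z)))))
        / (csqrt (1 - z) * csqrt (1 - z))) (at z)"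
    unfolding weight_out_def[abs_def]
    by (rule DERIV_divide)
     (use h in \<open>auto intro!: derivative_eq_intros simp: field_simps\<close>)
  also have "((- 2 * (1 / (2 * csqrt (1 - 2 * z)))) * csqrt (1 - z) - csqrt (1 - 2 * z) * (- (1 / (2 * csqrt (1 - z)))))
        / (csqrt (1 - z) * csqrt (1 - z)) = weight_out z * (1 / (2 * (1 - z)) - 1 / (1 - 2 * z))"
    unfolding weight_out_def unfolding p_def[symmetric] q_def[symmetric] unfolding pq(1,2)
    using pq(3,4) by (simp add: field_simps power2_eq_square)
  finally show ?thesis .
qed

text \<open>The solution of the equation \<open>mode_ode\<close> that is holomorphic at 0, where the equation has a
  singular point. Inverting the operator amounts to two integrations from 0, and the division by \<open>z\<close>
  between them is absorbed in the averages.\<close>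

primrec mode :: "nat \<Rightarrow> complex \<Rightarrow> complex" where
  "mode 0 = (\<lambda>z. 1)"
| "mode (Suc n) = (\<lambda>z. z * ray_average (\<lambda>w. weight_out w / 4 * ray_average (\<lambda>v. weight_in v * mode n v) w) z)"

declare mode.simps(2) [simp del]

lemma mode_holomorphic: "mode n holomorphic_on ball 0 (1/2)"
  by (induction n)
    (auto simp: mode.simps(2) intro!: holomorphic_intros ray_average_holomorphic weight_holomorphic)

lemma DERIV_mode_Suc:
  assumes "z \<in> ball 0 (1/2)"
  shows "(mode (Suc n) has_field_derivative
    weight_out z / 4 * ray_average (\<lambda>v. weight_in v * mode n v) z) (at z)"
  unfolding mode.simps
  by (rule DERIV_mult_ray_average[OF _ assms])
    (auto intro!: holomorphic_intros ray_average_holomorphic weight_holomorphic mode_holomorphic)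

lemma mode_0: "mode n 0 = (if n = 0 then 1 else 0)"
  by (cases n) (auto simp: mode.simps(2))

text \<open>Multiplied by \<open>z\<close>, the derivative of \<open>mode (Suc n)\<close> is \<open>weight_out / 4\<close> times the primitive of
  \<open>weight_in * mode n\<close>. Differentiating this product and eliminating the primitive leaves the
  equation, because the product of the weights is \<open>1 / (1 - z)\<close>.\<close>

lemma mode_ode:
  assumes z: "z \<in> ball 0 (1/2)"
  shows "4 * z * (1 - z) * (1 - 2 * z) * (deriv ^^ 2) (mode (Suc n)) z
     + (4 - 10 * z + 8 * z\<^sup>2) * deriv (mode (Suc n)) z = (1 - 2 * z) * mode n z"
proof -
  define R where "R = ray_average (\<lambda>v. weight_in v * mode n v)"
  have hol: "(\<lambda>v. weight_in v * mode n v) holomorphic_on ball 0 (1/2)"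
    using mode_holomorphic[of n] weight_holomorphic by (auto intro!: holomorphic_intros)
  have d1: "deriv (mode (Suc n)) w = weight_out w / 4 * R w" if "w \<in> ball 0 (1/2)" for w
    unfolding R_def using DERIV_imp_deriv[OF DERIV_mode_Suc[OF that]] .
  have dR: "((\<lambda>w. w * R w) has_field_derivative weight_in z * mode n z) (at z)"
    unfolding R_def by (rule DERIV_mult_ray_average[OF hol z])
  define d2 where "d2 = (deriv ^^ 2) (mode (Suc n)) z"
  have "(deriv (mode (Suc n)) has_field_derivative d2) (at z)"
    using has_field_derivative_higher_deriv[OF mode_holomorphic open_ball z, of 1] by (simp add: d2_def numeral_2_eq_2)
  from DERIV_mult[OF DERIV_ident this]
  have D1: "((\<lambda>w. w * deriv (mode (Suc n)) w) has_field_derivative deriv (mode (Suc n)) z + d2 * z) (at z)" by simp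
  have "((\<lambda>w. weight_out w / 4 * (w * R w)) has_field_derivative
       weight_out z * (1 / (2 * (1 - z)) - 1 / (1 - 2 * z)) / 4 * (z * R z) + weight_in z * mode n z * (weight_out z / 4)) (at z)"
    by (rule DERIV_mult[OF DERIV_cdivide[OF DERIV_weight_out[OF z]] dR])
  then have D2: "((\<lambda>w. w * deriv (mode (Suc n)) w) has_field_derivative
       weight_out z * (1 / (2 * (1 - z)) - 1 / (1 - 2 * z)) / 4 * (z * R z) + weight_in z * mode n z * (weight_out z / 4)) (at z)"
    by (rule has_field_derivative_transform_within_open[OF _ open_ball z]) (simp add: d1)
  define d where "d = deriv (mode (Suc n)) z"
  have "d + d2 * z = weight_out z / 4 * R z * z * (1 / (2 * (1 - z)) - 1 / (1 - 2 * z)) + weight_out z * weight_in z * mode n z / 4"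
    using DERIV_unique[OF D1 D2] by (simp add: d_def mult_ac)
  then have e: "d + d2 * z = d * z * (1 / (2 * (1 - z)) - 1 / (1 - 2 * z)) + mode n z / (4 * (1 - z))"
    unfolding weight_out_times_in[OF z] d1[OF z, symmetric] d_def[symmetric] by simp
  have nz: "1 - z \<noteq> 0" "1 - 2 * z \<noteq> 0" using half_disc_slit[OF z] by auto
  have "4 * (1 - z) * (1 - 2 * z) * (d + d2 * z) =
      2 * d * z * (1 - 2 * z) - 4 * d * z * (1 - z) + mode n z * (1 - 2 * z)"
    unfolding e using nz by (simp add: divide_simps) (simp add: algebra_simps)
  then show ?thesis unfolding d_def[symmetric] d2_def[symmetric] by (simp add: algebra_simps power2_eq_square)
qed

text \<open>Each step of the recursion involves the weights only through a product of \<open>weight_out\<close> at a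
  point and \<open>weight_in\<close> at a point between it and 0. A bound for such products on a star-shaped set
  suffices, even if \<open>weight_in\<close> itself is unbounded there.\<close>

lemma mode_bound:
  assumes K: "K \<ge> 0" and S: "S \<subseteq> ball 0 (1/2)"
    and star: "\<And>z x. z \<in> S \<Longrightarrow> x \<in> {0..1::real} \<Longrightarrow> of_real x * z \<in> S"
    and w: "\<And>z x. z \<in> S \<Longrightarrow> x \<in> {0..1::real} \<Longrightarrow> cmod (weight_out z * weight_in (of_real x * z)) \<le> K"
  shows "z \<in> S \<Longrightarrow> cmod (mode n z) \<le> (K * cmod z) ^ n / (4 ^ n * (fact n)\<^sup>2)"
    and "z \<in> S \<Longrightarrow> cmod (deriv (mode (Suc n)) z) \<le> K / 4 * (K * cmod z) ^ n / (4 ^ n * (fact n)\<^sup>2) / (real n + 1)"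
proof -
  have step: "cmod (weight_out z / 4 * ray_average (\<lambda>v. weight_in v * mode n v) z)
      \<le> K / 4 * (K * cmod z) ^ n / (4 ^ n * (fact n)\<^sup>2) / (real n + 1)"
    if z: "z \<in> S" and IH: "\<And>z. z \<in> S \<Longrightarrow> cmod (mode n z) \<le> (K * cmod z) ^ n / (4 ^ n * (fact n)\<^sup>2)" for z n
  proof -
    have hol: "(\<lambda>v. weight_out z * (weight_in v * mode n v)) holomorphic_on ball 0 (1/2)"
      using mode_holomorphic[of n] weight_holomorphic by (auto intro!: holomorphic_intros)
    have "cmod (ray_average (\<lambda>v. weight_out z * (weight_in v * mode n v)) z)
       \<le> (K * ((K * cmod z) ^ n / (4 ^ n * (fact n)\<^sup>2))) / (real n + 1)"
    proof (rule norm_ray_average_le[OF hol])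
      show "z \<in> ball 0 (1/2)" using z S by auto
      fix x :: real assume x: "x \<in> {0..1}"
      have "cmod (mode n (of_real x * z)) \<le> (K * cmod z) ^ n / (4 ^ n * (fact n)\<^sup>2) * x ^ n"
        using IH[OF star[OF z x]] x by (simp add: norm_mult power_mult_distrib mult_ac)
      then have "cmod (weight_out z * weight_in (of_real x * z)) * cmod (mode n (of_real x * z))
        \<le> K * ((K * cmod z) ^ n / (4 ^ n * (fact n)\<^sup>2) * x ^ n)"
        using w[OF z x] K by (intro mult_mono) auto
      then show "cmod (weight_out z * (weight_in (of_real x * z) * mode n (of_real x * z)))
        \<le> (K * ((K * cmod z) ^ n / (4 ^ n * (fact n)\<^sup>2))) * x ^ n"
        by (simp add: norm_mult mult.assoc)
    qed
    moreover have "ray_average (\<lambda>v. weight_out z * (weight_in v * mode n v)) z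
        = weight_out z * ray_average (\<lambda>v. weight_in v * mode n v) z"
      by (simp add: ray_average_def)
    ultimately show ?thesis by (simp add: norm_mult norm_divide)
  qed
  have main: "\<forall>z\<in>S. cmod (mode n z) \<le> (K * cmod z) ^ n / (4 ^ n * (fact n)\<^sup>2)" for n
  proof (induction n)
    case 0
    show ?case by simp
  next
    case (Suc n)
    show ?case
    proof
      fix z assume z: "z \<in> S"
      define f where "f = (\<lambda>w. weight_out w / 4 * ray_average (\<lambda>v. weight_in v * mode n v) w)"
      define B where "B = K / 4 * (K * cmod z) ^ n / (4 ^ n * (fact n)\<^sup>2) / (real n + 1)"
      have hol: "f holomorphic_on ball 0 (1/2)" unfolding f_def
        using mode_holomorphic[of n] weight_holomorphic by (auto intro!: holomorphic_intros ray_average_holomorphic)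
      have "cmod (ray_average f z) \<le> B / (real n + 1)"
      proof (rule norm_ray_average_le[OF hol])
        show "z \<in> ball 0 (1/2)" using z S by auto
        fix x :: real assume x: "x \<in> {0..1}"
        show "cmod (f (of_real x * z)) \<le> B * x ^ n"
          using step[OF star[OF z x]] Suc x by (simp add: f_def B_def norm_mult power_mult_distrib mult_ac)
      qed
      then have "cmod (mode (Suc n) z) \<le> cmod z * (B / (real n + 1))"
        by (simp only: mode.simps f_def[symmetric] norm_mult mult_left_mono norm_ge_zero)
      also have "\<dots> = (K * cmod z) ^ Suc n / (4 ^ Suc n * (fact (Suc n))\<^sup>2)"
        unfolding B_def by (simp add: field_simps power2_eq_square)
      finally show "cmod (mode (Suc n) z) \<le> (K * cmod z) ^ Suc n / (4 ^ Suc n * (fact (Suc n))\<^sup>2)" .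
    qed
  qed
  then show "z \<in> S \<Longrightarrow> cmod (mode n z) \<le> (K * cmod z) ^ n / (4 ^ n * (fact n)\<^sup>2)" by blast
  show "cmod (deriv (mode (Suc n)) z) \<le> K / 4 * (K * cmod z) ^ n / (4 ^ n * (fact n)\<^sup>2) / (real n + 1)" if "z \<in> S"
  proof -
    have "z \<in> ball 0 (1/2)" using that S by auto
    note d = DERIV_imp_deriv[OF DERIV_mode_Suc[OF this], of n]
    show ?thesis unfolding d by (rule step[OF that]) (use main in blast)
  qed
qed

section \<open>Bounds for the separated solutions and for derivatives of the Gaussian\<close>

lemma has_field_derivative_Re_of_real:
  assumes "(f has_field_derivative f') (at (of_real x))"
  shows "((\<lambda>x::real. Re (f (of_real x))) has_field_derivative Re f') (at x)"
  using has_field_derivative_Re[OF has_vector_derivative_real_field[OF assms]] .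

lemma DERIV_iterated_deriv:
  assumes "f holomorphic_on S" "open S" "z \<in> S"
  shows "((deriv ^^ n) f has_field_derivative (deriv ^^ Suc n) f z) (at z)"
  using holomorphic_derivI[OF holomorphic_higher_deriv[OF assms(1,2)] assms(2,3), of n] by simp

text \<open>The potential has to be a real function. Real parts inherit every linear equation with real
  coefficients.\<close>

definition real_mode :: "nat \<Rightarrow> nat \<Rightarrow> real \<Rightarrow> real" where
  "real_mode j n r = Re ((deriv ^^ j) (mode n) (of_real r))"

lemma DERIV_real_mode:
  assumes "\<bar>r\<bar> < 1/2"
  shows "(real_mode j n has_field_derivative real_mode (Suc j) n r) (at r)"
  unfolding real_mode_def[abs_def]
  by (rule has_field_derivative_Re_of_real[OF DERIV_iterated_deriv[OF mode_holomorphic open_ball]])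
    (use assms in simp)

lemma real_mode_0: "real_mode 0 n 0 = (if n = 0 then 1 else 0)"
  by (simp add: real_mode_def mode_0)

lemma real_mode_ode:
  assumes "\<bar>r\<bar> < 1/2"
  shows "4 * r * (1 - r) * (1 - 2 * r) * real_mode 2 (Suc n) r
     + (4 - 10 * r + 8 * r\<^sup>2) * real_mode 1 (Suc n) r = (1 - 2 * r) * real_mode 0 n r"
proof -
  have "complex_of_real r \<in> ball 0 (1/2)" using assms by simp
  note o = mode_ode[OF this, of n]
  have "of_real (4 * r * (1 - r) * (1 - 2 * r)) * (deriv ^^ 2) (mode (Suc n)) (of_real r)
     + of_real (4 - 10 * r + 8 * r\<^sup>2) * deriv (mode (Suc n)) (of_real r) = of_real (1 - 2 * r) * mode n (of_real r)"
    using o by simp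
  from arg_cong[OF this, of Re] show ?thesis
    by (simp add: real_mode_def)
qed

lemma real_mode_Suc_0: "real_mode (Suc j) 0 r = 0"
  by (simp add: real_mode_def higher_deriv_const del: funpow.simps)

lemma fact_double_le: "(fact (2 * n) :: real) \<le> 4 ^ n * (fact n)\<^sup>2"
proof (induction n)
  case (Suc n)
  have "(fact (2 * Suc n) :: real) = (2 * real n + 1) * (2 * real n + 2) * fact (2 * n)"
    by (simp add: algebra_simps)
  also have "\<dots> \<le> (2 * real n + 2) * (2 * real n + 2) * (4 ^ n * (fact n)\<^sup>2)"
    using Suc by (intro mult_mono) auto
  also have "\<dots> = 4 ^ Suc n * (fact (Suc n))\<^sup>2"
    by (simp add: power2_eq_square algebra_simps)
  finally show ?case .
qed simp

lemma weight_ratio_norm: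
  "cmod (weight_out z * weight_in w) =
     sqrt (cmod (1 - 2 * z)) / (sqrt (cmod (1 - 2 * w)) * (sqrt (cmod (1 - z)) * sqrt (cmod (1 - w))))"
  by (simp add: weight_out_def weight_in_def norm_mult norm_divide mult_ac)

lemma mode_bound_disc:
  assumes "r < 1/2"
  shows "\<exists>K\<ge>0. \<forall>n. \<forall>z\<in>cball 0 r. cmod (mode n z) \<le> K ^ n / fact (2 * n)"
proof -
  define K where "K = sqrt 2 / (sqrt (1 - 2 * r) * (sqrt (1/2) * sqrt (1/2)))"
  have K: "K \<ge> 0" using assms by (auto simp: K_def)
  have "cmod (mode n z) \<le> K ^ n / fact (2 * n)" if z: "z \<in> cball 0 r" for n z
  proof -
    have "cmod (mode n z) \<le> (K * cmod z) ^ n / (4 ^ n * (fact n)\<^sup>2)"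
    proof (rule mode_bound(1)[OF K _ _ _ z])
      show "cball (0::complex) r \<subseteq> ball 0 (1/2)" using assms by auto
      fix z :: complex and x :: real assume z: "z \<in> cball 0 r" and x: "x \<in> {0..1}"
      have "\<bar>x\<bar> * cmod z \<le> 1 * cmod z" using x by (intro mult_right_mono) auto
      then have xz: "cmod (of_real x * z) \<le> r" using z by (simp add: norm_mult)
      then show "of_real x * z \<in> cball 0 r" by simp
      have "cmod (1 - 2 * z) \<le> 2" using norm_triangle_ineq4[of 1 "2 * z"] z assms by (simp add: norm_mult)
      moreover have "cmod (1 - 2 * (of_real x * z)) \<ge> 1 - 2 * r"
        using norm_triangle_ineq2[of 1 "2 * (of_real x * z)"] xz by (simp add: norm_mult)
      moreover have "cmod (1 - z) \<ge> 1/2" "cmod (1 - of_real x * z) \<ge> 1/2"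
        using norm_triangle_ineq2[of 1 z] norm_triangle_ineq2[of 1 "of_real x * z"] z xz assms by auto
      ultimately show "cmod (weight_out z * weight_in (of_real x * z)) \<le> K"
        unfolding weight_ratio_norm K_def using assms by (intro frac_le mult_mono) auto
    qed
    also have "\<dots> \<le> K ^ n / fact (2 * n)"
    proof (rule frac_le)
      have "K * cmod z \<le> K * 1" using z assms K by (intro mult_left_mono) auto
      then show "(K * cmod z) ^ n \<le> K ^ n" using K by (intro power_mono) auto
    qed (use K fact_double_le in auto)
    finally show ?thesis .
  qed
  then show ?thesis using K by blast
qed

text \<open>Cauchy's inequality on a disc slightly larger than the segment, which still lies inside the
  disc of holomorphy.\<close>

lemma real_mode_bound_compact:
  assumes "r < 1/2"
  shows "\<exists>K\<ge>0. \<exists>C\<ge>0. \<forall>n. \<forall>x\<in>{-r..r}. \<bar>real_mode j n x\<bar> \<le> C * K ^ n / fact (2 * n)"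
proof -
  define d where "d = (1/2 - r) / 2"
  have d: "d > 0" "r + d < 1/2" using assms by (auto simp: d_def field_simps)
  obtain K where K: "K \<ge> 0" "\<And>n z. z \<in> cball 0 (r + d) \<Longrightarrow> cmod (mode n z) \<le> K ^ n / fact (2 * n)"
    using mode_bound_disc[OF d(2)] by blast
  have "\<bar>real_mode j n x\<bar> \<le> (fact j / d ^ j) * K ^ n / fact (2 * n)" if x: "x \<in> {-r..r}" for n x
  proof -
    have sub: "cball (of_real x) d \<subseteq> cball (0::complex) (r + d)" "cball (of_real x) d \<subseteq> ball (0::complex) (1/2)"
    proof -
      have "cmod w \<le> r + d" if "dist (of_real x) w \<le> d" for w
        using that x norm_triangle_ineq3[of w "of_real x"] by (auto simp: dist_norm norm_minus_commute abs_le_iff)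
      then show "cball (of_real x) d \<subseteq> cball (0::complex) (r + d)" "cball (of_real x) d \<subseteq> ball (0::complex) (1/2)"
        using d(2) by fastforce+
    qed
    have hol: "mode n holomorphic_on cball (of_real x) d" using mode_holomorphic sub(2) by (rule holomorphic_on_subset)
    have "cmod ((deriv ^^ j) (mode n) (of_real x)) \<le> fact j * (K ^ n / fact (2 * n)) / d ^ j"
    proof (rule Cauchy_inequality)
      show "mode n holomorphic_on ball (of_real x) d" using hol ball_subset_cball by (rule holomorphic_on_subset)
      show "continuous_on (cball (of_real x) d) (mode n)" using hol by (rule holomorphic_on_imp_continuous_on)
      fix w assume "cmod (of_real x - w) = d"
      then have "w \<in> cball (of_real x) d" by (simp add: dist_norm)
      then show "cmod (mode n w) \<le> K ^ n / fact (2 * n)" using sub(1) K(2) by blast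
    qed (use d in auto)
    then show ?thesis
      using abs_Re_le_cmod[of "(deriv ^^ j) (mode n) (of_real x)"] by (simp add: real_mode_def field_simps)
  qed
  moreover have "fact j / d ^ j \<ge> 0" using d by simp
  ultimately show ?thesis using K(1) by blast
qed

text \<open>On \<open>[0, 1/2)\<close> the function \<open>1 - 2t\<close> decreases, so in the relevant products the quotient of the
  singular factors of the two weights is at most 1, and the products are at most 2 up to the
  singular point 1/2. This point is the sphere at infinity of the manifold.\<close>

lemma real_mode_bound_uniform:
  assumes x: "0 \<le> x" "x < 1/2"
  shows "\<bar>real_mode 0 n x\<bar> \<le> 2 ^ n / fact (2 * n)"
    and "\<bar>real_mode 1 n x\<bar> \<le> 2 * 4 ^ n / fact (2 * n)"
proof -
  define S where "S = complex_of_real ` {0..<1/2}"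
  have w: "cmod (weight_out z * weight_in (of_real t * z)) \<le> 2" if z: "z \<in> S" and t: "t \<in> {0..1::real}" for z t
  proof -
    obtain y where y: "z = of_real y" "0 \<le> y" "y < 1/2" using z by (auto simp: S_def)
    have ty: "0 \<le> t * y" "t * y \<le> y" using y t by (auto simp: mult_left_le_one_le)
    have e: "1 - 2 * z = of_real (1 - 2 * y)" "1 - 2 * (of_real t * z) = of_real (1 - 2 * (t * y))"
      "1 - z = of_real (1 - y)" "1 - of_real t * z = of_real (1 - t * y)"
      using y by auto
    have "cmod (weight_out z * weight_in (of_real t * z)) =
        sqrt (1 - 2 * y) / (sqrt (1 - 2 * (t * y)) * (sqrt (1 - y) * sqrt (1 - t * y)))"
      unfolding weight_ratio_norm unfolding e norm_of_real using y ty by simp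
    also have "\<dots> \<le> sqrt (1 - 2 * y) / (sqrt (1 - 2 * y) * (sqrt (1/2) * sqrt (1/2)))"
      using y ty by (intro divide_left_mono mult_mono mult_pos_pos) auto
    also have "\<dots> = 2" using y by simp
    finally show ?thesis .
  qed
  have S: "S \<subseteq> ball 0 (1/2)" by (auto simp: S_def)
  have star: "of_real t * z \<in> S" if z: "z \<in> S" and t: "t \<in> {0..1::real}" for z t
  proof -
    obtain y where y: "z = of_real y" "0 \<le> y" "y < 1/2" using z by (auto simp: S_def)
    have "0 \<le> t * y" "t * y < 1/2" using y t mult_left_le_one_le[of y t] by auto
    then show ?thesis unfolding S_def y(1) of_real_mult[symmetric] by (intro imageI) auto
  qed
  have xS: "of_real x \<in> S" using x by (auto simp: S_def)
  note b = mode_bound[OF _ S star w xS, simplified]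
  have x2: "(2 * x) ^ m \<le> 2 ^ m" for m using x by (intro power_mono) auto
  have "\<bar>real_mode 0 n x\<bar> \<le> (2 * x) ^ n / (4 ^ n * (fact n)\<^sup>2)"
    using b(1)[of n] abs_Re_le_cmod[of "mode n (of_real x)"] x by (simp add: real_mode_def)
  also have "\<dots> \<le> 2 ^ n / fact (2 * n)" using x2 x fact_double_le by (intro frac_le) auto
  finally show "\<bar>real_mode 0 n x\<bar> \<le> 2 ^ n / fact (2 * n)" .
  show "\<bar>real_mode 1 n x\<bar> \<le> 2 * 4 ^ n / fact (2 * n)"
  proof (cases n)
    case 0
    then show ?thesis using real_mode_Suc_0[of 0] by simp
  next
    case (Suc m)
    have nz: "(fact m :: real) > 0" "(4::real) ^ m > 0" by auto
    have "\<bar>real_mode 1 n x\<bar> \<le> 2 / 4 * (2 * x) ^ m / (4 ^ m * (fact m)\<^sup>2) / (real m + 1)"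
      using b(2)[of m] abs_Re_le_cmod[of "deriv (mode n) (of_real x)"] x Suc by (simp add: real_mode_def)
    also have "\<dots> \<le> 2 / 4 * 2 ^ m / (4 ^ m * (fact m)\<^sup>2) / (real m + 1)"
      using x2 by (intro divide_right_mono mult_left_mono) auto
    also have "\<dots> = (2 * (real m + 1) * 2 ^ m) / (4 ^ n * (fact n)\<^sup>2)"
      using nz by (simp add: Suc divide_simps) (simp add: power2_eq_square algebra_simps)
    also have "\<dots> \<le> (2 * (real m + 1) * 2 ^ m) / fact (2 * n)"
      using fact_double_le[of n] by (intro divide_left_mono) auto
    also have "\<dots> \<le> 2 * 4 ^ n / fact (2 * n)"
    proof (rule divide_right_mono)
      have "real m + 1 \<le> 2 ^ n" using of_nat_less_two_power[of n, where 'a=real] Suc by simp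
      then have "(real m + 1) * 2 ^ m \<le> 2 ^ n * 2 ^ n" using Suc by (intro mult_mono) auto
      also have "\<dots> = (4::real) ^ n" by (simp flip: power_mult_distrib)
      finally show "2 * (real m + 1) * 2 ^ m \<le> 2 * 4 ^ n" by (simp only: mult.assoc mult_le_cancel_left_pos zero_less_numeral)
    qed simp
    finally show ?thesis .
  qed
qed

text \<open>Near the singular point 1/2 the second derivative is recovered from the differential equation,
  whose leading coefficient vanishes there to first order; this is the reason for the factor
  \<open>1 - 2x\<close>. Away from 1/2, the compact bound applies.\<close>

lemma real_mode_bound_second:
  "\<exists>K\<ge>0. \<exists>C\<ge>0. \<forall>n. \<forall>x\<in>{0..<1/2}. \<bar>real_mode 2 n x\<bar> * (1 - 2 * x) \<le> C * K ^ n / fact (2 * n)"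
proof -
  obtain K C where K: "K \<ge> 0" "C \<ge> 0" and
    b: "\<And>n x. x \<in> {-1/4..1/4} \<Longrightarrow> \<bar>real_mode 2 n x\<bar> \<le> C * K ^ n / fact (2 * n)"
    using real_mode_bound_compact[of "1/4" 2] by auto
  have K4: "K ^ n \<le> (K + 16) ^ n" "16 ^ n \<le> (K + 16) ^ n" for n using K by (auto intro!: power_mono)
  have "\<bar>real_mode 2 n x\<bar> * (1 - 2 * x) \<le> (C + 48) * (K + 16) ^ n / fact (2 * n)" if x: "x \<in> {0..<1/2}" for n x
  proof (cases "x \<le> 1/4")
    case True
    have "\<bar>real_mode 2 n x\<bar> * (1 - 2 * x) \<le> \<bar>real_mode 2 n x\<bar> * 1" using x by (intro mult_left_mono) auto
    also have "\<dots> \<le> C * K ^ n / fact (2 * n)" using b[of x n] x True by simp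
    also have "\<dots> \<le> (C + 48) * (K + 16) ^ n / fact (2 * n)"
      using K K4 by (intro divide_right_mono mult_mono) auto
    finally show ?thesis .
  next
    case False
    show ?thesis
    proof (cases n)
      case 0
      then show ?thesis using real_mode_Suc_0[of 1 x] K by (simp add: numeral_2_eq_2)
    next
      case (Suc m)
      define y1 y2 y0 where "y1 = real_mode 1 n x" and "y2 = real_mode 2 n x" and "y0 = real_mode 0 m x"
      have "4 * x * (1 - x) * ((1 - 2 * x) * y2) = (1 - 2 * x) * y0 - (4 - 10 * x + 8 * x\<^sup>2) * y1"
        using real_mode_ode[of x m] x by (simp add: Suc y0_def y1_def y2_def algebra_simps)
      then have "4 * x * (1 - x) * \<bar>(1 - 2 * x) * y2\<bar> = \<bar>(1 - 2 * x) * y0 - (4 - 10 * x + 8 * x\<^sup>2) * y1\<bar>"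
        using x by (simp add: abs_mult flip: \<open>4 * x * (1 - x) * ((1 - 2 * x) * y2) = _\<close>)
      also have "\<dots> \<le> \<bar>y0\<bar> + 4 * \<bar>y1\<bar>"
      proof -
        have "\<bar>(1 - 2 * x) * y0\<bar> \<le> 1 * \<bar>y0\<bar>" unfolding abs_mult using x by (intro mult_right_mono) auto
        moreover have "\<bar>(4 - 10 * x + 8 * x\<^sup>2) * y1\<bar> \<le> 4 * \<bar>y1\<bar>" unfolding abs_mult
        proof (rule mult_right_mono)
          have "x\<^sup>2 \<le> (1/2) * x" using x unfolding power2_eq_square by (intro mult_right_mono) auto
          moreover have e: "4 - 10 * x + 8 * x\<^sup>2 = 8 * (x - 5/8)\<^sup>2 + 7/8" by (simp add: power2_eq_square algebra_simps)
          moreover have "4 - 10 * x + 8 * x\<^sup>2 \<ge> 0" unfolding e by simp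
          ultimately show "\<bar>4 - 10 * x + 8 * x\<^sup>2\<bar> \<le> 4" using x by (simp add: abs_le_iff)
        qed simp
        ultimately show ?thesis by linarith
      qed
      finally have "4 * x * (1 - x) * \<bar>(1 - 2 * x) * y2\<bar> \<le> \<bar>y0\<bar> + 4 * \<bar>y1\<bar>" .
      moreover have "4 * x * (1 - x) \<ge> 1/2"
      proof -
        have "x * (1 - x) \<ge> (1/4) * (1/2)" using x False by (intro mult_mono) auto
        then show ?thesis by simp
      qed
      then have "1/2 * \<bar>(1 - 2 * x) * y2\<bar> \<le> 4 * x * (1 - x) * \<bar>(1 - 2 * x) * y2\<bar>" by (rule mult_right_mono) simp
      ultimately have "\<bar>(1 - 2 * x) * y2\<bar> \<le> 2 * \<bar>y0\<bar> + 8 * \<bar>y1\<bar>" by linarith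
      then have "\<bar>y2\<bar> * (1 - 2 * x) \<le> 2 * \<bar>y0\<bar> + 8 * \<bar>y1\<bar>" using x by (simp add: abs_mult mult.commute)
      also have "\<dots> \<le> 2 * (16 * 16 ^ m / fact (2 * n)) + 8 * (2 * 16 ^ n / fact (2 * n))"
      proof (intro add_mono mult_left_mono)
        have "2 ^ m / fact (2 * m) \<le> 16 * 16 ^ m / (fact (2 * n) :: real)"
        proof -
          have "(fact (2 * n) :: real) = (2 * real m + 1) * (2 * real m + 2) * fact (2 * m)"
            by (simp add: Suc algebra_simps)
          also have "\<dots> \<le> (2 * 2 ^ m) * (2 * 2 ^ m) * fact (2 * m)"
          proof (intro mult_mono)
            have "real m + 1 \<le> 2 ^ m" by (induction m) auto
            then show "2 * real m + 1 \<le> 2 * 2 ^ m" "2 * real m + 2 \<le> 2 * 2 ^ m" by auto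
          qed auto
          also have "\<dots> = 4 * 4 ^ m * fact (2 * m)" by (simp flip: power_mult_distrib)
          finally have "2 ^ m * fact (2 * n) \<le> 2 ^ m * (4 * 4 ^ m * (fact (2 * m) :: real))" by (intro mult_left_mono) auto
          also have "\<dots> = 4 * 8 ^ m * fact (2 * m)" by (simp flip: power_mult_distrib)
          also have "\<dots> \<le> 16 * 16 ^ m * fact (2 * m)" by (intro mult_mono power_mono) auto
          finally show ?thesis by (simp add: divide_simps)
        qed
        then show "\<bar>y0\<bar> \<le> 16 * 16 ^ m / fact (2 * n)"
          using real_mode_bound_uniform(1)[of x m] x by (simp add: y0_def)
        have "2 * 4 ^ n / fact (2 * n) \<le> 2 * 16 ^ n / (fact (2 * n) :: real)"
          by (intro divide_right_mono mult_left_mono power_mono) auto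
        then show "\<bar>y1\<bar> \<le> 2 * 16 ^ n / fact (2 * n)"
          using real_mode_bound_uniform(2)[of x n] x by (simp add: y1_def)
      qed auto
      also have "\<dots> = 18 * 16 ^ n / fact (2 * n)" by (simp add: Suc add_divide_distrib[symmetric])
      also have "\<dots> \<le> (C + 48) * (K + 16) ^ n / fact (2 * n)"
        using K K4 by (intro divide_right_mono mult_mono) auto
      finally show ?thesis by (simp add: y2_def)
    qed
  qed
  moreover have "K + 16 \<ge> 0" "C + 48 \<ge> 0" using K by auto
  ultimately show ?thesis by blast
qed

definition gauss_deriv :: "nat \<Rightarrow> real \<Rightarrow> real" where
  "gauss_deriv m s = Re ((deriv ^^ m) (\<lambda>z. exp (- z\<^sup>2)) (of_real s))"

lemma DERIV_gauss_deriv: "(gauss_deriv m has_field_derivative gauss_deriv (Suc m) s) (at s)"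
  unfolding gauss_deriv_def[abs_def]
  by (rule has_field_derivative_Re_of_real[OF DERIV_iterated_deriv[of _ UNIV]])
    (auto intro!: holomorphic_intros)

lemma gauss_deriv_0: "gauss_deriv 0 s = exp (- s\<^sup>2)"
  by (simp add: gauss_deriv_def Re_exp flip: of_real_power)

lemma gauss_deriv_1: "gauss_deriv 1 s = - 2 * s * exp (- s\<^sup>2)"
proof -
  have "((\<lambda>s::real. exp (- s\<^sup>2)) has_field_derivative gauss_deriv 1 s) (at s)"
    using DERIV_gauss_deriv[of 0 s] gauss_deriv_0[abs_def] by simp
  moreover have "((\<lambda>s::real. exp (- s\<^sup>2)) has_field_derivative - 2 * s * exp (- s\<^sup>2)) (at s)"
    by (auto intro!: derivative_eq_intros)
  ultimately show ?thesis by (rule DERIV_unique)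
qed

text \<open>On the circle of radius \<open>R\<close> about \<open>s\<close> the modulus of \<open>exp (- z\<^sup>2)\<close> is at most
  \<open>exp (R\<^sup>2 + 2R|s| - s\<^sup>2)\<close>, and completing the square shows that \<open>- s\<^sup>2\<close> beats every linear term.
  Cauchy's inequality transfers this to the derivatives, with \<open>R\<close> at our disposal.\<close>

lemma gauss_deriv_bound:
  assumes R: "R > 0" and c: "c \<ge> 0"
  shows "\<exists>C\<ge>0. \<forall>m s. \<bar>gauss_deriv m s\<bar> \<le> C * (fact m / R ^ m) * exp (- c * \<bar>s\<bar>)"
proof -
  define C where "C = exp (R\<^sup>2 + (2 * R + c)\<^sup>2 / 4)"
  have "\<bar>gauss_deriv m s\<bar> \<le> C * (fact m / R ^ m) * exp (- c * \<bar>s\<bar>)" for m s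
  proof -
    have "cmod ((deriv ^^ m) (\<lambda>z. exp (- z\<^sup>2)) (of_real s)) \<le> fact m * (C * exp (- c * \<bar>s\<bar>)) / R ^ m"
    proof (rule Cauchy_inequality[OF _ _ R])
      fix x assume "cmod (of_real s - x) = R"
      then have eq: "(s - Re x)\<^sup>2 + (Im x)\<^sup>2 = R\<^sup>2"
        by (metis cmod_power2 minus_complex.sel(1) minus_complex.sel(2) Re_complex_of_real Im_complex_of_real
            diff_0 power2_minus)
      define a b where "a = Re x - s" and "b = Im x"
      have ab: "a\<^sup>2 + b\<^sup>2 = R\<^sup>2" using eq by (simp add: a_def b_def power2_commute)
      have "\<bar>a\<bar> \<le> R" using ab R by (metis abs_le_square_iff abs_of_pos le_add_same_cancel1 zero_le_power2)
      then have "\<bar>a * s\<bar> \<le> R * \<bar>s\<bar>" by (simp add: abs_mult mult_right_mono)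
      then have "- 2 * a * s \<le> 2 * R * \<bar>s\<bar>" by (simp add: abs_le_iff)
      moreover have "b\<^sup>2 \<le> R\<^sup>2" using ab by (metis le_add_same_cancel2 zero_le_power2)
      moreover have "Re (- x\<^sup>2) = - s\<^sup>2 - 2 * a * s - a\<^sup>2 + b\<^sup>2"
        by (simp add: a_def b_def power2_eq_square algebra_simps)
      ultimately have "Re (- x\<^sup>2) \<le> - s\<^sup>2 + 2 * R * \<bar>s\<bar> + R\<^sup>2" using zero_le_power2[of a] by linarith
      also have "\<dots> \<le> R\<^sup>2 + (2 * R + c)\<^sup>2 / 4 + (- c * \<bar>s\<bar>)"
      proof -
        have "0 \<le> (\<bar>s\<bar> - (2 * R + c) / 2)\<^sup>2" by simp
        also have "\<dots> = s\<^sup>2 - (2 * R + c) * \<bar>s\<bar> + (2 * R + c)\<^sup>2 / 4" by (simp add: power2_diff power_divide)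
        finally show ?thesis by (simp add: algebra_simps)
      qed
      finally show "cmod (exp (- x\<^sup>2)) \<le> C * exp (- c * \<bar>s\<bar>)"
        by (simp add: C_def flip: exp_add)
    qed (auto intro!: holomorphic_intros continuous_intros)
    then show ?thesis
      using abs_Re_le_cmod[of "(deriv ^^ m) (\<lambda>z. exp (- z\<^sup>2)) (of_real s)"] by (simp add: gauss_deriv_def field_simps)
  qed
  moreover have "C \<ge> 0" by (simp add: C_def)
  ultimately show ?thesis by blast
qed

section \<open>Solutions of the reduced equation on a strip\<close>

text \<open>Separated solutions of the reduced equation in \<open>(s, r)\<close> are formally superposed to
  \<open>\<Sum>n. (-1) ^ n a\<^sub>n(r) G\<^sup>(\<^sup>2\<^sup>n\<^sup>)(s)\<close> with the Gaussian \<open>G\<close> as the value on the axis \<open>r = 0\<close>. The indices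
  \<open>i\<close> and \<open>j\<close> count derivatives in \<open>s\<close> and \<open>r\<close>.\<close>

definition strip_term :: "nat \<Rightarrow> nat \<Rightarrow> nat \<Rightarrow> real \<times> real \<Rightarrow> real" where
  "strip_term i j n z = (-1) ^ n * (gauss_deriv (2 * n + i) (fst z) * real_mode j n (snd z))"

definition strip_sol :: "nat \<Rightarrow> nat \<Rightarrow> real \<times> real \<Rightarrow> real" where
  "strip_sol i j z = (\<Sum>n. strip_term i j n z)"

lemma fact_add_le: "(fact (m + i) :: real) \<le> 2 ^ (m + i) * fact m * fact i"
proof -
  have "(fact (m + i) :: real) = real ((m + i) choose m) * fact m * fact i"
    using binomial_fact[of m "m + i", where 'a=real] by simp
  also have "real ((m + i) choose m) \<le> 2 ^ (m + i)"
    using of_nat_mono[OF binomial_le_pow2, where 'a=real, of "m + i" m] by simp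
  finally show ?thesis by (simp add: mult_right_mono)
qed

text \<open>The radius \<open>R\<close> in the estimate of the Gaussian is chosen large in comparison with the
  exponential rate \<open>K\<close> of the separated solutions, so that the series is dominated by a geometric
  one. The weight \<open>w\<close> allows for factors such as \<open>1 - 2r\<close> that tame a singularity at the boundary.\<close>

lemma strip_term_bound:
  assumes c: "c \<ge> 0" and K: "K \<ge> 0" "A \<ge> 0"
    and b: "\<And>n r. r \<in> S \<Longrightarrow> \<bar>real_mode j n r\<bar> * w r \<le> A * K ^ n / fact (2 * n)" "\<And>r. r \<in> S \<Longrightarrow> w r \<ge> 0"
  shows "\<exists>C\<ge>0. \<forall>n s. \<forall>r\<in>S. \<bar>strip_term i j n (s, r)\<bar> * w r \<le> C * exp (- c * \<bar>s\<bar>) * (1/2) ^ n"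
proof -
  \<comment> \<open>With this radius \<open>4K \<le> R\<^sup>2 / 2\<close>, which makes the ratio of the majorant 1/2.\<close>
  define R where "R = 8 * K + 8"
  have R: "R > 0" "R \<ge> 1" using K by (auto simp: R_def)
  obtain G where G: "G \<ge> 0" "\<And>m s. \<bar>gauss_deriv m s\<bar> \<le> G * (fact m / R ^ m) * exp (- c * \<bar>s\<bar>)"
    using gauss_deriv_bound[OF R(1) c] by blast
  define C where "C = G * A * 2 ^ i * fact i"
  have C: "C \<ge> 0" using G K by (simp add: C_def)
  have "\<bar>strip_term i j n (s, r)\<bar> * w r \<le> C * exp (- c * \<bar>s\<bar>) * (1/2) ^ n" if r: "r \<in> S" for n s r
  proof -
    have f: "fact (2 * n + i) / R ^ (2 * n + i) \<le> 2 ^ i * fact i * fact (2 * n) * (4 / R\<^sup>2) ^ n"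
    proof -
      have "fact (2 * n + i) / R ^ (2 * n + i) \<le> (2 ^ (2 * n + i) * fact (2 * n) * fact i) / (R ^ (2 * n) * 1)"
        using R fact_add_le[of "2 * n" i] by (intro frac_le) (auto simp: power_add)
      also have "\<dots> = 2 ^ i * fact i * fact (2 * n) * (4 / R\<^sup>2) ^ n"
        by (simp add: power_add power_mult power_divide)
      finally show ?thesis .
    qed
    have q: "(4 / R\<^sup>2) ^ n * K ^ n \<le> (1/2) ^ n"
    proof -
      have "4 * K \<le> R * (1/2)" by (simp add: R_def)
      also have "\<dots> \<le> R * (R * (1/2))" using R by (intro mult_left_mono) auto
      finally have "4 / R\<^sup>2 * K \<le> 1/2" using R by (simp add: field_simps power2_eq_square)
      then show ?thesis using K R unfolding power_mult_distrib[symmetric] by (intro power_mono) auto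
    qed
    have "\<bar>strip_term i j n (s, r)\<bar> * w r = \<bar>gauss_deriv (2 * n + i) s\<bar> * (\<bar>real_mode j n r\<bar> * w r)"
      by (simp add: strip_term_def abs_mult power_abs)
    also have "\<dots> \<le> (G * (2 ^ i * fact i * fact (2 * n) * (4 / R\<^sup>2) ^ n) * exp (- c * \<bar>s\<bar>)) * (A * K ^ n / fact (2 * n))"
    proof (rule mult_mono)
      have "G * (fact (2 * n + i) / R ^ (2 * n + i)) * exp (- c * \<bar>s\<bar>) \<le> G * (2 ^ i * fact i * fact (2 * n) * (4 / R\<^sup>2) ^ n) * exp (- c * \<bar>s\<bar>)"
        using f G(1) by (intro mult_right_mono mult_left_mono) auto
      then show "\<bar>gauss_deriv (2 * n + i) s\<bar> \<le> G * (2 ^ i * fact i * fact (2 * n) * (4 / R\<^sup>2) ^ n) * exp (- c * \<bar>s\<bar>)"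
        using G(2)[of "2 * n + i" s] by linarith
    qed (use b[OF r] G(1) in \<open>auto\<close>)
    also have "\<dots> = C * exp (- c * \<bar>s\<bar>) * ((4 / R\<^sup>2) ^ n * K ^ n)" by (simp add: C_def field_simps)
    also have "\<dots> \<le> C * exp (- c * \<bar>s\<bar>) * (1/2) ^ n" using C q by (intro mult_left_mono) auto
    finally show ?thesis .
  qed
  then show ?thesis using C by blast
qed

lemma geometric_tail:
  fixes t :: "nat \<Rightarrow> real"
  assumes "\<And>k. \<bar>t k\<bar> \<le> C * (1/2) ^ k"
  shows "summable t" "\<bar>sum t {..<n} - suminf t\<bar> \<le> 2 * C * (1/2) ^ n"
proof -
  have g: "summable (\<lambda>k. C * (1/2::real) ^ k)" by (intro summable_mult summable_geometric) auto
  show s: "summable t" by (rule summable_comparison_test'[OF g]) (use assms in auto)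
  have "\<bar>sum t {..<n} - suminf t\<bar> = \<bar>\<Sum>k. t (k + n)\<bar>"
    using suminf_minus_initial_segment[OF s, of n] by simp
  also have "\<dots> \<le> (\<Sum>k. C * (1/2) ^ n * (1/2) ^ k)"
  proof -
    have g2: "summable (\<lambda>k. C * (1/2) ^ n * (1/2::real) ^ k)" by (intro summable_mult summable_geometric) auto
    have le: "norm (t (k + n)) \<le> C * (1/2) ^ n * (1/2) ^ k" for k
      using assms[of "k + n"] by (simp add: power_add mult_ac)
    have "norm (\<Sum>k. t (k + n)) \<le> (\<Sum>k. C * (1/2) ^ n * (1/2) ^ k)" by (rule norm_suminf_le[OF le g2])
    then show ?thesis by simp
  qed
  also have "\<dots> = 2 * C * (1/2) ^ n"
    by (subst suminf_mult) (auto intro!: summable_geometric simp: suminf_geometric)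
  finally show "\<bar>sum t {..<n} - suminf t\<bar> \<le> 2 * C * (1/2) ^ n" .
qed

lemma strip_term_bound_compact:
  assumes "r < 1/2"
  shows "\<exists>C\<ge>0. \<forall>n. \<forall>z\<in>UNIV \<times> {-r<..<r}. \<bar>strip_term i j n z\<bar> \<le> C * (1/2) ^ n"
proof -
  obtain K A where KA: "K \<ge> 0" "A \<ge> 0" "\<And>n x. x \<in> {-r..r} \<Longrightarrow> \<bar>real_mode j n x\<bar> \<le> A * K ^ n / fact (2 * n)"
    using real_mode_bound_compact[OF assms, of j] by blast
  have "\<exists>C\<ge>0. \<forall>n s. \<forall>x\<in>{-r..r}. \<bar>strip_term i j n (s, x)\<bar> * 1 \<le> C * exp (- 0 * \<bar>s\<bar>) * (1/2) ^ n"
    by (rule strip_term_bound[OF _ KA(1,2)]) (use KA(3) in auto)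
  then obtain C where "C \<ge> 0" "\<And>n s x. x \<in> {-r..r} \<Longrightarrow> \<bar>strip_term i j n (s, x)\<bar> \<le> C * (1/2) ^ n"
    by auto
  then show ?thesis by (intro exI[of _ C]) auto
qed

lemma strip_term_summable:
  assumes "\<bar>snd z\<bar> < 1/2"
  shows "summable (\<lambda>n. strip_term i j n z)"
proof -
  define r where "r = (\<bar>snd z\<bar> + 1/2) / 2"
  have r: "r < 1/2" "snd z \<in> {-r<..<r}" using assms by (auto simp: r_def field_simps)
  obtain C where "\<forall>n. \<forall>z\<in>UNIV \<times> {-r<..<r}. \<bar>strip_term i j n z\<bar> \<le> C * (1/2) ^ n"
    using strip_term_bound_compact[OF r(1)] by blast
  then have "\<bar>strip_term i j n z\<bar> \<le> C * (1/2) ^ n" for n using r(2) by (simp only: mem_Times_iff UNIV_I)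
  then show ?thesis by (rule geometric_tail(1))
qed

text \<open>Term by term differentiation, justified by the geometric majorants of both series of partial
  derivatives. The derivatives are again of the form \<open>strip_sol\<close>, so that all these functions are
  smooth.\<close>

lemma strip_sol_has_derivative:
  assumes "\<bar>snd z\<bar> < 1/2"
  shows "(strip_sol i j has_derivative (\<lambda>h. strip_sol (Suc i) j z * fst h + strip_sol i (Suc j) z * snd h)) (at z)"
proof -
  define r where "r = (\<bar>snd z\<bar> + 1/2) / 2"
  have r: "r < 1/2" "snd z \<in> {-r<..<r}" using assms by (auto simp: r_def field_simps)
  define S where "S = (UNIV :: real set) \<times> {-r<..<r}"
  have S: "open S" "convex S" "z \<in> S" using r by (auto simp: S_def open_Times convex_Times mem_Times_iff)
  have sndS: "\<bar>snd x\<bar> < 1/2" if "x \<in> S" for x using that r(1) by (auto simp: S_def)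
  obtain C1 where C1: "C1 \<ge> 0" "\<And>n x. x \<in> S \<Longrightarrow> \<bar>strip_term (Suc i) j n x\<bar> \<le> C1 * (1/2) ^ n"
    using strip_term_bound_compact[OF r(1)] unfolding S_def by blast
  obtain C2 where C2: "C2 \<ge> 0" "\<And>n x. x \<in> S \<Longrightarrow> \<bar>strip_term i (Suc j) n x\<bar> \<le> C2 * (1/2) ^ n"
    using strip_term_bound_compact[OF r(1)] unfolding S_def by blast
  define f' where "f' n x h = strip_term (Suc i) j n x * fst h + strip_term i (Suc j) n x * snd h" for n x and h :: "real \<times> real"
  define g' where "g' x h = strip_sol (Suc i) j x * fst h + strip_sol i (Suc j) x * snd h" for x and h :: "real \<times> real"
  have "\<exists>g. \<forall>x\<in>S. (\<lambda>n. strip_term i j n x) sums (g x) \<and> (g has_derivative g' x) (at x within S)"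
  proof (rule has_derivative_series[where f'=f' and x=z])
    show "convex S" "z \<in> S" using S by auto
    show "(\<lambda>n. strip_term i j n z) sums strip_sol i j z"
      unfolding strip_sol_def using strip_term_summable[OF assms] by (rule summable_sums)
  next
    fix n x assume x: "x \<in> S"
    have d1: "((\<lambda>z. gauss_deriv (2 * n + i) (fst z)) has_derivative (\<lambda>h. gauss_deriv (Suc (2 * n + i)) (fst x) * fst h)) (at x within S)"
      using has_derivative_compose[of fst fst x S, OF _ DERIV_gauss_deriv[THEN has_field_derivative_imp_has_derivative]]
      by (simp add: bounded_linear_imp_has_derivative bounded_linear_fst)
    have d2: "((\<lambda>z. real_mode j n (snd z)) has_derivative (\<lambda>h. real_mode (Suc j) n (snd x) * snd h)) (at x within S)"
      using has_derivative_compose[of snd snd x S, OF _ DERIV_real_mode[OF sndS[OF x], THEN has_field_derivative_imp_has_derivative]]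
      by (simp add: bounded_linear_imp_has_derivative bounded_linear_snd)
    show "(strip_term i j n has_derivative f' n x) (at x within S)"
      unfolding strip_term_def[abs_def] f'_def
      by (rule has_derivative_eq_rhs[OF has_derivative_mult_right[OF has_derivative_mult[OF d1 d2]]])
        (auto simp: algebra_simps)
  next
    fix e :: real assume e: "e > 0"
    have "(\<lambda>n. (2 * C1 + 2 * C2) * (1/2::real) ^ n) \<longlonglongrightarrow> (2 * C1 + 2 * C2) * 0"
      by (intro tendsto_intros LIMSEQ_power_zero) auto
    then have "\<forall>\<^sub>F n in sequentially. (2 * C1 + 2 * C2) * (1/2::real) ^ n < e"
      using e by (intro order_tendstoD(2)[of _ 0]) auto
    then show "\<forall>\<^sub>F n in sequentially. \<forall>x\<in>S. \<forall>h. norm (sum (\<lambda>i. f' i x h) {..<n} - g' x h) \<le> e * norm h"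
    proof eventually_elim
      case (elim n)
      show ?case
      proof (intro ballI allI)
        fix x and h :: "real \<times> real" assume x: "x \<in> S"
        define p q where "p = (\<Sum>k<n. strip_term (Suc i) j k x) - strip_sol (Suc i) j x"
          and "q = (\<Sum>k<n. strip_term i (Suc j) k x) - strip_sol i (Suc j) x"
        have p: "\<bar>p\<bar> \<le> 2 * C1 * (1/2) ^ n" unfolding p_def strip_sol_def by (rule geometric_tail(2)) (rule C1(2)[OF x])
        have q: "\<bar>q\<bar> \<le> 2 * C2 * (1/2) ^ n" unfolding q_def strip_sol_def by (rule geometric_tail(2)) (rule C2(2)[OF x])
        have h: "\<bar>fst h\<bar> \<le> norm h" "\<bar>snd h\<bar> \<le> norm h"
          using norm_fst_le[of "fst h" "snd h"] norm_snd_le[of "snd h" "fst h"] by auto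
        have "sum (\<lambda>i. f' i x h) {..<n} - g' x h = p * fst h + q * snd h"
          by (simp add: f'_def g'_def p_def q_def sum.distrib sum_distrib_left algebra_simps)
        then have "norm (sum (\<lambda>i. f' i x h) {..<n} - g' x h) \<le> \<bar>p\<bar> * \<bar>fst h\<bar> + \<bar>q\<bar> * \<bar>snd h\<bar>"
          by (simp add: abs_mult[symmetric] abs_triangle_ineq)
        also have "\<dots> \<le> (2 * C1 * (1/2) ^ n) * norm h + (2 * C2 * (1/2) ^ n) * norm h"
          using p q h C1(1) C2(1) by (intro add_mono mult_mono) auto
        also have "\<dots> \<le> e * norm h"
          using elim by (subst distrib_right[symmetric]) (intro mult_right_mono, auto simp: algebra_simps)
        finally show "norm (sum (\<lambda>i. f' i x h) {..<n} - g' x h) \<le> e * norm h" .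
      qed
    qed
  qed
  then obtain g where g: "\<And>x. x \<in> S \<Longrightarrow> (\<lambda>n. strip_term i j n x) sums (g x)"
    "\<And>x. x \<in> S \<Longrightarrow> (g has_derivative g' x) (at x within S)" by blast
  have "(g has_derivative g' z) (at z)" using g(2)[OF S(3)] at_within_open[OF S(3,1)] by simp
  then have "(strip_sol i j has_derivative g' z) (at z)"
    by (rule has_derivative_transform_within_open[OF _ S(1,3)]) (metis strip_sol_def g(1) sums_unique)
  then show ?thesis by (simp add: g'_def[abs_def])
qed

lemma strip_sol_bound:
  assumes c: "c \<ge> 0" and K: "K \<ge> 0" "A \<ge> 0"
    and b: "\<And>n r. r \<in> {0..<1/2} \<Longrightarrow> \<bar>real_mode j n r\<bar> * w r \<le> A * K ^ n / fact (2 * n)" "\<And>r. r \<in> {0..<1/2} \<Longrightarrow> w r \<ge> 0"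
  shows "\<exists>C\<ge>0. \<forall>s. \<forall>r\<in>{0..<1/2}. \<bar>strip_sol i j (s, r)\<bar> * w r \<le> C * exp (- c * \<bar>s\<bar>)"
proof -
  obtain C where C: "C \<ge> 0" "\<And>n s r. r \<in> {0..<1/2} \<Longrightarrow> \<bar>strip_term i j n (s, r)\<bar> * w r \<le> C * exp (- c * \<bar>s\<bar>) * (1/2) ^ n"
  proof -
    have "\<exists>C\<ge>0. \<forall>n s. \<forall>r\<in>{0..<1/2}. \<bar>strip_term i j n (s, r)\<bar> * w r \<le> C * exp (- c * \<bar>s\<bar>) * (1/2) ^ n"
      by (rule strip_term_bound[OF c K]) (use b in auto)
    then show ?thesis using that by blast
  qed
  have "\<bar>strip_sol i j (s, r)\<bar> * w r \<le> 2 * C * exp (- c * \<bar>s\<bar>)" if r: "r \<in> {0..<1/2}" for s r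
  proof -
    have sm: "summable (\<lambda>n. strip_term i j n (s, r))" using r by (intro strip_term_summable) auto
    have "\<bar>(\<Sum>k<0. strip_term i j k (s, r) * w r) - (\<Sum>k. strip_term i j k (s, r) * w r)\<bar> \<le> 2 * (C * exp (- c * \<bar>s\<bar>)) * (1/2) ^ 0"
    proof (rule geometric_tail(2))
      show "\<bar>strip_term i j k (s, r) * w r\<bar> \<le> C * exp (- c * \<bar>s\<bar>) * (1/2) ^ k" for k
        using C(2)[OF r, of k s] b(2)[OF r] by (simp add: abs_mult)
    qed
    then have "\<bar>strip_sol i j (s, r) * w r\<bar> \<le> 2 * (C * exp (- c * \<bar>s\<bar>))"
      unfolding strip_sol_def suminf_mult2[OF sm, of "w r"] by simp
    then show ?thesis using b(2)[OF r] by (simp add: abs_mult)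
  qed
  then show ?thesis using C(1) by (intro exI[of _ "2 * C"]) auto
qed

lemma strip_sol_bounds:
  assumes c: "c \<ge> 0"
  shows "\<exists>C\<ge>0. \<forall>s. \<forall>r\<in>{0..<1/2}. \<bar>strip_sol i 0 (s, r)\<bar> \<le> C * exp (- c * \<bar>s\<bar>)"
    and "\<exists>C\<ge>0. \<forall>s. \<forall>r\<in>{0..<1/2}. \<bar>strip_sol i 1 (s, r)\<bar> \<le> C * exp (- c * \<bar>s\<bar>)"
    and "\<exists>C\<ge>0. \<forall>s. \<forall>r\<in>{0..<1/2}. \<bar>strip_sol i 2 (s, r)\<bar> * (1 - 2 * r) \<le> C * exp (- c * \<bar>s\<bar>)"
proof -
  show "\<exists>C\<ge>0. \<forall>s. \<forall>r\<in>{0..<1/2}. \<bar>strip_sol i 0 (s, r)\<bar> \<le> C * exp (- c * \<bar>s\<bar>)"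
    using strip_sol_bound[OF c, of 2 1 0 "\<lambda>_. 1" i] real_mode_bound_uniform(1) by simp
  show "\<exists>C\<ge>0. \<forall>s. \<forall>r\<in>{0..<1/2}. \<bar>strip_sol i 1 (s, r)\<bar> \<le> C * exp (- c * \<bar>s\<bar>)"
    using strip_sol_bound[OF c, of 4 2 1 "\<lambda>_. 1" i] real_mode_bound_uniform(2) by simp
  obtain K C where "K \<ge> 0" "C \<ge> 0" "\<And>n x. x \<in> {0..<1/2} \<Longrightarrow> \<bar>real_mode 2 n x\<bar> * (1 - 2 * x) \<le> C * K ^ n / fact (2 * n)"
    using real_mode_bound_second by blast
  then show "\<exists>C\<ge>0. \<forall>s. \<forall>r\<in>{0..<1/2}. \<bar>strip_sol i 2 (s, r)\<bar> * (1 - 2 * r) \<le> C * exp (- c * \<bar>s\<bar>)"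
    by (intro strip_sol_bound[OF c, of K C]) auto
qed

text \<open>The sum telescopes: by \<open>mode_ode\<close> the \<open>r\<close>-derivatives of the term with index \<open>n + 1\<close> cancel
  the \<open>s\<close>-derivatives of the term with index \<open>n\<close>, and the first separated solution is constant.\<close>

lemma strip_sol_pde:
  assumes r: "\<bar>r\<bar> < 1/2"
  shows "4 * r * (1 - r) * (1 - 2 * r) * strip_sol 0 2 (s, r)
    + (4 - 10 * r + 8 * r\<^sup>2) * strip_sol 0 1 (s, r) + (1 - 2 * r) * strip_sol 2 0 (s, r) = 0"
proof -
  define a b where "a = 4 * r * (1 - r) * (1 - 2 * r)" and "b = 4 - 10 * r + 8 * r\<^sup>2"
  define L where "L n = a * strip_term 0 2 n (s, r) + b * strip_term 0 1 n (s, r)" for n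
  have sm: "summable (\<lambda>n. strip_term i j n (s, r))" for i j using r by (intro strip_term_summable) auto
  have smL: "summable L" unfolding L_def[abs_def] using sm by (intro summable_add summable_mult)
  have LS: "L (Suc n) = - (1 - 2 * r) * strip_term 2 0 n (s, r)" for n
  proof -
    have "L (Suc n) = (-1) ^ Suc n * gauss_deriv (2 * n + 2) s * (a * real_mode 2 (Suc n) r + b * real_mode 1 (Suc n) r)"
      by (simp add: L_def strip_term_def algebra_simps)
    also have "a * real_mode 2 (Suc n) r + b * real_mode 1 (Suc n) r = (1 - 2 * r) * real_mode 0 n r"
      unfolding a_def b_def by (rule real_mode_ode[OF r])
    finally show ?thesis by (simp add: strip_term_def algebra_simps)
  qed
  have "a * strip_sol 0 2 (s, r) + b * strip_sol 0 1 (s, r) = suminf L"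
    unfolding strip_sol_def L_def using suminf_add[OF summable_mult[OF sm] summable_mult[OF sm]] suminf_mult[OF sm]
    by simp
  also have "\<dots> = (\<Sum>n. L (Suc n)) + L 0" using suminf_split_head[OF smL] by simp
  also have "L 0 = 0" using real_mode_Suc_0[of 0 r] real_mode_Suc_0[of 1 r]
    by (simp add: L_def strip_term_def numeral_2_eq_2)
  also have "(\<Sum>n. L (Suc n)) + 0 = (\<Sum>n. - (1 - 2 * r) * strip_term 2 0 n (s, r))" by (simp only: LS add_0_right)
  also have "(\<Sum>n. - (1 - 2 * r) * strip_term 2 0 n (s, r)) = - (1 - 2 * r) * strip_sol 2 0 (s, r)"
    unfolding strip_sol_def by (rule suminf_mult[OF sm])
  finally show ?thesis unfolding a_def[symmetric] b_def[symmetric] by (simp add: algebra_simps)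
qed

lemma strip_sol_axis: "strip_sol i 0 (s, 0) = gauss_deriv i s"
proof -
  have "strip_sol i 0 (s, 0) = (\<Sum>n. if n = 0 then gauss_deriv i s else 0)"
    unfolding strip_sol_def strip_term_def by (intro suminf_cong) (auto simp: real_mode_0)
  also have "\<dots> = gauss_deriv i s" using suminf_finite[of "{0}" "\<lambda>n::nat. if n = 0 then gauss_deriv i s else 0"] by simp
  finally show ?thesis .
qed

section \<open>Axisymmetric calculus and strip coordinates on the ball\<close>

text \<open>An axisymmetric function is a function of \<open>q\<^sub>1\<^sup>2 + q\<^sub>2\<^sup>2\<close> and \<open>q\<^sub>3\<close>, and its gradient has the form
  \<open>(b q\<^sub>1, b q\<^sub>2, c)\<close> with axisymmetric \<open>b\<close> and \<open>c\<close>. Working with \<open>b\<close> in place of the radial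
  derivative avoids all divisions by the distance from the axis.\<close>

definition axi_deriv :: "(real^3 \<Rightarrow> real) \<Rightarrow> real \<Rightarrow> real \<Rightarrow> real^3 \<Rightarrow> bool" where
  "axi_deriv f b c q \<longleftrightarrow> (f has_derivative (\<lambda>v. b * (q $ 1 * v $ 1 + q $ 2 * v $ 2) + c * v $ 3)) (at q)"

lemma axi_deriv_eq: "axi_deriv f b c q \<Longrightarrow> b = b' \<Longrightarrow> c = c' \<Longrightarrow> axi_deriv f b' c' q"
  by simp

lemma axi_deriv_const: "axi_deriv (\<lambda>q. k) 0 0 q"
  by (simp add: axi_deriv_def)

lemma axi_deriv_add:
  "axi_deriv f b c q \<Longrightarrow> axi_deriv g b' c' q \<Longrightarrow> axi_deriv (\<lambda>q. f q + g q) (b + b') (c + c') q"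
  unfolding axi_deriv_def by (drule (1) has_derivative_add) (simp add: algebra_simps)

lemma axi_deriv_diff:
  "axi_deriv f b c q \<Longrightarrow> axi_deriv g b' c' q \<Longrightarrow> axi_deriv (\<lambda>q. f q - g q) (b - b') (c - c') q"
  unfolding axi_deriv_def by (drule (1) has_derivative_diff) (simp add: algebra_simps)

lemma axi_deriv_mult:
  "axi_deriv f b c q \<Longrightarrow> axi_deriv g b' c' q \<Longrightarrow>
   axi_deriv (\<lambda>q. f q * g q) (f q * b' + b * g q) (f q * c' + c * g q) q"
  unfolding axi_deriv_def by (drule (1) has_derivative_mult) (simp add: algebra_simps)

lemma axi_deriv_compose:
  "axi_deriv f b c q \<Longrightarrow> (g has_field_derivative g') (at (f q)) \<Longrightarrow> axi_deriv (\<lambda>q. g (f q)) (g' * b) (g' * c) q"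
  unfolding axi_deriv_def
  by (drule has_derivative_compose[OF _ has_field_derivative_imp_has_derivative]) (auto simp: algebra_simps)

lemma axi_deriv_power:
  "axi_deriv f b c q \<Longrightarrow> axi_deriv (\<lambda>q. f q ^ n) (real n * f q ^ (n - 1) * b) (real n * f q ^ (n - 1) * c) q"
  by (rule axi_deriv_compose) (auto intro!: derivative_eq_intros)

lemma axi_deriv_axis: "axi_deriv (\<lambda>q. q $ 3) 0 1 q"
  by (simp add: axi_deriv_def bounded_linear_imp_has_derivative bounded_linear_vec_nth)

lemma axi_deriv_partial:
  assumes "axi_deriv f b c q"
  shows "partial 1 f q = b * q $ 1" "partial 2 f q = b * q $ 2" "partial 3 f q = c"
proof -
  have "frechet_derivative f (at q) = (\<lambda>v. b * (q $ 1 * v $ 1 + q $ 2 * v $ 2) + c * v $ 3)"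
    using frechet_derivative_at[OF assms[unfolded axi_deriv_def]] by simp
  then show "partial 1 f q = b * q $ 1" "partial 2 f q = b * q $ 2" "partial 3 f q = c"
    by (simp_all add: partial_def axis_def)
qed

text \<open>Write \<open>x\<close> for the distance from the axis and \<open>y = q\<^sub>3\<close>. The function \<open>bdef\<close> vanishes on the
  boundary sphere, \<open>pdist4\<close> is the square of the product of the distances to the end points of \<open>L\<close>,
  and \<open>ipd\<close> is the inverse of that product. The meridian half disc is mapped conformally onto a
  strip by \<open>s + i\<tau> = artanh (y + ix)\<close>, with \<open>0 \<le> \<tau> < \<pi>/4\<close>; then \<open>lon = s\<close> and \<open>lat = sin\<^sup>2 \<tau>\<close>. The
  latter, unlike the angle itself, is smooth across the axis.\<close>

definition rad2 :: "real^3 \<Rightarrow> real" where "rad2 q = (q $ 1)\<^sup>2 + (q $ 2)\<^sup>2"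
definition bdef :: "real^3 \<Rightarrow> real" where "bdef q = 1 - rad2 q - (q $ 3)\<^sup>2"
definition pdist4 :: "real^3 \<Rightarrow> real" where "pdist4 q = (bdef q)\<^sup>2 + 4 * rad2 q"
definition ipd :: "real^3 \<Rightarrow> real" where "ipd q = pdist4 q powr (-1/2)"
definition lon :: "real^3 \<Rightarrow> real" where
  "lon q = 1/4 * (ln ((1 + q $ 3)\<^sup>2 + rad2 q) - ln ((1 - q $ 3)\<^sup>2 + rad2 q))"
definition lat :: "real^3 \<Rightarrow> real" where "lat q = 1/2 * (1 - bdef q * ipd q)"

lemma rad2_nonneg: "rad2 q \<ge> 0" by (simp add: rad2_def)

lemma norm_sq_3: "(norm q)\<^sup>2 = rad2 q + (q $ 3)\<^sup>2" for q :: "real^3"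
  by (simp add: norm_vec_def L2_set_def sum_3 rad2_def)

lemma anderson_iff_bdef_pos: "q \<in> anderson \<longleftrightarrow> bdef q > 0"
proof -
  have "q \<in> anderson \<longleftrightarrow> (norm q)\<^sup>2 < 1" by (simp add: anderson_def abs_square_less_1)
  then show ?thesis unfolding norm_sq_3 bdef_def by auto
qed

lemma pole_factors:
  "((1 + q $ 3)\<^sup>2 + rad2 q) * ((1 - q $ 3)\<^sup>2 + rad2 q) = pdist4 q"
  by (simp add: pdist4_def bdef_def power2_eq_square algebra_simps)

lemma coord_bounds:
  assumes "q \<in> anderson"
  shows "0 < bdef q" "bdef q \<le> 1" "rad2 q < 1" "\<bar>q $ 3\<bar> < 1" "0 < pdist4 q" "pdist4 q \<le> 4"
    "(1 + q $ 3)\<^sup>2 + rad2 q > 0" "(1 - q $ 3)\<^sup>2 + rad2 q > 0"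
proof -
  have D: "bdef q > 0" using assms anderson_iff_bdef_pos by simp
  then show "0 < bdef q" .
  show "bdef q \<le> 1" using rad2_nonneg[of q] zero_le_power2[of "q $ 3"] unfolding bdef_def by linarith
  show "rad2 q < 1" using D zero_le_power2[of "q $ 3"] unfolding bdef_def by linarith
  have "(q $ 3)\<^sup>2 < 1" using D rad2_nonneg[of q] by (simp add: bdef_def)
  then show y: "\<bar>q $ 3\<bar> < 1" by (simp add: abs_square_less_1)
  show "0 < pdist4 q" using D rad2_nonneg[of q] by (simp add: pdist4_def add_pos_nonneg)
  have "(bdef q)\<^sup>2 \<le> bdef q"
    using D \<open>bdef q \<le> 1\<close> by (simp add: power2_eq_square mult_left_le)
  moreover have "rad2 q \<le> 1 - bdef q" by (simp add: bdef_def)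
  ultimately show "pdist4 q \<le> 4" using D by (simp add: pdist4_def)
  show "(1 + q $ 3)\<^sup>2 + rad2 q > 0" "(1 - q $ 3)\<^sup>2 + rad2 q > 0"
    using y rad2_nonneg[of q] by (auto intro!: add_pos_nonneg)
qed

lemma ipd_facts:
  assumes "q \<in> anderson"
  shows "ipd q > 0" "(ipd q)\<^sup>2 * pdist4 q = 1" "ipd q \<ge> 1/2" "0 < bdef q * ipd q" "bdef q * ipd q \<le> 1"
proof -
  note b = coord_bounds[OF assms]
  show pos: "ipd q > 0" using b by (simp add: ipd_def)
  have "(ipd q)\<^sup>2 = pdist4 q powr (-1)" using b by (simp add: ipd_def power2_eq_square flip: powr_add)
  then show e: "(ipd q)\<^sup>2 * pdist4 q = 1" using b by (simp add: powr_minus)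
  have "(1/2)\<^sup>2 \<le> (ipd q)\<^sup>2"
  proof -
    have "1 \<le> (ipd q)\<^sup>2 * 4" unfolding e[symmetric] using b by (intro mult_left_mono) auto
    then show ?thesis by (simp add: power2_eq_square)
  qed
  then show "ipd q \<ge> 1/2" using pos by (simp add: power2_le_iff_abs_le)
  show "0 < bdef q * ipd q" using pos b by simp
  have "(bdef q * ipd q)\<^sup>2 \<le> (ipd q)\<^sup>2 * pdist4 q"
    using rad2_nonneg[of q] by (simp add: pdist4_def power_mult_distrib algebra_simps)
  then show "bdef q * ipd q \<le> 1" unfolding e by (metis power2_le_iff_abs_le abs_le_D1 one_power2 zero_le_one)
qed

lemma lat_bounds:
  assumes "q \<in> anderson"
  shows "0 \<le> lat q" "lat q < 1/2" "1 - 2 * lat q = bdef q * ipd q"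
  using ipd_facts[OF assms] by (auto simp: lat_def field_simps)

text \<open>The ratio of the squared distances to the two end points of \<open>L\<close> is \<open>exp (4 lon)\<close>, and the
  larger of these squares is at least 1.\<close>

lemma exp_lon_le:
  assumes "q \<in> anderson"
  shows "exp (- 4 * \<bar>lon q\<bar>) \<le> pdist4 q"
proof -
  define P Q where "P = (1 + q $ 3)\<^sup>2 + rad2 q" and "Q = (1 - q $ 3)\<^sup>2 + rad2 q"
  have pos: "P > 0" "Q > 0" using coord_bounds[OF assms] by (auto simp: P_def Q_def)
  have PQ: "pdist4 q = P * Q" using pole_factors by (simp add: P_def Q_def)
  have sum: "P + Q \<ge> 2" using rad2_nonneg[of q] by (simp add: P_def Q_def power2_eq_square algebra_simps)
  have l: "4 * lon q = ln (P / Q)" using pos by (simp add: lon_def P_def[symmetric] Q_def[symmetric] ln_div)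
  have key: "a / b \<le> a * b" if "a > 0" "a \<le> b" "a + b \<ge> 2" for a b :: real
  proof -
    have "1 \<le> b" using that by linarith
    then have "1 \<le> b * b" using mult_mono[of 1 b 1 b] by simp
    then have "a * 1 \<le> a * (b * b)" using that by (intro mult_left_mono) auto
    then show ?thesis using that by (simp add: divide_simps mult_ac)
  qed
  show ?thesis
  proof (cases "P \<le> Q")
    case True
    then have "ln (P / Q) \<le> 0" using pos by simp
    then have "- 4 * \<bar>lon q\<bar> = ln (P / Q)" using l by linarith
    then show ?thesis using pos key[OF pos(1) True sum] by (simp add: PQ)
  next
    case False
    then have "ln (P / Q) \<ge> 0" using pos by simp
    then have "- 4 * \<bar>lon q\<bar> = - ln (P / Q)" using l by linarith
    also have "\<dots> = ln (Q / P)" using pos by (simp add: ln_div)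
    finally have "exp (- 4 * \<bar>lon q\<bar>) = Q / P" using pos by simp
    then show ?thesis using key[of Q P] pos sum False by (simp add: PQ mult.commute)
  qed
qed

text \<open>Decay in \<open>lon\<close> pays for any power of the singular function \<open>ipd\<close>. This is why the value on the
  axis is chosen to decay rapidly.\<close>

lemma exp_lon_ipd_le:
  assumes "q \<in> anderson" "c \<ge> 2 * real k"
  shows "exp (- c * \<bar>lon q\<bar>) * (ipd q) ^ k \<le> 1"
proof -
  note b = coord_bounds[OF assms(1)] and i = ipd_facts[OF assms(1)]
  have "(exp (- c * \<bar>lon q\<bar>) * (ipd q) ^ k)\<^sup>2 \<le> (exp (- 4 * \<bar>lon q\<bar>)) ^ k * ((ipd q)\<^sup>2) ^ k"
  proof -
    have "2 * (2 * real k) * \<bar>lon q\<bar> \<le> 2 * c * \<bar>lon q\<bar>" using assms(2) by (intro mult_right_mono) auto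
    then have "(exp (- c * \<bar>lon q\<bar>))\<^sup>2 \<le> (exp (- 4 * \<bar>lon q\<bar>)) ^ k"
      by (simp add: power2_eq_square algebra_simps flip: exp_add exp_of_nat_mult)
    then show ?thesis using i by (simp add: power_mult_distrib mult.commute mult_right_mono flip: power_mult)
  qed
  also have "\<dots> \<le> (pdist4 q) ^ k * ((ipd q)\<^sup>2) ^ k"
    using exp_lon_le[OF assms(1)] by (intro mult_right_mono power_mono) auto
  also have "\<dots> = 1" using i(2) by (simp add: mult.commute flip: power_mult_distrib)
  finally show ?thesis by (metis power2_le_iff_abs_le abs_le_D1 one_power2 zero_le_one)
qed

lemma axi_deriv_rad2: "axi_deriv rad2 2 0 q"
proof -
  have d: "((\<lambda>q. q $ i) has_derivative (\<lambda>v. v $ i)) (at q)" for i and q :: "real^3"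
    by (simp add: bounded_linear_imp_has_derivative bounded_linear_vec_nth)
  show ?thesis
    unfolding rad2_def[abs_def] axi_deriv_def
    by (rule has_derivative_eq_rhs[OF has_derivative_add[OF has_derivative_power[OF d] has_derivative_power[OF d]]])
      (auto simp: algebra_simps)
qed

lemma axi_deriv_bdef: "axi_deriv bdef (-2) (-2 * q $ 3) q"
  unfolding bdef_def[abs_def]
  by (rule axi_deriv_eq[OF axi_deriv_diff[OF axi_deriv_diff[OF axi_deriv_const axi_deriv_rad2]
        axi_deriv_power[OF axi_deriv_axis, where n=2]]]) auto

text \<open>Here and below, suffixes \<open>_b\<close> and \<open>_c\<close> denote the two coefficients of the gradient of an
  axisymmetric function; the prefix \<open>N\<close> belongs to \<open>pdist4\<close> and \<open>I\<close> to \<open>ipd\<close>. Two such letters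
  denote second derivatives.\<close>

definition N_b where "N_b q = 8 - 4 * bdef q"
definition N_c where "N_c q = - 4 * bdef q * q $ 3" for q :: "real^3"

lemma axi_deriv_pdist4: "axi_deriv pdist4 (N_b q) (N_c q) q"
  unfolding pdist4_def[abs_def]
  by (rule axi_deriv_eq[OF axi_deriv_add[OF axi_deriv_power[OF axi_deriv_bdef, where n=2]
        axi_deriv_mult[OF axi_deriv_const axi_deriv_rad2]]])
    (auto simp: N_b_def N_c_def)

definition I_b where "I_b q = - 1/2 * N_b q * (ipd q) ^ 3"
definition I_c where "I_c q = - 1/2 * N_c q * (ipd q) ^ 3"

lemma axi_deriv_ipd:
  assumes "q \<in> anderson"
  shows "axi_deriv ipd (I_b q) (I_c q) q"
proof -
  have "pdist4 q powr (- 1/2 - 1) = (ipd q) ^ 3"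
    using coord_bounds(5)[OF assms] by (simp add: ipd_def powr_power)
  then show ?thesis
    unfolding ipd_def[abs_def]
    by (intro axi_deriv_eq[OF axi_deriv_compose[OF axi_deriv_pdist4 has_real_derivative_powr[OF coord_bounds(5)[OF assms], of "- 1/2"]]])
      (auto simp: I_b_def I_c_def ipd_def)
qed

definition lon_b where "lon_b q = - 2 * q $ 3 * (ipd q)\<^sup>2" for q :: "real^3"
definition lon_c where "lon_c q = (bdef q + 2 * rad2 q) * (ipd q)\<^sup>2"
definition lat_b where "lat_b q = (4 * rad2 q + 2 * bdef q) * (ipd q) ^ 3"
definition lat_c where "lat_c q = 4 * rad2 q * q $ 3 * (ipd q) ^ 3" for q :: "real^3"

lemma ipd2_eq: "q \<in> anderson \<Longrightarrow> (ipd q)\<^sup>2 = 1 / pdist4 q"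
  using ipd_facts(2)[of q] coord_bounds(5)[of q] by (simp add: field_simps)

lemma axi_deriv_lon:
  assumes "q \<in> anderson"
  shows "axi_deriv lon (lon_b q) (lon_c q) q"
proof -
  define P Q where "P = (1 + q $ 3)\<^sup>2 + rad2 q" and "Q = (1 - q $ 3)\<^sup>2 + rad2 q"
  have pos: "P > 0" "Q > 0" using coord_bounds[OF assms] by (auto simp: P_def Q_def)
  have dP: "axi_deriv (\<lambda>q. (1 + q $ 3)\<^sup>2 + rad2 q) 2 (2 * (1 + q $ 3)) q"
    by (rule axi_deriv_eq[OF axi_deriv_add[OF axi_deriv_power[OF axi_deriv_add[OF axi_deriv_const axi_deriv_axis], where n=2] axi_deriv_rad2]]) auto
  have dQ: "axi_deriv (\<lambda>q. (1 - q $ 3)\<^sup>2 + rad2 q) 2 (- 2 * (1 - q $ 3)) q"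
    by (rule axi_deriv_eq[OF axi_deriv_add[OF axi_deriv_power[OF axi_deriv_diff[OF axi_deriv_const axi_deriv_axis], where n=2] axi_deriv_rad2]]) auto
  have "axi_deriv lon (0 * (ln P - ln Q) + 1/4 * (1 / P * 2 - 1 / Q * 2))
      (0 * (ln P - ln Q) + 1/4 * (1 / P * (2 * (1 + q $ 3)) - 1 / Q * (- 2 * (1 - q $ 3)))) q"
    unfolding lon_def[abs_def]
    by (rule axi_deriv_eq[OF axi_deriv_mult[OF axi_deriv_const axi_deriv_diff[OF
        axi_deriv_compose[OF dP DERIV_ln_divide] axi_deriv_compose[OF dQ DERIV_ln_divide]]]])
      (use pos in \<open>auto simp: P_def Q_def\<close>)
  moreover have "0 * (ln P - ln Q) + 1/4 * (1 / P * 2 - 1 / Q * 2) = lon_b q"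
  proof -
    have "0 * (ln P - ln Q) + 1/4 * (1 / P * 2 - 1 / Q * 2) = (Q - P) / (2 * (P * Q))"
      using pos by (simp add: field_simps)
    also have "Q - P = - 4 * q $ 3" by (simp add: P_def Q_def power2_eq_square algebra_simps)
    also have "P * Q = pdist4 q" using pole_factors by (simp add: P_def Q_def)
    finally show ?thesis by (simp add: lon_b_def ipd2_eq[OF assms])
  qed
  moreover have "0 * (ln P - ln Q) + 1/4 * (1 / P * (2 * (1 + q $ 3)) - 1 / Q * (- 2 * (1 - q $ 3))) = lon_c q"
  proof -
    have "0 * (ln P - ln Q) + 1/4 * (1 / P * (2 * (1 + q $ 3)) - 1 / Q * (- 2 * (1 - q $ 3)))
        = ((1 + q $ 3) * Q + (1 - q $ 3) * P) / (2 * (P * Q))"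
      using pos by (simp add: field_simps)
    also have "(1 + q $ 3) * Q + (1 - q $ 3) * P = 2 * (bdef q + 2 * rad2 q)"
      by (simp add: P_def Q_def bdef_def power2_eq_square algebra_simps)
    also have "P * Q = pdist4 q" using pole_factors by (simp add: P_def Q_def)
    also have "2 * (bdef q + 2 * rad2 q) / (2 * pdist4 q) = lon_c q"
      unfolding lon_c_def ipd2_eq[OF assms] using coord_bounds(5)[OF assms] by (simp add: field_simps)
    finally show ?thesis .
  qed
  ultimately show ?thesis by (simp only:)
qed

lemma axi_deriv_lat:
  assumes "q \<in> anderson"
  shows "axi_deriv lat (lat_b q) (lat_c q) q"
proof -
  have i: "ipd q = (ipd q) ^ 3 * pdist4 q"
    using ipd_facts(2)[OF assms] by (simp add: power2_eq_square power3_eq_cube)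
  have "axi_deriv lat (- 1/2 * (bdef q * I_b q + (-2) * ipd q)) (- 1/2 * (bdef q * I_c q + (- 2 * q $ 3) * ipd q)) q"
    unfolding lat_def[abs_def]
    by (rule axi_deriv_eq[OF axi_deriv_mult[OF axi_deriv_const axi_deriv_diff[OF axi_deriv_const
        axi_deriv_mult[OF axi_deriv_bdef axi_deriv_ipd[OF assms]]]]]) (auto simp: field_simps)
  moreover have "- 1/2 * (bdef q * I_b q + (-2) * ipd q) = lat_b q"
  proof -
    have "- 1/2 * (bdef q * I_b q + (-2) * ipd q) = - 1/2 * bdef q * I_b q + (ipd q) ^ 3 * pdist4 q"
      unfolding i[symmetric] by (simp add: field_simps)
    also have "\<dots> = lat_b q" by (simp add: I_b_def N_b_def lat_b_def pdist4_def power2_eq_square algebra_simps)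
    finally show ?thesis .
  qed
  moreover have "- 1/2 * (bdef q * I_c q + (- 2 * q $ 3) * ipd q) = lat_c q"
  proof -
    have "- 1/2 * (bdef q * I_c q + (- 2 * q $ 3) * ipd q) = - 1/2 * bdef q * I_c q + q $ 3 * ((ipd q) ^ 3 * pdist4 q)"
      unfolding i[symmetric] by (simp add: field_simps)
    also have "\<dots> = lat_c q" by (simp add: I_c_def N_c_def lat_c_def pdist4_def power2_eq_square algebra_simps)
    finally show ?thesis .
  qed
  ultimately show ?thesis by simp
qed

definition lon_bb where "lon_bb q = 2 * q $ 3 * N_b q * (ipd q) ^ 4" for q :: "real^3"
definition lon_bc where "lon_bc q = - 2 * (ipd q)\<^sup>2 + 2 * q $ 3 * N_c q * (ipd q) ^ 4" for q :: "real^3"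
definition lon_cc where "lon_cc q = - 2 * q $ 3 * (ipd q)\<^sup>2 - (bdef q + 2 * rad2 q) * N_c q * (ipd q) ^ 4" for q :: "real^3"
definition lat_bb where "lat_bb q = 4 * (ipd q) ^ 3 - 3/2 * (4 * rad2 q + 2 * bdef q) * N_b q * (ipd q) ^ 5"
definition lat_bc where "lat_bc q = - 4 * q $ 3 * (ipd q) ^ 3 - 3/2 * (4 * rad2 q + 2 * bdef q) * N_c q * (ipd q) ^ 5" for q :: "real^3"
definition lat_cc where "lat_cc q = 4 * rad2 q * (ipd q) ^ 3 - 6 * rad2 q * q $ 3 * N_c q * (ipd q) ^ 5" for q :: "real^3"

lemma axi_deriv_ipd_power:
  assumes "q \<in> anderson"
  shows "axi_deriv (\<lambda>q. (ipd q)\<^sup>2) (- N_b q * (ipd q) ^ 4) (- N_c q * (ipd q) ^ 4) q"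
    and "axi_deriv (\<lambda>q. (ipd q) ^ 3) (- 3/2 * N_b q * (ipd q) ^ 5) (- 3/2 * N_c q * (ipd q) ^ 5) q"
  by (rule axi_deriv_eq[OF axi_deriv_power[OF axi_deriv_ipd[OF assms]]];
      simp add: I_b_def I_c_def power2_eq_square eval_nat_numeral algebra_simps)+

lemma axi_deriv_lon_b:
  assumes "q \<in> anderson"
  shows "axi_deriv lon_b (lon_bb q) (lon_bc q) q"
  unfolding lon_b_def[abs_def]
  by (rule axi_deriv_eq[OF axi_deriv_mult[OF axi_deriv_mult[OF axi_deriv_const axi_deriv_axis] axi_deriv_ipd_power(1)[OF assms]]])
    (auto simp: lon_bb_def lon_bc_def)

lemma axi_deriv_bdef_rad2:
  "axi_deriv (\<lambda>q. bdef q + 2 * rad2 q) 2 (- 2 * q $ 3) q"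
  "axi_deriv (\<lambda>q. 4 * rad2 q + 2 * bdef q) 4 (- 4 * q $ 3) q"
  "axi_deriv (\<lambda>q. 4 * rad2 q * q $ 3) (8 * q $ 3) (4 * rad2 q) q"
proof -
  show "axi_deriv (\<lambda>q. bdef q + 2 * rad2 q) 2 (- 2 * q $ 3) q"
    by (rule axi_deriv_eq[OF axi_deriv_add[OF axi_deriv_bdef axi_deriv_mult[OF axi_deriv_const axi_deriv_rad2]]]) auto
  show "axi_deriv (\<lambda>q. 4 * rad2 q + 2 * bdef q) 4 (- 4 * q $ 3) q"
    by (rule axi_deriv_eq[OF axi_deriv_add[OF axi_deriv_mult[OF axi_deriv_const axi_deriv_rad2]
          axi_deriv_mult[OF axi_deriv_const axi_deriv_bdef]]]) auto
  show "axi_deriv (\<lambda>q. 4 * rad2 q * q $ 3) (8 * q $ 3) (4 * rad2 q) q"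
    by (rule axi_deriv_eq[OF axi_deriv_mult[OF axi_deriv_mult[OF axi_deriv_const axi_deriv_rad2] axi_deriv_axis]]) auto
qed

text \<open>Used to homogenise expressions: after it, the identities below become polynomial identities in
  the coordinates.\<close>

lemma ipd_reduce:
  assumes "q \<in> anderson"
  shows "(ipd q)\<^sup>2 = (ipd q) ^ 4 * pdist4 q" "(ipd q) ^ 3 = (ipd q) ^ 5 * pdist4 q"
proof -
  have e: "ipd q * (ipd q * pdist4 q) = 1" using ipd_facts(2)[OF assms] by (simp add: power2_eq_square mult.assoc)
  show "(ipd q)\<^sup>2 = (ipd q) ^ 4 * pdist4 q" "(ipd q) ^ 3 = (ipd q) ^ 5 * pdist4 q"
    by (simp_all add: eval_nat_numeral mult.assoc e)
qed

lemma axi_deriv_lon_c: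
  assumes "q \<in> anderson"
  shows "axi_deriv lon_c (lon_bc q) (lon_cc q) q"
proof -
  have "axi_deriv lon_c ((bdef q + 2 * rad2 q) * (- N_b q * (ipd q) ^ 4) + 2 * (ipd q)\<^sup>2)
     ((bdef q + 2 * rad2 q) * (- N_c q * (ipd q) ^ 4) + (- 2 * q $ 3) * (ipd q)\<^sup>2) q"
    unfolding lon_c_def[abs_def]
    by (rule axi_deriv_mult[OF axi_deriv_bdef_rad2(1) axi_deriv_ipd_power(1)[OF assms]])
  moreover have "(bdef q + 2 * rad2 q) * (- N_b q * (ipd q) ^ 4) + 2 * (ipd q)\<^sup>2 = lon_bc q"
    unfolding lon_bc_def ipd_reduce(1)[OF assms]
    by (simp add: N_b_def N_c_def pdist4_def bdef_def power2_eq_square algebra_simps)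
  moreover have "(bdef q + 2 * rad2 q) * (- N_c q * (ipd q) ^ 4) + (- 2 * q $ 3) * (ipd q)\<^sup>2 = lon_cc q"
    by (simp add: lon_cc_def algebra_simps)
  ultimately show ?thesis by (simp only:)
qed

lemma axi_deriv_lat_b:
  assumes "q \<in> anderson"
  shows "axi_deriv lat_b (lat_bb q) (lat_bc q) q"
  unfolding lat_b_def[abs_def]
  by (rule axi_deriv_eq[OF axi_deriv_mult[OF axi_deriv_bdef_rad2(2) axi_deriv_ipd_power(2)[OF assms]]])
    (auto simp: lat_bb_def lat_bc_def algebra_simps)

lemma axi_deriv_lat_c:
  assumes "q \<in> anderson"
  shows "axi_deriv lat_c (lat_bc q) (lat_cc q) q"
proof -
  have "axi_deriv lat_c (4 * rad2 q * q $ 3 * (- 3/2 * N_b q * (ipd q) ^ 5) + 8 * q $ 3 * (ipd q) ^ 3)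
     (4 * rad2 q * q $ 3 * (- 3/2 * N_c q * (ipd q) ^ 5) + 4 * rad2 q * (ipd q) ^ 3) q"
    unfolding lat_c_def[abs_def]
    by (rule axi_deriv_mult[OF axi_deriv_bdef_rad2(3) axi_deriv_ipd_power(2)[OF assms]])
  moreover have "4 * rad2 q * q $ 3 * (- 3/2 * N_b q * (ipd q) ^ 5) + 8 * q $ 3 * (ipd q) ^ 3 = lat_bc q"
    unfolding lat_bc_def ipd_reduce(2)[OF assms]
    by (simp add: N_b_def N_c_def pdist4_def bdef_def power2_eq_square algebra_simps)
  moreover have "4 * rad2 q * q $ 3 * (- 3/2 * N_c q * (ipd q) ^ 5) + 4 * rad2 q * (ipd q) ^ 3 = lat_cc q"
    by (simp add: lat_cc_def algebra_simps)
  ultimately show ?thesis by (simp only:)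
qed

text \<open>These identities express that \<open>artanh\<close> is conformal with derivative of modulus \<open>ipd\<close>; the
  right hand side of the last one is \<open>(d lat/d\<tau>)\<^sup>2 ipd\<^sup>2\<close>.\<close>

lemma orthogonal_coords:
  assumes "q \<in> anderson"
  shows "rad2 q * (lon_b q)\<^sup>2 + (lon_c q)\<^sup>2 = (ipd q)\<^sup>2"
    and "rad2 q * (lon_b q * lat_b q) + lon_c q * lat_c q = 0"
    and "rad2 q * (lat_b q)\<^sup>2 + (lat_c q)\<^sup>2 = 4 * rad2 q * (ipd q) ^ 4"
proof -
  show "rad2 q * (lon_b q)\<^sup>2 + (lon_c q)\<^sup>2 = (ipd q)\<^sup>2"
    unfolding ipd_reduce(1)[OF assms]
    by (simp add: lon_b_def lon_c_def pdist4_def bdef_def power2_eq_square eval_nat_numeral algebra_simps)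
  show "rad2 q * (lon_b q * lat_b q) + lon_c q * lat_c q = 0"
    by (simp add: lon_b_def lon_c_def lat_b_def lat_c_def algebra_simps)
  have i: "(ipd q) ^ 4 = (ipd q) ^ 6 * pdist4 q"
    using ipd_reduce(2)[OF assms] by (simp add: eval_nat_numeral)
  show "rad2 q * (lat_b q)\<^sup>2 + (lat_c q)\<^sup>2 = 4 * rad2 q * (ipd q) ^ 4"
    unfolding i
    by (simp add: lat_b_def lat_c_def pdist4_def bdef_def power2_eq_square eval_nat_numeral algebra_simps)
qed

text \<open>The subtracted term is the inner product with the gradient of \<open>- ln ipd\<close>, which is one part of
  the first order term in the harmonic equation.\<close>

lemma lon_laplace:
  assumes "q \<in> anderson"
  shows "2 * lon_b q + rad2 q * lon_bb q + lon_cc q - 1/2 * (ipd q)\<^sup>2 * (rad2 q * N_b q * lon_b q + N_c q * lon_c q) = 0"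
proof -
  have "2 * lon_b q + rad2 q * lon_bb q + lon_cc q - 1/2 * (ipd q)\<^sup>2 * (rad2 q * N_b q * lon_b q + N_c q * lon_c q)
    = - 6 * q $ 3 * (ipd q)\<^sup>2 + (3 * rad2 q * q $ 3 * N_b q - 3/2 * (bdef q + 2 * rad2 q) * N_c q) * (ipd q) ^ 4"
    by (simp add: lon_b_def lon_c_def lon_bb_def lon_cc_def power2_eq_square eval_nat_numeral algebra_simps)
  also have "\<dots> = 0"
    unfolding ipd_reduce(1)[OF assms]
    by (simp add: N_b_def N_c_def pdist4_def bdef_def power2_eq_square field_simps)
  finally show ?thesis .
qed

lemma lat_laplace:
  assumes "q \<in> anderson"
  shows "2 * lat_b q + rad2 q * lat_bb q + lat_cc q - 1/2 * (ipd q)\<^sup>2 * (rad2 q * N_b q * lat_b q + N_c q * lat_c q)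
    = 4 * bdef q * (ipd q) ^ 3"
proof -
  have "2 * lat_b q + rad2 q * lat_bb q + lat_cc q - 1/2 * (ipd q)\<^sup>2 * (rad2 q * N_b q * lat_b q + N_c q * lat_c q)
     - 4 * bdef q * (ipd q) ^ 3
    = (16 * rad2 q) * (ipd q) ^ 3
      - (2 * rad2 q * (4 * rad2 q + 2 * bdef q) * N_b q + 8 * rad2 q * q $ 3 * N_c q) * (ipd q) ^ 5"
    by (simp add: lat_b_def lat_c_def lat_bb_def lat_cc_def power2_eq_square eval_nat_numeral algebra_simps)
  also have "\<dots> = 0"
    unfolding ipd_reduce(2)[OF assms]
    by (simp add: N_b_def N_c_def pdist4_def bdef_def power2_eq_square field_simps)
  finally show ?thesis by simp
qed

section \<open>The harmonic potential\<close>

text \<open>The superposition of separated solutions, and its partial derivatives in the strip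
  coordinates, as functions on the ball.\<close>

definition Phi :: "nat \<Rightarrow> nat \<Rightarrow> real^3 \<Rightarrow> real" where
  "Phi i j q = strip_sol i j (lon q, lat q)"

lemma axi_deriv_Phi:
  assumes "q \<in> anderson"
  shows "axi_deriv (Phi i j) (Phi (Suc i) j q * lon_b q + Phi i (Suc j) q * lat_b q)
    (Phi (Suc i) j q * lon_c q + Phi i (Suc j) q * lat_c q) q"
proof -
  have "\<bar>snd (lon q, lat q)\<bar> < 1/2" using lat_bounds[OF assms] by simp
  from has_derivative_compose[OF has_derivative_Pair[OF axi_deriv_lon[OF assms, unfolded axi_deriv_def]
      axi_deriv_lat[OF assms, unfolded axi_deriv_def]] strip_sol_has_derivative[OF this]]
  show ?thesis
    unfolding axi_deriv_def Phi_def[abs_def]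
    by (rule has_derivative_eq_rhs) (auto simp: algebra_simps)
qed

definition pot :: "real^3 \<Rightarrow> real" where "pot = Phi 0 0"
definition pot_b where "pot_b q = Phi 1 0 q * lon_b q + Phi 0 1 q * lat_b q"
definition pot_c where "pot_c q = Phi 1 0 q * lon_c q + Phi 0 1 q * lat_c q"
definition hes_bb where
  "hes_bb q = (Phi 2 0 q * lon_b q + Phi 1 1 q * lat_b q) * lon_b q + Phi 1 0 q * lon_bb q
    + (Phi 1 1 q * lon_b q + Phi 0 2 q * lat_b q) * lat_b q + Phi 0 1 q * lat_bb q"
definition hes_bc where
  "hes_bc q = (Phi 2 0 q * lon_c q + Phi 1 1 q * lat_c q) * lon_b q + Phi 1 0 q * lon_bc q
    + (Phi 1 1 q * lon_c q + Phi 0 2 q * lat_c q) * lat_b q + Phi 0 1 q * lat_bc q"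
definition hes_cc where
  "hes_cc q = (Phi 2 0 q * lon_c q + Phi 1 1 q * lat_c q) * lon_c q + Phi 1 0 q * lon_cc q
    + (Phi 1 1 q * lon_c q + Phi 0 2 q * lat_c q) * lat_c q + Phi 0 1 q * lat_cc q"

lemma axi_deriv_pot:
  assumes "q \<in> anderson"
  shows "axi_deriv pot (pot_b q) (pot_c q) q"
  using axi_deriv_Phi[OF assms, of 0 0] by (simp add: pot_def pot_b_def pot_c_def)

lemma axi_deriv_pot_b:
  assumes "q \<in> anderson"
  shows "axi_deriv pot_b (hes_bb q) (hes_bc q) q"
  unfolding pot_b_def[abs_def]
  by (rule axi_deriv_eq[OF axi_deriv_add[OF
        axi_deriv_mult[OF axi_deriv_Phi[OF assms] axi_deriv_lon_b[OF assms]]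
        axi_deriv_mult[OF axi_deriv_Phi[OF assms] axi_deriv_lat_b[OF assms]]]])
    (simp_all add: hes_bb_def hes_bc_def numeral_2_eq_2)

lemma axi_deriv_pot_c:
  assumes "q \<in> anderson"
  shows "axi_deriv pot_c (hes_bc q) (hes_cc q) q"
  unfolding pot_c_def[abs_def]
  by (rule axi_deriv_eq[OF axi_deriv_add[OF
        axi_deriv_mult[OF axi_deriv_Phi[OF assms] axi_deriv_lon_c[OF assms]]
        axi_deriv_mult[OF axi_deriv_Phi[OF assms] axi_deriv_lat_c[OF assms]]]])
    (simp_all add: hes_cc_def hes_bc_def numeral_2_eq_2 algebra_simps)

text \<open>This is the positive root of \<open>bdef\<^sup>2 * psi * (1 + rad2 * psi) = 1\<close>. The square of the warping
  function is \<open>rad2 * psi\<close>, and harmonic functions that are axisymmetric are those with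
  \<open>div (sqrt psi * \<nabla>F) = 0\<close> in the Euclidean sense.\<close>

definition psi where "psi q = 2 * (ipd q)\<^sup>2 / ((bdef q * ipd q) * (1 + bdef q * ipd q))"
definition psi_b where
  "psi_b q = psi q * (- N_b q * (ipd q)\<^sup>2 + 2 * lat_b q * (1 / (bdef q * ipd q) + 1 / (1 + bdef q * ipd q)))"
definition psi_c where
  "psi_c q = psi q * (- N_c q * (ipd q)\<^sup>2 + 2 * lat_c q * (1 / (bdef q * ipd q) + 1 / (1 + bdef q * ipd q)))"

lemma psi_facts:
  assumes "q \<in> anderson"
  shows "psi q > 0" "(bdef q)\<^sup>2 * psi q * (1 + rad2 q * psi q) = 1" "bdef q * psi q \<le> 2 * ipd q"
    "(bdef q)\<^sup>2 * psi q \<le> 1"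
proof -
  define u where "u = bdef q * ipd q"
  have u0: "0 < u" "u \<le> 1" and i: "ipd q > 0" and D: "bdef q > 0"
    using ipd_facts[OF assms] coord_bounds[OF assms] unfolding u_def by blast+
  then have u: "0 < u" "u \<le> 1" "1 + u > 0" by auto
  have psi: "psi q = 2 * (ipd q)\<^sup>2 / (u * (1 + u))" by (simp add: psi_def u_def)
  show pos: "psi q > 0" unfolding psi using u i by auto
  have dp: "bdef q * psi q = 2 * ipd q / (1 + u)"
    unfolding psi using u i D by (simp add: u_def divide_simps power2_eq_square)
  have "(bdef q)\<^sup>2 * psi q = bdef q * (bdef q * psi q)" by (simp add: power2_eq_square)
  also have "\<dots> = 2 * (bdef q * ipd q) / (1 + u)" unfolding dp by simp
  finally have d2: "(bdef q)\<^sup>2 * psi q = 2 * u / (1 + u)" by (simp only: u_def)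
  have "4 * rad2 q * (ipd q)\<^sup>2 = 1 - u\<^sup>2"
    using ipd_facts(2)[OF assms] by (simp add: pdist4_def u_def power_mult_distrib algebra_simps)
  moreover have "rad2 q * psi q = (4 * rad2 q * (ipd q)\<^sup>2) / (2 * (u * (1 + u)))"
    unfolding psi by simp
  ultimately have "rad2 q * psi q = (1 - u\<^sup>2) / (2 * (u * (1 + u)))" by (simp only:)
  also have "\<dots> = (1 - u) / (2 * u)" using u by (simp add: divide_simps power2_eq_square) (simp add: algebra_simps)
  finally have "1 + rad2 q * psi q = (1 + u) / (2 * u)" using u by (simp add: field_simps)
  then show e: "(bdef q)\<^sup>2 * psi q * (1 + rad2 q * psi q) = 1" unfolding d2 using u by simp
  show "bdef q * psi q \<le> 2 * ipd q"
  proof -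
    have "2 * ipd q / (1 + u) \<le> 2 * ipd q / 1" using u i by (intro divide_left_mono) auto
    then show ?thesis unfolding dp by simp
  qed
  have "(bdef q)\<^sup>2 * psi q * 1 \<le> (bdef q)\<^sup>2 * psi q * (1 + rad2 q * psi q)"
    using pos rad2_nonneg[of q] by (intro mult_left_mono) auto
  then show "(bdef q)\<^sup>2 * psi q \<le> 1" unfolding e by simp
qed

lemma axi_deriv_psi:
  assumes "q \<in> anderson"
  shows "axi_deriv psi (psi_b q) (psi_c q) q"
proof -
  define u where "u = bdef q * ipd q"
  have "0 < u" using ipd_facts[OF assms] unfolding u_def by blast
  then have u: "0 < u" "1 + u > 0" by auto
  have du: "axi_deriv (\<lambda>q. bdef q * ipd q) (- 2 * lat_b q) (- 2 * lat_c q) q"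
  proof -
    have "axi_deriv (\<lambda>q. 1 - 2 * lat q) (- 2 * lat_b q) (- 2 * lat_c q) q"
      by (rule axi_deriv_eq[OF axi_deriv_diff[OF axi_deriv_const axi_deriv_mult[OF axi_deriv_const axi_deriv_lat[OF assms]]]]) auto
    moreover have "(\<lambda>q. 1 - 2 * lat q) = (\<lambda>q. bdef q * ipd q)" by (auto simp: lat_def field_simps)
    ultimately show ?thesis by simp
  qed
  have di: "axi_deriv (\<lambda>q. 2 * (ipd q)\<^sup>2) (2 * (- N_b q * (ipd q) ^ 4)) (2 * (- N_c q * (ipd q) ^ 4)) q"
    by (rule axi_deriv_eq[OF axi_deriv_mult[OF axi_deriv_const axi_deriv_ipd_power(1)[OF assms]]]) auto
  have d1: "axi_deriv (\<lambda>q. inverse (bdef q * ipd q)) (- inverse (u\<^sup>2) * (- 2 * lat_b q)) (- inverse (u\<^sup>2) * (- 2 * lat_c q)) q"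
    by (rule axi_deriv_compose[OF du]) (use u in \<open>auto intro!: derivative_eq_intros simp: u_def power2_eq_square\<close>)
  have d2: "axi_deriv (\<lambda>q. inverse (1 + bdef q * ipd q)) (- inverse ((1 + u)\<^sup>2) * (- 2 * lat_b q)) (- inverse ((1 + u)\<^sup>2) * (- 2 * lat_c q)) q"
    by (rule axi_deriv_compose[OF du, of "\<lambda>x. inverse (1 + x)"])
      (use u in \<open>auto intro!: derivative_eq_intros simp: u_def power2_eq_square\<close>)
  have eq: "psi = (\<lambda>q. 2 * (ipd q)\<^sup>2 * (inverse (bdef q * ipd q) * inverse (1 + bdef q * ipd q)))"
    by (auto simp: psi_def field_simps)
  define a b where "a = inverse u" and "b = inverse (1 + u)"
  have ab: "inverse (u\<^sup>2) = a\<^sup>2" "inverse ((1 + u)\<^sup>2) = b\<^sup>2" "inverse (bdef q * ipd q) = a"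
    "inverse (1 + bdef q * ipd q) = b"
    by (simp_all only: a_def b_def power_inverse) (simp_all only: u_def)
  have pq: "psi q = 2 * (ipd q)\<^sup>2 * (a * b)" by (simp only: eq ab)
  have v: "1 / (bdef q * ipd q) + 1 / (1 + bdef q * ipd q) = a + b" by (simp only: ab inverse_eq_divide[symmetric])
  have "axi_deriv (\<lambda>q. 2 * (ipd q)\<^sup>2 * (inverse (bdef q * ipd q) * inverse (1 + bdef q * ipd q))) (psi_b q) (psi_c q) q"
  proof (rule axi_deriv_eq[OF axi_deriv_mult[OF di axi_deriv_mult[OF d1 d2]]], goal_cases)
    case 1
    show ?case unfolding psi_b_def pq v unfolding ab by (simp add: algebra_simps power2_eq_square eval_nat_numeral)
  next
    case 2
    show ?case unfolding psi_c_def pq v unfolding ab by (simp add: algebra_simps power2_eq_square eval_nat_numeral)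
  qed
  then show ?thesis unfolding eq .
qed

text \<open>The Euclidean inner product of the gradients of \<open>psi\<close> and \<open>pot\<close>.\<close>

definition dpsi where "dpsi q = rad2 q * psi_b q * pot_b q + psi_c q * pot_c q"

text \<open>The logarithmic derivative of \<open>sqrt psi\<close> splits into a part along \<open>ipd\<close> and a part along
  \<open>lat\<close>. With the Laplacians of \<open>lon\<close> and \<open>lat\<close> computed above, the reduced equation of \<open>strip_sol\<close>
  turns into this one, which says that \<open>pot\<close> is harmonic for the Anderson metric.\<close>

lemma pot_pde:
  assumes q: "q \<in> anderson"
  shows "1/2 * dpsi q = - psi q * (2 * pot_b q + rad2 q * hes_bb q + hes_cc q)"
proof -
  define u where "u = bdef q * ipd q"
  have u0: "0 < u" "u \<le> 1" and i: "ipd q > 0" and D: "bdef q > 0"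
    using ipd_facts[OF q] coord_bounds[OF q] unfolding u_def by blast+
  then have u: "0 < u" "u \<le> 1" "1 + u > 0" by auto
  define v where "v = 1 / u + 1 / (1 + u)"
  define X sb sc gb gc where "X = rad2 q" and "sb = lon_b q" and "sc = lon_c q" and "gb = lat_b q" and "gc = lat_c q"
  define s2 sg g2 where "s2 = X * sb\<^sup>2 + sc\<^sup>2" and "sg = X * (sb * gb) + sc * gc" and "g2 = X * gb\<^sup>2 + gc\<^sup>2"
  have o: "s2 = (ipd q)\<^sup>2" "sg = 0" "g2 = 4 * X * (ipd q) ^ 4"
    using orthogonal_coords[OF q] by (auto simp: s2_def sg_def g2_def X_def sb_def sc_def gb_def gc_def)
  define Ls Lg where "Ls = 2 * sb + X * lon_bb q + lon_cc q - 1/2 * (ipd q)\<^sup>2 * (X * N_b q * sb + N_c q * sc)"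
    and "Lg = 2 * gb + X * lat_bb q + lat_cc q - 1/2 * (ipd q)\<^sup>2 * (X * N_b q * gb + N_c q * gc)"
  have L: "Ls = 0" "Lg = 4 * bdef q * (ipd q) ^ 3"
    using lon_laplace[OF q] lat_laplace[OF q] by (auto simp: Ls_def Lg_def X_def sb_def sc_def gb_def gc_def)
  define p20 p11 p02 p10 p01 where "p20 = Phi 2 0 q" and "p11 = Phi 1 1 q" and "p02 = Phi 0 2 q" and "p10 = Phi 1 0 q" and "p01 = Phi 0 1 q"
  have "2 * pot_b q + X * hes_bb q + hes_cc q
      + X * pot_b q * (- 1/2 * N_b q * (ipd q)\<^sup>2 + gb * v) + pot_c q * (- 1/2 * N_c q * (ipd q)\<^sup>2 + gc * v)
    = p20 * s2 + 2 * p11 * sg + p02 * g2 + p10 * (Ls + v * sg) + p01 * (Lg + v * g2)"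
    unfolding pot_b_def pot_c_def hes_bb_def hes_cc_def s2_def sg_def g2_def Ls_def Lg_def X_def[symmetric]
      sb_def[symmetric] sc_def[symmetric] gb_def[symmetric] gc_def[symmetric]
      p20_def[symmetric] p11_def[symmetric] p02_def[symmetric] p10_def[symmetric] p01_def[symmetric]
    by (simp add: power2_eq_square field_simps)
  also have "\<dots> = p20 * (ipd q)\<^sup>2 + p02 * (4 * X * (ipd q) ^ 4) + p01 * (4 * bdef q * (ipd q) ^ 3 + v * (4 * X * (ipd q) ^ 4))"
    unfolding o L by simp
  also have "\<dots> = (ipd q)\<^sup>2 * (p20 + p02 * (4 * X * (ipd q)\<^sup>2) + p01 * (4 * u + v * (4 * X * (ipd q)\<^sup>2)))"
    by (simp add: u_def algebra_simps eval_nat_numeral)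
  also have "4 * X * (ipd q)\<^sup>2 = 1 - u\<^sup>2"
    using ipd_facts(2)[OF q] by (simp add: X_def pdist4_def u_def power_mult_distrib algebra_simps)
  also have "p20 + p02 * (1 - u\<^sup>2) + p01 * (4 * u + v * (1 - u\<^sup>2)) = 0"
  proof -
    define r where "r = lat q"
    have r: "u = 1 - 2 * r" using lat_bounds(3)[OF q] by (simp add: u_def r_def)
    have "\<bar>r\<bar> < 1/2" using lat_bounds[OF q] by (simp add: r_def)
    from strip_sol_pde[OF this, of "lon q"]
    have "4 * r * (1 - r) * (1 - 2 * r) * p02 + (4 - 10 * r + 8 * r\<^sup>2) * p01 + (1 - 2 * r) * p20 = 0"
      by (simp add: p02_def p01_def p20_def Phi_def r_def)
    moreover have "u * (p20 + p02 * (1 - u\<^sup>2) + p01 * (4 * u + v * (1 - u\<^sup>2)))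
        = u * p20 + u * (1 - u\<^sup>2) * p02 + (4 * u\<^sup>2 + (u * v) * (1 - u\<^sup>2)) * p01"
      by (simp add: power2_eq_square algebra_simps)
    moreover have "(u * v) * (1 - u\<^sup>2) = (1 + 2 * u) * (1 - u)"
      unfolding v_def using u by (simp add: divide_simps power2_eq_square) (simp add: algebra_simps)
    moreover have "u * p20 + u * (1 - u\<^sup>2) * p02 + (4 * u\<^sup>2 + (1 + 2 * u) * (1 - u)) * p01
       = 4 * r * (1 - r) * (1 - 2 * r) * p02 + (4 - 10 * r + 8 * r\<^sup>2) * p01 + (1 - 2 * r) * p20"
      unfolding r by (simp add: power2_eq_square algebra_simps)
    ultimately have "u * (p20 + p02 * (1 - u\<^sup>2) + p01 * (4 * u + v * (1 - u\<^sup>2))) = 0" by (simp only:)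
    then show ?thesis using u by simp
  qed
  finally have sum: "2 * pot_b q + X * hes_bb q + hes_cc q
      + X * pot_b q * (- 1/2 * N_b q * (ipd q)\<^sup>2 + gb * v) + pot_c q * (- 1/2 * N_c q * (ipd q)\<^sup>2 + gc * v) = 0" by simp
  define W where "W = X * pot_b q * (- 1/2 * N_b q * (ipd q)\<^sup>2 + gb * v) + pot_c q * (- 1/2 * N_c q * (ipd q)\<^sup>2 + gc * v)"
  have "1/2 * dpsi q = psi q * W"
    unfolding dpsi_def psi_b_def psi_c_def u_def[symmetric] v_def[symmetric] X_def[symmetric] gb_def[symmetric] gc_def[symmetric] W_def
    by (simp add: field_simps)
  also have "W = - (2 * pot_b q + X * hes_bb q + hes_cc q)" using sum unfolding W_def by linarith
  finally show ?thesis unfolding X_def by (simp only: mult_minus_right mult_minus_left)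
qed

text \<open>The strip coordinates are singular only at the two end points of \<open>L\<close>. A crude power of \<open>ipd\<close>
  is enough, since decay in \<open>lon\<close> compensates for it.\<close>

lemma coord_deriv_bounds:
  assumes q: "q \<in> anderson"
    and f: "f \<in> {lon_b, lon_c, lat_b, lat_c, lon_bb, lon_bc, lon_cc, lat_bb, lat_bc, lat_cc}"
  shows "\<bar>f q\<bar> \<le> 100 * (2 * ipd q) ^ 5"
proof -
  define i y X D where "i = ipd q" and "y = q $ 3" and "X = rad2 q" and "D = bdef q"
  have i: "1/2 \<le> i" and y: "\<bar>y\<bar> \<le> 1" and X: "0 \<le> X" "X \<le> 1" and D: "0 \<le> D" "D \<le> 1"
    using ipd_facts[OF q] coord_bounds[OF q] rad2_nonneg[of q] by (auto simp: i_def y_def X_def D_def)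
  have pw: "(2 * i) ^ k \<le> (2 * i) ^ 5" if "k \<le> 5" for k using i that by (intro power_increasing) auto
  define J where "J = (2 * i) ^ 5"
  have J: "4 * i\<^sup>2 \<le> J" "8 * i ^ 3 \<le> J" "16 * i ^ 4 \<le> J" "32 * i ^ 5 \<le> J"
    using pw[of 2] pw[of 3] pw[of 4] pw[of 5] by (auto simp: J_def power_mult_distrib)
  have i0: "0 \<le> i\<^sup>2" "0 \<le> i ^ 3" "0 \<le> i ^ 4" "0 \<le> i ^ 5" using i by auto
  have m: "\<bar>a * p\<bar> \<le> k * p" if "\<bar>a\<bar> \<le> k" "0 \<le> p" for a k p :: real
    using that by (simp add: abs_mult mult_right_mono)
  have yy: "\<bar>a * y\<bar> \<le> k" if "\<bar>a\<bar> \<le> k" for a k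
  proof -
    have "\<bar>a\<bar> * \<bar>y\<bar> \<le> k * 1" using that y by (intro mult_mono) auto
    then show ?thesis by (simp add: abs_mult)
  qed
  have prod: "\<bar>a * b\<bar> \<le> k * l" if "\<bar>a\<bar> \<le> k" "\<bar>b\<bar> \<le> l" for a b k l :: real
    using that by (simp add: abs_mult mult_mono')
  have Nb: "\<bar>N_b q\<bar> \<le> 8" using D by (simp add: N_b_def D_def[symmetric])
  have Nc: "\<bar>N_c q\<bar> \<le> 4" using yy[of "-4 * D" 4] D by (simp add: N_c_def D_def[symmetric] y_def[symmetric])
  have a1: "\<bar>- 2 * y\<bar> \<le> 2" "\<bar>2 * y\<bar> \<le> 2" "\<bar>- 4 * y\<bar> \<le> 4" using y by auto
  have a2: "\<bar>D + 2 * X\<bar> \<le> 3" "\<bar>4 * X + 2 * D\<bar> \<le> 6" using X D by auto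
  have a3: "\<bar>4 * X * y\<bar> \<le> 4" "\<bar>6 * X * y\<bar> \<le> 6" using yy[of "4 * X" 4] yy[of "6 * X" 6] X by auto
  have a4: "\<bar>3/2 * (4 * X + 2 * D)\<bar> \<le> 9" "\<bar>4 * X\<bar> \<le> 4" using X D by auto
  note unf = i_def[symmetric] y_def[symmetric] X_def[symmetric] D_def[symmetric] J_def[symmetric]
  have "\<bar>lon_b q\<bar> \<le> 100 * J" unfolding lon_b_def unf using m[OF a1(1) i0(1)] J i0 by linarith
  moreover have "\<bar>lon_c q\<bar> \<le> 100 * J" unfolding lon_c_def unf using m[OF a2(1) i0(1)] J i0 by linarith
  moreover have "\<bar>lat_b q\<bar> \<le> 100 * J" unfolding lat_b_def unf using m[OF a2(2) i0(2)] J i0 by linarith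
  moreover have "\<bar>lat_c q\<bar> \<le> 100 * J" unfolding lat_c_def unf using m[OF a3(1) i0(2)] J i0 by linarith
  moreover have "\<bar>lon_bb q\<bar> \<le> 100 * J" unfolding lon_bb_def unf using m[OF prod[OF a1(2) Nb] i0(3)] J i0 by linarith
  moreover have "\<bar>lon_bc q\<bar> \<le> 100 * J" unfolding lon_bc_def unf using m[OF prod[OF a1(2) Nc] i0(3)] J i0 by linarith
  moreover have "\<bar>lon_cc q\<bar> \<le> 100 * J" unfolding lon_cc_def unf
    using m[OF a1(1) i0(1)] m[OF prod[OF a2(1) Nc] i0(3)] J i0 by linarith
  moreover have "\<bar>lat_bb q\<bar> \<le> 100 * J" unfolding lat_bb_def unf
    using m[OF prod[OF a4(1) Nb] i0(4)] J i0 by linarith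
  moreover have "\<bar>lat_bc q\<bar> \<le> 100 * J" unfolding lat_bc_def unf
    using m[OF a1(3) i0(2)] m[OF prod[OF a4(1) Nc] i0(4)] J i0 by linarith
  moreover have "\<bar>lat_cc q\<bar> \<le> 100 * J" unfolding lat_cc_def unf
    using m[OF a4(2) i0(2)] m[OF prod[OF a3(2) Nc] i0(4)] J i0 by linarith
  ultimately show ?thesis using f unfolding J_def i_def by auto
qed

lemma hes_estimate:
  fixes a b a' b' d d' :: real
  assumes "\<bar>a\<bar> \<le> M" "\<bar>b\<bar> \<le> M" "\<bar>a'\<bar> \<le> M" "\<bar>b'\<bar> \<le> M" "\<bar>d\<bar> \<le> M" "\<bar>d'\<bar> \<le> M" "M \<ge> 1"
    and "\<bar>p20\<bar> \<le> E" "\<bar>p11\<bar> \<le> E" "\<bar>p10\<bar> \<le> E" "\<bar>p01\<bar> \<le> E" "\<bar>p02\<bar> * D \<le> E" "0 < D" "D \<le> 1"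
  shows "D * \<bar>(p20 * a + p11 * b) * a' + p10 * d + (p11 * a + p02 * b) * b' + p01 * d'\<bar> \<le> 6 * (E * M\<^sup>2)"
proof -
  have E: "E \<ge> 0" using assms(8) abs_ge_zero[of p20] by linarith
  have M0: "M \<ge> 0" "M \<ge> 1" using assms(7) by auto
  have MM: "M \<le> M\<^sup>2" using M0 by (simp add: power2_eq_square)
  have two: "\<bar>p * x * y\<bar> \<le> E * M\<^sup>2" if "\<bar>p\<bar> \<le> E" "\<bar>x\<bar> \<le> M" "\<bar>y\<bar> \<le> M" for p x y
  proof -
    have "\<bar>p\<bar> * (\<bar>x\<bar> * \<bar>y\<bar>) \<le> E * (M * M)" using that E M0 by (intro mult_mono) auto
    then show ?thesis by (simp only: abs_mult power2_eq_square mult.assoc)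
  qed
  have one: "\<bar>p * x\<bar> \<le> E * M\<^sup>2" if "\<bar>p\<bar> \<le> E" "\<bar>x\<bar> \<le> M" for p x
  proof -
    have "\<bar>p\<bar> * \<bar>x\<bar> \<le> E * M" using that E M0 by (intro mult_mono) auto
    also have "\<dots> \<le> E * M\<^sup>2" using MM E by (intro mult_left_mono)
    finally show ?thesis by (simp only: abs_mult)
  qed
  have sc: "\<bar>D * p\<bar> \<le> E" if "\<bar>p\<bar> \<le> E" for p
  proof -
    have "D * \<bar>p\<bar> \<le> 1 * \<bar>p\<bar>" using assms(14) by (intro mult_right_mono) auto
    then show ?thesis using that assms(13) by (simp add: abs_mult)
  qed
  have "D * ((p20 * a + p11 * b) * a' + p10 * d + (p11 * a + p02 * b) * b' + p01 * d') =
     (D * p20) * a * a' + (D * p11) * b * a' + (D * p10) * d + (D * p11) * a * b' + (p02 * D) * b * b' + (D * p01) * d'"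
    by (simp add: algebra_simps)
  also have "\<bar>\<dots>\<bar> \<le> 6 * (E * M\<^sup>2)"
  proof -
    have "\<bar>p02 * D\<bar> \<le> E" using assms(12,13) by (simp add: abs_mult)
    from two[OF this assms(2,4)] two[OF sc[OF assms(8)] assms(1,3)] two[OF sc[OF assms(9)] assms(2,3)]
      one[OF sc[OF assms(10)] assms(5)] two[OF sc[OF assms(9)] assms(1,4)] one[OF sc[OF assms(11)] assms(6)]
    show ?thesis by linarith
  qed
  finally show ?thesis using assms(13) by (simp add: abs_mult)
qed

text \<open>The eigenvalue of the matrix of the covariant Hessian of \<open>pot\<close> that belongs to the eigenvector
  \<open>rot\<close>; see \<open>nabla_flat_rot\<close>.\<close>

definition tsn where
  "tsn q = (bdef q)\<^sup>2 * (psi q * pot_b q + 1/2 * dpsi q)"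

text \<open>The gradient of the potential is bounded, while its second derivatives may grow like the
  inverse of \<open>bdef\<close>. The bound for \<open>tsn\<close> rests on the harmonic equation, which replaces the
  derivative of \<open>psi\<close> by second derivatives of the potential. One factor \<open>ipd\<close> is kept in reserve
  for the volume density.\<close>

lemma potential_bounds:
  "\<exists>C\<ge>0. \<forall>q\<in>anderson. 2 * ipd q * \<bar>pot_b q\<bar> \<le> C \<and> 2 * ipd q * \<bar>pot_c q\<bar> \<le> C
     \<and> 2 * ipd q * (bdef q * \<bar>hes_bb q\<bar>) \<le> C \<and> 2 * ipd q * (bdef q * \<bar>hes_bc q\<bar>) \<le> C
     \<and> 2 * ipd q * (bdef q * \<bar>hes_cc q\<bar>) \<le> C \<and> 2 * ipd q * \<bar>tsn q\<bar> \<le> C"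
proof -
  have c: "(40::real) \<ge> 0" by simp
  note b = strip_sol_bounds[OF c]
  obtain C1 C2 C3 C4 C5 where
    C: "C1 \<ge> 0" "\<And>s r. r \<in> {0..<1/2} \<Longrightarrow> \<bar>strip_sol 1 0 (s, r)\<bar> \<le> C1 * exp (- 40 * \<bar>s\<bar>)"
     "C2 \<ge> 0" "\<And>s r. r \<in> {0..<1/2} \<Longrightarrow> \<bar>strip_sol 0 1 (s, r)\<bar> \<le> C2 * exp (- 40 * \<bar>s\<bar>)"
     "C3 \<ge> 0" "\<And>s r. r \<in> {0..<1/2} \<Longrightarrow> \<bar>strip_sol 2 0 (s, r)\<bar> \<le> C3 * exp (- 40 * \<bar>s\<bar>)"
     "C4 \<ge> 0" "\<And>s r. r \<in> {0..<1/2} \<Longrightarrow> \<bar>strip_sol 1 1 (s, r)\<bar> \<le> C4 * exp (- 40 * \<bar>s\<bar>)"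
     "C5 \<ge> 0" "\<And>s r. r \<in> {0..<1/2} \<Longrightarrow> \<bar>strip_sol 0 2 (s, r)\<bar> * (1 - 2 * r) \<le> C5 * exp (- 40 * \<bar>s\<bar>)"
    using b(1)[of 1] b(2)[of 0] b(1)[of 2] b(2)[of 1] b(3)[of 0] by metis
  define C where "C = C1 + C2 + C3 + C4 + 2 * C5"
  \<comment> \<open>The largest product below consists of \<open>M\<^sup>2 = 10000 (2 ipd) ^ 10\<close> and two further factors \<open>2 ipd\<close>; decay with rate 40 pays for \<open>ipd ^ 12\<close>.\<close>
  define B where "B = 6 * (C * 10000 * 2 ^ 12)"
  have C0: "C \<ge> 0" "B \<ge> 0" using C by (auto simp: C_def B_def)
  have "2 * ipd q * \<bar>pot_b q\<bar> \<le> 6 * B \<and> 2 * ipd q * \<bar>pot_c q\<bar> \<le> 6 * B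
     \<and> 2 * ipd q * (bdef q * \<bar>hes_bb q\<bar>) \<le> 6 * B \<and> 2 * ipd q * (bdef q * \<bar>hes_bc q\<bar>) \<le> 6 * B
     \<and> 2 * ipd q * (bdef q * \<bar>hes_cc q\<bar>) \<le> 6 * B \<and> 2 * ipd q * \<bar>tsn q\<bar> \<le> 6 * B" if q: "q \<in> anderson" for q
  proof -
    define e where "e = exp (- 40 * \<bar>lon q\<bar>)"
    define i where "i = ipd q"
    define M where "M = 100 * (2 * i) ^ 5"
    have i: "1/2 \<le> i" "0 < bdef q" "bdef q \<le> 1" using ipd_facts[OF q] coord_bounds[OF q] by (auto simp: i_def)
    have "1 \<le> (2 * i) ^ 5" using i by (intro one_le_power) auto
    then have M: "M \<ge> 1" by (simp add: M_def)
    have e0: "e \<ge> 0" by (simp add: e_def)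
    have r: "lat q \<in> {0..<1/2}" using lat_bounds[OF q] by auto
    have le: "Ck * e \<le> C * e" if "Ck \<le> C" for Ck using that e0 by (intro mult_right_mono)
    have cs: "C1 \<le> C" "C2 \<le> C" "C3 \<le> C" "C4 \<le> C" "2 * C5 \<le> C" using C by (auto simp: C_def)
    have P: "\<bar>Phi 1 0 q\<bar> \<le> C * e" "\<bar>Phi 0 1 q\<bar> \<le> C * e" "\<bar>Phi 2 0 q\<bar> \<le> C * e" "\<bar>Phi 1 1 q\<bar> \<le> C * e"
      using C(2)[OF r, of "lon q"] C(4)[OF r, of "lon q"] C(6)[OF r, of "lon q"] C(8)[OF r, of "lon q"]
        le[OF cs(1)] le[OF cs(2)] le[OF cs(3)] le[OF cs(4)]
      unfolding Phi_def e_def by linarith+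
    have P02: "\<bar>Phi 0 2 q\<bar> * bdef q \<le> C * e"
    proof -
      have "bdef q * 1 \<le> bdef q * (2 * i)" using i by (intro mult_left_mono) auto
      then have "\<bar>Phi 0 2 q\<bar> * bdef q \<le> \<bar>Phi 0 2 q\<bar> * (2 * (1 - 2 * lat q))"
        unfolding lat_bounds(3)[OF q] by (intro mult_left_mono) (auto simp: i_def)
      also have "\<dots> = 2 * (\<bar>strip_sol 0 2 (lon q, lat q)\<bar> * (1 - 2 * lat q))" by (simp add: Phi_def)
      also have "\<dots> \<le> 2 * C5 * e" using C(10)[OF r, of "lon q"] unfolding e_def by linarith
      finally show ?thesis using le[OF cs(5)] by linarith
    qed
    have eI: "C * e * M\<^sup>2 * (2 * i)\<^sup>2 \<le> B / 6"
    proof -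
      have "e * i ^ 12 \<le> 1" using exp_lon_ipd_le[OF q, of 12 40] by (simp add: e_def i_def)
      then have "C * 10000 * 2 ^ 12 * (e * i ^ 12) \<le> C * 10000 * 2 ^ 12 * 1" using C0 by (intro mult_left_mono) auto
      moreover have "C * e * M\<^sup>2 * (2 * i)\<^sup>2 = C * 10000 * 2 ^ 12 * (e * i ^ 12)"
      proof -
        have "M\<^sup>2 * (2 * i)\<^sup>2 = 10000 * 2 ^ 12 * i ^ 12"
          unfolding M_def by (simp add: power_mult_distrib power2_eq_square eval_nat_numeral)
        then have "C * e * (M\<^sup>2 * (2 * i)\<^sup>2) = C * e * (10000 * 2 ^ 12 * i ^ 12)" by simp
        then show ?thesis by (simp only: mult_ac)
      qed
      ultimately show ?thesis unfolding B_def by linarith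
    qed
    have eM: "6 * (C * e * M\<^sup>2) * (2 * i)\<^sup>2 \<le> B" using eI by simp
    have eM1: "(2 * i) * (6 * (C * e * M\<^sup>2)) \<le> B"
    proof -
      have "6 * (C * e * M\<^sup>2) * ((2 * i) * 1) \<le> 6 * (C * e * M\<^sup>2) * ((2 * i) * (2 * i))"
        using C0 e0 i by (intro mult_left_mono) auto
      then show ?thesis using eM by (simp add: power2_eq_square mult_ac)
    qed
    note cb = coord_deriv_bounds[OF q, folded i_def, folded M_def]
    have h: "bdef q * \<bar>hes_bb q\<bar> \<le> 6 * (C * e * M\<^sup>2)" "bdef q * \<bar>hes_bc q\<bar> \<le> 6 * (C * e * M\<^sup>2)"
       "bdef q * \<bar>hes_cc q\<bar> \<le> 6 * (C * e * M\<^sup>2)"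
      unfolding hes_bb_def hes_bc_def hes_cc_def
      by (rule hes_estimate; (rule P P02 M i cb; simp))+
    have MM: "M \<le> M\<^sup>2" using M by (simp add: power2_eq_square)
    have pb: "\<bar>p * x + p' * x'\<bar> \<le> 2 * (C * e * M\<^sup>2)" if "\<bar>p\<bar> \<le> C * e" "\<bar>p'\<bar> \<le> C * e" "\<bar>x\<bar> \<le> M" "\<bar>x'\<bar> \<le> M" for p p' x x'
    proof -
      have "\<bar>p\<bar> * \<bar>x\<bar> \<le> C * e * M" "\<bar>p'\<bar> * \<bar>x'\<bar> \<le> C * e * M"
        using that C0 e0 M by (auto intro!: mult_mono)
      moreover have "C * e * M \<le> C * e * M\<^sup>2" using MM C0 e0 by (intro mult_left_mono) auto
      ultimately show ?thesis using abs_triangle_ineq[of "p * x" "p' * x'"] by (simp add: abs_mult)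
    qed
    have p: "\<bar>pot_b q\<bar> \<le> 2 * (C * e * M\<^sup>2)" "\<bar>pot_c q\<bar> \<le> 2 * (C * e * M\<^sup>2)"
      unfolding pot_b_def pot_c_def by (rule pb; (rule P cb; simp))+
    have Z: "0 \<le> C * e * M\<^sup>2" using C0 e0 by auto
    have "tsn q = - (bdef q * psi q) * (bdef q * pot_b q + rad2 q * (bdef q * hes_bb q) + bdef q * hes_cc q)"
      unfolding tsn_def pot_pde[OF q] by (simp add: power2_eq_square algebra_simps)
    also have "\<bar>\<dots>\<bar> \<le> (2 * i) * (3 * (6 * (C * e * M\<^sup>2)))"
      unfolding abs_mult abs_minus_cancel
    proof (rule mult_mono)
      show "\<bar>bdef q\<bar> * \<bar>psi q\<bar> \<le> 2 * i" using psi_facts[OF q] i by (simp add: i_def)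
      have "bdef q * \<bar>pot_b q\<bar> \<le> 1 * \<bar>pot_b q\<bar>" using i by (intro mult_right_mono) auto
      moreover have "rad2 q * (bdef q * \<bar>hes_bb q\<bar>) \<le> 1 * (bdef q * \<bar>hes_bb q\<bar>)"
        using i coord_bounds[OF q] by (intro mult_right_mono) auto
      moreover have "\<bar>bdef q * pot_b q + rad2 q * (bdef q * hes_bb q) + bdef q * hes_cc q\<bar>
         \<le> bdef q * \<bar>pot_b q\<bar> + rad2 q * (bdef q * \<bar>hes_bb q\<bar>) + bdef q * \<bar>hes_cc q\<bar>"
      proof -
        have "\<bar>a + b + c\<bar> \<le> \<bar>a\<bar> + \<bar>b\<bar> + \<bar>c\<bar>" for a b c :: real by linarith
        from this[of "bdef q * pot_b q" "rad2 q * (bdef q * hes_bb q)" "bdef q * hes_cc q"]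
        show ?thesis using i rad2_nonneg[of q] by (simp add: abs_mult)
      qed
      ultimately show "\<bar>bdef q * pot_b q + rad2 q * (bdef q * hes_bb q) + bdef q * hes_cc q\<bar> \<le> 3 * (6 * (C * e * M\<^sup>2))"
        using h p Z by linarith
    qed (use i in auto)
    finally have tb: "\<bar>tsn q\<bar> \<le> (2 * i) * (3 * (6 * (C * e * M\<^sup>2)))" .
    have w: "2 * i * a \<le> 6 * B" if "a \<le> 6 * (C * e * M\<^sup>2)" for a
      using mult_left_mono[OF that, of "2 * i"] eM1 i C0 by linarith
    have "2 * i * \<bar>tsn q\<bar> \<le> 2 * i * ((2 * i) * (3 * (6 * (C * e * M\<^sup>2))))"
      using tb i by (intro mult_left_mono) auto
    also have "\<dots> = 3 * (6 * (C * e * M\<^sup>2) * (2 * i)\<^sup>2)" by (simp add: power2_eq_square)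
    also have "\<dots> \<le> 6 * B" using eM C0 by linarith
    finally have "2 * i * \<bar>tsn q\<bar> \<le> 6 * B" .
    moreover have "\<bar>pot_b q\<bar> \<le> 6 * (C * e * M\<^sup>2)" "\<bar>pot_c q\<bar> \<le> 6 * (C * e * M\<^sup>2)"
      using p Z by linarith+
    ultimately show ?thesis using w h unfolding i_def by blast
  qed
  moreover have "6 * B \<ge> 0" using C0 by simp
  ultimately show ?thesis by blast
qed

section \<open>Covariant derivatives in coordinates\<close>

lemma matrix_inv_eqI:
  fixes A :: "real^'n::finite^'n"
  assumes "A ** B = mat 1" "B ** A = mat 1"
  shows "matrix_inv A = B"
proof -
  have "A ** matrix_inv A = mat 1 \<and> matrix_inv A ** A = mat 1"
    unfolding matrix_inv_def by (rule someI[of _ B]) (use assms in simp)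
  then have "matrix_inv A = matrix_inv A ** (A ** B)" "matrix_inv A ** A = mat 1" using assms by simp_all
  then show ?thesis by (simp add: matrix_mul_assoc)
qed

lemma matrix_inv_left_right:
  fixes A :: "real^'n::finite^'n"
  assumes "invertible A"
  shows "A ** matrix_inv A = mat 1" "matrix_inv A ** A = mat 1"
proof -
  obtain B where "A ** B = mat 1" "B ** A = mat 1" using assms by (auto simp: invertible_def)
  then show "A ** matrix_inv A = mat 1" "matrix_inv A ** A = mat 1" using matrix_inv_eqI by metis+
qed

lemma partial_mult:
  assumes "f differentiable (at x)" "h differentiable (at x)"
  shows "partial i (\<lambda>y. f y * h y) x = partial i f x * h x + f x * partial i h x"
proof -
  have "((\<lambda>y. f y * h y) has_derivative (\<lambda>v. f x * frechet_derivative h (at x) v + frechet_derivative f (at x) v * h x)) (at x)"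
    using has_derivative_mult[OF assms(1)[unfolded frechet_derivative_works] assms(2)[unfolded frechet_derivative_works]] .
  note fd = frechet_derivative_at[OF this, symmetric]
  show ?thesis unfolding partial_def fd by simp
qed

lemma partial_sum:
  assumes "finite A" "\<And>k. k \<in> A \<Longrightarrow> f k differentiable (at x)"
  shows "partial i (\<lambda>y. \<Sum>k\<in>A. f k y) x = (\<Sum>k\<in>A. partial i (f k) x)"
proof -
  have "((\<lambda>y. \<Sum>k\<in>A. f k y) has_derivative (\<lambda>v. \<Sum>k\<in>A. frechet_derivative (f k) (at x) v)) (at x)"
    using assms by (intro has_derivative_sum) (simp add: frechet_derivative_works)
  note fd = frechet_derivative_at[OF this, symmetric]
  show ?thesis unfolding partial_def fd by simp
qed

lemma partial_cong:
  assumes "open S" "x \<in> S" "\<And>y. y \<in> S \<Longrightarrow> f y = h y"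
  shows "partial i f x = partial i h x"
proof -
  have "(f has_derivative D) (at x) \<longleftrightarrow> (h has_derivative D) (at x)" for D
    using has_derivative_transform_within_open[OF _ assms(1,2), of f D UNIV h]
      has_derivative_transform_within_open[OF _ assms(1,2), of h D UNIV f] assms(3) by metis
  then show ?thesis by (simp add: partial_def frechet_derivative_def)
qed

lemma sum_mult_matrix_inv:
  fixes A :: "real^'n::finite^'n"
  assumes "invertible A"
  shows "(\<Sum>k\<in>UNIV. A $ j $ k * (\<Sum>l\<in>UNIV. matrix_inv A $ k $ l * c l)) = c j"
proof -
  have "(\<Sum>k\<in>UNIV. A $ j $ k * (\<Sum>l\<in>UNIV. matrix_inv A $ k $ l * c l))
     = (A *v (matrix_inv A *v (\<chi> l. c l))) $ j"
    by (simp add: matrix_vector_mult_def)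
  also have "\<dots> = c j" using matrix_inv_left_right[OF assms] by (simp add: matrix_vector_mul_assoc)
  finally show ?thesis .
qed

text \<open>The Koszul formula after lowering an index. The product rule for the lowered field produces a
  derivative of the metric that reverses the sign of one of the three terms in the Christoffel
  symbol.\<close>

lemma nabla_flat_eq:
  fixes g :: "real^'n::finite \<Rightarrow> real^'n^'n"
  assumes inv: "invertible (g x)" and sym: "\<And>i j y. g y $ i $ j = g y $ j $ i"
    and dg: "\<And>i j. (\<lambda>y. g y $ i $ j) differentiable (at x)"
    and du: "\<And>k. (\<lambda>y. u y $ k) differentiable (at x)"
  shows "nabla_flat g u x $ i $ j = partial i (\<lambda>y. flat g u y $ j) x
    - (1/2) * (\<Sum>k\<in>UNIV. (partial i (\<lambda>y. g y $ j $ k) x + partial j (\<lambda>y. g y $ i $ k) x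
        - partial k (\<lambda>y. g y $ i $ j) x) * u x $ k)"
proof -
  define P where "P i j l = partial i (\<lambda>y. g y $ j $ l) x" for i j l
  have Psym: "P i j l = P i l j" for i j l by (simp add: P_def sym[of _ j l])
  have "(\<lambda>y. g y $ j $ k * u y $ k) differentiable (at x)" for k using dg du by (intro derivative_intros)
  then have f: "partial i (\<lambda>y. flat g u y $ j) x = (\<Sum>k\<in>UNIV. P i j k * u x $ k + g x $ j $ k * partial i (\<lambda>y. u y $ k) x)"
    unfolding flat_def matrix_vector_mult_def P_def
    by (simp add: partial_sum partial_mult[OF dg du])
  have "(\<Sum>k\<in>UNIV. g x $ j $ k * (\<Sum>m\<in>UNIV. christoffel g k i m x * u x $ m))
     = (\<Sum>k\<in>UNIV. g x $ j $ k * (\<Sum>l\<in>UNIV. matrix_inv (g x) $ k $ l * (\<Sum>m\<in>UNIV. (1/2) * (P i m l + P m i l - P l i m) * u x $ m)))"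
  proof (rule sum.cong[OF refl])
    fix k
    have "(\<Sum>m\<in>UNIV. christoffel g k i m x * u x $ m)
       = (\<Sum>m\<in>UNIV. \<Sum>l\<in>UNIV. matrix_inv (g x) $ k $ l * ((1/2) * (P i m l + P m i l - P l i m) * u x $ m))"
      by (simp add: christoffel_def P_def sum_distrib_left sum_distrib_right mult_ac)
    also have "\<dots> = (\<Sum>l\<in>UNIV. \<Sum>m\<in>UNIV. matrix_inv (g x) $ k $ l * ((1/2) * (P i m l + P m i l - P l i m) * u x $ m))"
      by (rule sum.swap)
    finally show "g x $ j $ k * (\<Sum>m\<in>UNIV. christoffel g k i m x * u x $ m)
       = g x $ j $ k * (\<Sum>l\<in>UNIV. matrix_inv (g x) $ k $ l * (\<Sum>m\<in>UNIV. (1/2) * (P i m l + P m i l - P l i m) * u x $ m))"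
      by (simp add: sum_distrib_left)
  qed
  also have "\<dots> = (\<Sum>m\<in>UNIV. (1/2) * (P i m j + P m i j - P j i m) * u x $ m)"
    by (rule sum_mult_matrix_inv[OF inv])
  finally have "nabla_flat g u x $ i $ j
     = (\<Sum>k\<in>UNIV. g x $ j $ k * partial i (\<lambda>y. u y $ k) x) + (\<Sum>m\<in>UNIV. (1/2) * (P i m j + P m i j - P j i m) * u x $ m)"
    by (simp add: nabla_flat_def nabla_def distrib_left sum.distrib)
  also have "\<dots> = partial i (\<lambda>y. flat g u y $ j) x - (1/2) * (\<Sum>k\<in>UNIV. (P i j k + P j i k - P k i j) * u x $ k)"
    unfolding f sum_distrib_left sum.distrib[symmetric] sum_subtractf[symmetric]
  proof (rule sum.cong[OF refl])
    fix k
    show "g x $ j $ k * partial i (\<lambda>y. u y $ k) x + 1/2 * (P i k j + P k i j - P j i k) * u x $ k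
      = P i j k * u x $ k + g x $ j $ k * partial i (\<lambda>y. u y $ k) x - 1/2 * ((P i j k + P j i k - P k i j) * u x $ k)"
      unfolding Psym[of i k j] by (simp add: field_simps)
  qed
  finally show ?thesis by (simp add: P_def)
qed

lemma metric_mult_cov_deriv:
  "(g x *v cov_deriv g v u x) $ j = (\<Sum>i\<in>UNIV. v x $ i * nabla_flat g u x $ i $ j)"
proof -
  have "(g x *v cov_deriv g v u x) $ j = (\<Sum>k\<in>UNIV. \<Sum>i\<in>UNIV. g x $ j $ k * (v x $ i * nabla g u i k x))"
    by (simp add: matrix_vector_mult_def cov_deriv_def sum_distrib_left)
  also have "\<dots> = (\<Sum>i\<in>UNIV. \<Sum>k\<in>UNIV. g x $ j $ k * (v x $ i * nabla g u i k x))" by (rule sum.swap)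
  finally show ?thesis by (simp add: nabla_flat_def sum_distrib_left mult_ac)
qed

lemma divergence_eq_trace:
  fixes g :: "real^'n::finite \<Rightarrow> real^'n^'n"
  assumes inv: "invertible (g x)"
  shows "divergence g u x = (\<Sum>i\<in>UNIV. \<Sum>j\<in>UNIV. matrix_inv (g x) $ i $ j * nabla_flat g u x $ i $ j)"
proof -
  have "(\<Sum>j\<in>UNIV. matrix_inv (g x) $ i $ j * nabla_flat g u x $ i $ j) = nabla g u i i x" for i
  proof -
    have "(\<Sum>j\<in>UNIV. matrix_inv (g x) $ i $ j * nabla_flat g u x $ i $ j)
       = (matrix_inv (g x) *v (g x *v (\<chi> k. nabla g u i k x))) $ i"
      by (simp add: matrix_vector_mult_def nabla_flat_def)
    then show ?thesis using matrix_inv_left_right[OF inv] by (simp add: matrix_vector_mul_assoc)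
  qed
  then show ?thesis by (simp add: divergence_def)
qed

section \<open>The Anderson metric\<close>

text \<open>The generator of the rotations about the axis, which is a Killing field.\<close>

definition rot :: "real^3 \<Rightarrow> real^3" where "rot q = vector [- q $ 2, q $ 1, 0]"

lemma rot_nth [simp]: "rot q $ 1 = - q $ 2" "rot q $ 2 = q $ 1" "rot q $ 3 = 0"
  by (simp_all add: rot_def)

text \<open>The half-angle formula for \<open>sinh\<close> removes the factor \<open>1/a = 1/2\<close> in front of the hyperbolic
  distance.\<close>

lemma warp_squared:
  assumes q: "q \<in> anderson"
  shows "(anderson_warp (sqrt (rad2 q)) (q $ 3))\<^sup>2 = rad2 q * psi q"
proof -
  define t where "t = 2 * sqrt (rad2 q) / bdef q"
  define u where "u = bdef q * ipd q"
  have u0: "0 < u" "u \<le> 1" and i: "ipd q > 0" and D: "bdef q > 0"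
    using ipd_facts[OF q] coord_bounds[OF q] unfolding u_def by blast+
  have "(anderson_warp (sqrt (rad2 q)) (q $ 3))\<^sup>2 = (sinh (arsinh t / 2))\<^sup>2"
    using rad2_nonneg[of q]
    by (simp add: anderson_warp_def anderson_rho_def anderson_a_def t_def bdef_def algebra_simps)
  also have "\<dots> = (cosh (arsinh t) - 1) / 2"
    using cosh_double[of "arsinh t / 2"] cosh_square_eq[of "arsinh t / 2"] by simp
  also have "cosh (arsinh t) = 1 / u"
  proof -
    have "(1 / u)\<^sup>2 = pdist4 q / (bdef q)\<^sup>2"
      using ipd_facts(2)[OF q] i D unfolding u_def by (simp add: field_simps)
    also have "\<dots> = t\<^sup>2 + 1"
      using D rad2_nonneg[of q] by (simp add: t_def pdist4_def power_divide power_mult_distrib field_simps)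
    finally show ?thesis unfolding cosh_arsinh_real
      using u0 by (intro real_sqrt_unique) auto
  qed
  also have "(1 / u - 1) / 2 = rad2 q * psi q"
  proof -
    have "4 * rad2 q * (ipd q)\<^sup>2 = (1 - u) * (1 + u)"
      using ipd_facts(2)[OF q] by (simp add: pdist4_def u_def power_mult_distrib power2_eq_square algebra_simps)
    moreover have "rad2 q * psi q = (4 * rad2 q * (ipd q)\<^sup>2) / (2 * u * (1 + u))"
      unfolding psi_def u_def[symmetric] by simp
    ultimately have "rad2 q * psi q = (1 - u) * (1 + u) / (2 * u * (1 + u))" by (simp only:)
    also have "\<dots> = (1 - u) / (2 * u)" using u0 by simp
    also have "\<dots> = (1 / u - 1) / 2" using u0 by (simp add: field_simps)
    finally show ?thesis ..
  qed
  finally show ?thesis .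
qed

text \<open>In this form the metric is visibly smooth across the axis: the radial and angular parts of the
  polar form combine to a conformal metric and a correction along \<open>rot q\<close>, whose coefficient is
  found from the quadratic equation for \<open>psi\<close>.\<close>

lemma anderson_form_eq:
  assumes q: "q \<in> anderson"
  shows "anderson_form q v w = (v \<bullet> w) / (bdef q)\<^sup>2 - (psi q)\<^sup>2 * ((rot q \<bullet> v) * (rot q \<bullet> w))"
proof -
  have D: "bdef q > 0" using coord_bounds[OF q] by auto
  have c: "4 / (anderson_a\<^sup>2 * (1 - ((sqrt (rad2 q))\<^sup>2 + (q $ 3)\<^sup>2))\<^sup>2) = 1 / (bdef q)\<^sup>2"
    using rad2_nonneg[of q] by (simp add: anderson_a_def bdef_def algebra_simps)
  have iv: "v \<bullet> w = v $ 1 * w $ 1 + v $ 2 * w $ 2 + v $ 3 * w $ 3" for v w :: "real^3"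
    by (simp add: inner_vec_def sum_3)
  show ?thesis
  proof (cases "rad2 q = 0")
    case True
    then have "q $ 1 = 0" "q $ 2 = 0" by (auto simp: rad2_def sum_power2_eq_zero_iff)
    then have r: "rot q \<bullet> v = 0" by (simp add: iv)
    have "anderson_form q v w = 4 / (anderson_a\<^sup>2 * (1 - ((sqrt (rad2 q))\<^sup>2 + (q $ 3)\<^sup>2))\<^sup>2) * (v \<bullet> w)"
      using True by (simp add: anderson_form_def rad2_def)
    then show ?thesis unfolding c r by simp
  next
    case False
    define X where "X = rad2 q"
    have X: "X > 0" using False rad2_nonneg[of q] by (simp add: X_def)
    have s: "sqrt X \<noteq> 0" "(sqrt X)\<^sup>2 = X" "sqrt X * sqrt X = X" using X by auto
    define a b where "a = q $ 1 * v $ 1 + q $ 2 * v $ 2" and "b = q $ 1 * w $ 1 + q $ 2 * w $ 2"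
    have form: "anderson_form q v w = 1 / (bdef q)\<^sup>2 * (a / sqrt X * (b / sqrt X) + v $ 3 * w $ 3)
        + X * psi q * ((rot q \<bullet> v) / X * ((rot q \<bullet> w) / X))"
      unfolding anderson_form_def Let_def rad2_def[symmetric] c warp_squared[OF q]
      using False s by (simp add: a_def b_def iv X_def)
    have ab: "a / sqrt X * (b / sqrt X) = v $ 1 * w $ 1 + v $ 2 * w $ 2 - (rot q \<bullet> v) * (rot q \<bullet> w) / X"
    proof -
      have "a * b + (rot q \<bullet> v) * (rot q \<bullet> w) = X * (v $ 1 * w $ 1 + v $ 2 * w $ 2)"
        by (simp add: a_def b_def iv X_def rad2_def power2_eq_square algebra_simps)
      then have "a * b / X = v $ 1 * w $ 1 + v $ 2 * w $ 2 - (rot q \<bullet> v) * (rot q \<bullet> w) / X"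
        using X by (simp add: field_simps)
      then show ?thesis using s by simp
    qed
    have "1 / (bdef q)\<^sup>2 = psi q + X * (psi q)\<^sup>2"
      using psi_facts(2)[OF q] D by (simp add: X_def field_simps power2_eq_square)
    then have e: "psi q / X - 1 / (bdef q)\<^sup>2 / X = - (psi q)\<^sup>2" using X by (simp add: field_simps)
    have "anderson_form q v w = 1 / (bdef q)\<^sup>2 * (v \<bullet> w) + (psi q / X - 1 / (bdef q)\<^sup>2 / X) * ((rot q \<bullet> v) * (rot q \<bullet> w))"
    proof -
      define A R where "A = 1 / (bdef q)\<^sup>2" and "R = (rot q \<bullet> v) * (rot q \<bullet> w)"
      have "X * psi q * ((rot q \<bullet> v) / X * ((rot q \<bullet> w) / X)) = psi q / X * R"
        using X by (simp add: R_def)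
      then show ?thesis
        unfolding form ab iv[of v w] A_def[symmetric] R_def[symmetric] by (simp add: algebra_simps)
    qed
    then show ?thesis unfolding e by simp
  qed
qed

lemma anderson_metric_eq:
  assumes "q \<in> anderson"
  shows "anderson_metric q $ i $ j = (if i = j then 1 else 0) / (bdef q)\<^sup>2 - (psi q)\<^sup>2 * (rot q $ i * rot q $ j)"
  by (simp add: anderson_metric_def anderson_form_eq[OF assms] inner_axis) (simp add: axis_def)

definition ginv :: "real^3 \<Rightarrow> real^3^3" where
  "ginv q = (\<chi> i j. (bdef q)\<^sup>2 * ((if i = j then 1 else 0) + psi q * (rot q $ i * rot q $ j)))"

lemma anderson_metric_inverse:
  assumes q: "q \<in> anderson"
  shows "matrix_inv (anderson_metric q) = ginv q" "invertible (anderson_metric q)"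
    "ginv q ** anderson_metric q = mat 1" "anderson_metric q ** ginv q = mat 1"
proof -
  define d p where "d = (bdef q)\<^sup>2" and "p = psi q"
  have d: "d \<noteq> 0" using coord_bounds[OF q] by (auto simp: d_def)
  have e: "d * p * (1 + ((q $ 1)\<^sup>2 + (q $ 2)\<^sup>2) * p) = 1" using psi_facts(2)[OF q] by (simp add: d_def p_def rad2_def)
  have g: "anderson_metric q $ i $ j = (if i = j then 1 else 0) / d - p\<^sup>2 * (rot q $ i * rot q $ j)" for i j
    using anderson_metric_eq[OF q] by (simp add: d_def p_def)
  have h: "ginv q $ i $ j = d * ((if i = j then 1 else 0) + p * (rot q $ i * rot q $ j))" for i j
    by (simp add: ginv_def d_def p_def)
  have a: "anderson_metric q ** ginv q = mat 1"
    unfolding vec_eq_iff forall_3 matrix_matrix_mult_def mat_def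
    using e by (simp add: sum_3 g h d field_simps power2_eq_square) (algebra | simp)
  then show b: "ginv q ** anderson_metric q = mat 1" using matrix_left_right_inverse by blast
  show "anderson_metric q ** ginv q = mat 1" by (rule a)
  show "matrix_inv (anderson_metric q) = ginv q" using a b by (rule matrix_inv_eqI)
  show "invertible (anderson_metric q)" using a b by (auto simp: invertible_def)
qed

lemma det_anderson_metric:
  assumes q: "q \<in> anderson"
  shows "det (anderson_metric q) = psi q / (bdef q) ^ 4"
proof -
  define d p where "d = (bdef q)\<^sup>2" and "p = psi q"
  have d: "d \<noteq> 0" using coord_bounds[OF q] by (auto simp: d_def)
  have e: "d * p * (1 + rad2 q * p) = 1" using psi_facts(2)[OF q] by (simp add: d_def p_def)
  have g: "anderson_metric q $ i $ j = (if i = j then 1 else 0) / d - p\<^sup>2 * (rot q $ i * rot q $ j)" for i j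
    using anderson_metric_eq[OF q] by (simp add: d_def p_def)
  have "det (anderson_metric q) = (1 / d) * ((1 / d) * (1 / d - p\<^sup>2 * rad2 q))"
    by (simp add: det_3 g rad2_def power2_eq_square algebra_simps)
  also have "1 / d - p\<^sup>2 * rad2 q = p" using e d by (simp add: field_simps power2_eq_square)
  also have "(1 / d) * ((1 / d) * p) = psi q / (bdef q) ^ 4" by (simp add: d_def p_def eval_nat_numeral)
  finally show ?thesis .
qed

section \<open>The gradient field of the potential\<close>

lemma open_anderson: "open anderson" by (simp add: anderson_def)

lemma Ck_on_id:
  assumes "open S"
  shows "Ck_on k S (\<lambda>x. x)"
proof (cases k)
  case (Suc j)
  show ?thesis unfolding Suc
    by (rule Ck_on_SucI[OF assms has_derivative_ident]) (rule Ck_on_const[OF assms])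
qed simp

lemma Ck_on_nth:
  assumes "open S"
  shows "Ck_on k S (\<lambda>q::real^'n. q $ i)"
  by (rule Ck_on_bounded_linear_image[OF bounded_linear_vec_nth assms Ck_on_id[OF assms]])

lemmas Ck_arith = Ck_on_const[OF open_anderson] Ck_on_add[OF open_anderson]
  Ck_on_bilinear[OF bounded_bilinear_mult open_anderson] Ck_on_nth[OF open_anderson]

lemma Ck_on_diff_real:
  fixes f g :: "'a::real_normed_vector \<Rightarrow> real"
  assumes "open S" "Ck_on k S f" "Ck_on k S g"
  shows "Ck_on k S (\<lambda>x. f x - g x)"
proof -
  have "Ck_on k S (\<lambda>x. f x + - g x)"
    by (rule Ck_on_add[OF assms(1,2) Ck_on_bounded_linear_image[OF bounded_linear_minus[OF bounded_linear_ident] assms(1,3)]])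
  then show ?thesis by simp
qed

lemma Ck_on_power_real:
  fixes f :: "'a::real_normed_vector \<Rightarrow> real"
  assumes "open S" "Ck_on k S f"
  shows "Ck_on k S (\<lambda>x. f x ^ n)"
proof (induction n)
  case 0
  show ?case using Ck_on_const[OF assms(1)] by simp
next
  case (Suc n)
  show ?case unfolding power_Suc by (rule Ck_on_bilinear[OF bounded_bilinear_mult assms Suc])
qed

lemmas Ck_closure = Ck_arith Ck_on_diff_real[OF open_anderson] Ck_on_power_real[OF open_anderson]

lemma Ck_rad2: "Ck_on k anderson rad2" unfolding rad2_def[abs_def] by (intro Ck_closure)
lemma Ck_bdef: "Ck_on k anderson bdef" unfolding bdef_def[abs_def] by (intro Ck_closure Ck_rad2)
lemma Ck_pdist4: "Ck_on k anderson pdist4" unfolding pdist4_def[abs_def] by (intro Ck_closure Ck_rad2 Ck_bdef)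
lemma Ck_ipd: "Ck_on k anderson ipd" unfolding ipd_def[abs_def]
  using coord_bounds by (intro Ck_on_powr[OF open_anderson] Ck_pdist4) auto
lemma Ck_lat: "Ck_on k anderson lat" unfolding lat_def[abs_def] by (intro Ck_closure Ck_bdef Ck_ipd)
lemma Ck_lon: "Ck_on k anderson lon" unfolding lon_def[abs_def]
  using coord_bounds by (intro Ck_closure Ck_on_ln[OF open_anderson] Ck_rad2) auto

lemma Ck_Phi: "Ck_on k anderson (Phi i j)"
  unfolding Phi_def[abs_def]
  by (rule Ck_on_two_variable_family[OF open_anderson, where T="{z. \<bar>snd z\<bar> < 1/2}"])
    (use strip_sol_has_derivative lat_bounds in \<open>auto intro: Ck_lon Ck_lat\<close>)

lemma Ck_pot: "Ck_on k anderson pot" unfolding pot_def by (rule Ck_Phi)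
lemma Ck_pot_b: "Ck_on k anderson pot_b"
  unfolding pot_b_def[abs_def] lon_b_def lat_b_def
  by (intro Ck_closure Ck_Phi Ck_rad2 Ck_bdef Ck_ipd)
lemma Ck_pot_c: "Ck_on k anderson pot_c"
  unfolding pot_c_def[abs_def] lon_c_def lat_c_def
  by (intro Ck_closure Ck_Phi Ck_rad2 Ck_bdef Ck_ipd)

lemma Ck_psi: "Ck_on k anderson psi"
proof -
  have pos: "0 < (bdef q * ipd q) * (1 + bdef q * ipd q)" if "q \<in> anderson" for q
    using ipd_facts(4)[OF that] by (metis add_pos_pos mult_pos_pos zero_less_one)
  have eq: "psi q = 2 * (ipd q)\<^sup>2 * ((bdef q * ipd q) * (1 + bdef q * ipd q)) powr (-1)" if "q \<in> anderson" for q
  proof -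
    have "x powr (-1) = 1 / x" if "x > 0" for x :: real using that by (simp add: powr_minus_divide)
    from this[OF pos[OF that]] show ?thesis unfolding psi_def by simp
  qed
  have "Ck_on k anderson (\<lambda>q. ((bdef q * ipd q) * (1 + bdef q * ipd q)) powr (-1))"
    by (rule Ck_on_powr[OF open_anderson pos]) (assumption, intro Ck_closure Ck_ipd Ck_bdef)
  then have "Ck_on k anderson (\<lambda>q. 2 * (ipd q)\<^sup>2 * ((bdef q * ipd q) * (1 + bdef q * ipd q)) powr (-1))"
    by (intro Ck_closure Ck_ipd)
  then show ?thesis by (subst Ck_on_cong[OF open_anderson eq])
qed

text \<open>The Euclidean gradient of \<open>pot\<close>, its Euclidean Hessian \<open>hesm\<close>, and the Riemannian gradient
  \<open>gfield\<close>, which is a conformal multiple of the Euclidean one because \<open>dpot\<close> is orthogonal to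
  \<open>rot\<close>.\<close>

definition dpot :: "real^3 \<Rightarrow> real^3" where
  "dpot q = vector [pot_b q * q $ 1, pot_b q * q $ 2, pot_c q]"

definition hesm :: "real^3 \<Rightarrow> real^3^3" where
  "hesm q = vector [
     vector [pot_b q + hes_bb q * q $ 1 * q $ 1, hes_bb q * q $ 1 * q $ 2, hes_bc q * q $ 1],
     vector [hes_bb q * q $ 1 * q $ 2, pot_b q + hes_bb q * q $ 2 * q $ 2, hes_bc q * q $ 2],
     vector [hes_bc q * q $ 1, hes_bc q * q $ 2, hes_cc q]]"

definition gfield :: "real^3 \<Rightarrow> real^3" where
  "gfield q = (if q \<in> anderson then (bdef q)\<^sup>2 *\<^sub>R dpot q else 0)"

lemma dpot_nth [simp]: "dpot q $ 1 = pot_b q * q $ 1" "dpot q $ 2 = pot_b q * q $ 2" "dpot q $ 3 = pot_c q"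
  by (simp_all add: dpot_def)

lemma partial_pot:
  assumes "q \<in> anderson" shows "partial i pot q = dpot q $ i"
  using axi_deriv_partial[OF axi_deriv_pot[OF assms]] exhaust_3[of i] by auto

lemma axi_deriv_differentiable: "axi_deriv f b c q \<Longrightarrow> f differentiable (at q)"
  unfolding axi_deriv_def differentiable_def by blast

lemma nth_differentiable: "(\<lambda>q::real^'n. q $ i) differentiable (at q)"
  by (simp add: bounded_linear_imp_differentiable bounded_linear_vec_nth)

lemma partial_nth: "partial i (\<lambda>q::real^'n::finite. q $ j) q = (if i = j then 1 else 0)"
proof -
  have "((\<lambda>q::real^'n. q $ j) has_derivative (\<lambda>v. v $ j)) (at q)"
    by (simp add: bounded_linear_imp_has_derivative bounded_linear_vec_nth)
  from frechet_derivative_at[OF this, symmetric] show ?thesis by (simp add: partial_def axis_def)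
qed

lemma dpot_differentiable:
  assumes "q \<in> anderson"
  shows "(\<lambda>y. dpot y $ j) differentiable (at q)"
proof -
  have "pot_b differentiable (at q)" "pot_c differentiable (at q)"
    using axi_deriv_pot_b[OF assms] axi_deriv_pot_c[OF assms] axi_deriv_differentiable by blast+
  then show ?thesis using exhaust_3[of j] nth_differentiable by (auto intro!: differentiable_mult)
qed

lemma partial_dpot:
  assumes q: "q \<in> anderson"
  shows "partial i (\<lambda>y. dpot y $ j) q = hesm q $ i $ j"
proof -
  note b = axi_deriv_pot_b[OF q] and c = axi_deriv_pot_c[OF q]
  note pb = axi_deriv_partial[OF b] and pc = axi_deriv_partial[OF c]
  have m: "partial i (\<lambda>y. pot_b y * y $ k) q = partial i pot_b q * q $ k + pot_b q * (if i = k then 1 else 0)" for i k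
    by (simp add: partial_mult[OF axi_deriv_differentiable[OF b] nth_differentiable] partial_nth)
  have "\<forall>i j. partial i (\<lambda>y. dpot y $ j) q = hesm q $ i $ j"
    unfolding forall_3 by (simp add: m pb pc hesm_def algebra_simps)
  then show ?thesis by blast
qed

lemma flat_gfield:
  assumes q: "q \<in> anderson"
  shows "flat anderson_metric gfield q = dpot q"
proof -
  have "ginv q *v dpot q = gfield q"
    unfolding vec_eq_iff forall_3 using q
    by (simp add: matrix_vector_mult_def sum_3 ginv_def gfield_def algebra_simps)
  then have "flat anderson_metric gfield q = (anderson_metric q ** ginv q) *v dpot q"
    by (simp add: flat_def matrix_vector_mul_assoc[symmetric])
  then show ?thesis using anderson_metric_inverse(4)[OF q] by simp
qed

lemma partial_transform:
  assumes "x \<in> anderson" "\<And>y. y \<in> anderson \<Longrightarrow> f y = h y"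
  shows "partial i f x = partial i h x"
  by (rule partial_cong[OF open_anderson assms])

lemma differentiable_transform:
  assumes "x \<in> anderson" "\<And>y. y \<in> anderson \<Longrightarrow> f y = h y" "h differentiable (at x)"
  shows "f differentiable (at x)"
  using assms(3) unfolding differentiable_def
  using has_derivative_transform_within_open[OF _ open_anderson assms(1), of h _ UNIV f] assms(2) by metis

lemma gfield_differentiable:
  assumes q: "q \<in> anderson"
  shows "(\<lambda>y. gfield y $ j) differentiable (at q)"
  by (rule differentiable_transform[OF q, of _ "\<lambda>y. (bdef y)\<^sup>2 * dpot y $ j"])
    (use axi_deriv_differentiable[OF axi_deriv_bdef] dpot_differentiable[OF q] in
      \<open>auto simp: gfield_def intro!: differentiable_mult differentiable_power\<close>)

lemma axi_deriv_inv_bdef: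
  assumes q: "q \<in> anderson"
  shows "axi_deriv (\<lambda>q. 1 / (bdef q)\<^sup>2) (4 / (bdef q) ^ 3) (4 * q $ 3 / (bdef q) ^ 3) q"
proof -
  have D: "bdef q \<noteq> 0" using coord_bounds[OF q] by auto
  have "((\<lambda>x. 1 / x\<^sup>2) has_field_derivative - 2 / (bdef q) ^ 3) (at (bdef q))"
    using D by (auto intro!: derivative_eq_intros simp: eval_nat_numeral field_simps)
  from axi_deriv_compose[OF axi_deriv_bdef this] show ?thesis by (elim axi_deriv_eq) auto
qed

lemma axi_deriv_psi_sq:
  assumes q: "q \<in> anderson"
  shows "axi_deriv (\<lambda>q. (psi q)\<^sup>2) (2 * psi q * psi_b q) (2 * psi q * psi_c q) q"
  by (rule axi_deriv_eq[OF axi_deriv_power[OF axi_deriv_psi[OF q], where n=2]]) auto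

lemma rot_nth_derivative: "((\<lambda>y. rot y $ i) has_derivative (\<lambda>v. rot v $ i)) (at q)"
proof -
  have "bounded_linear (\<lambda>y. rot y $ i)"
    using exhaust_3[of i] bounded_linear_vec_nth[of 1] bounded_linear_minus[OF bounded_linear_vec_nth[of 2]]
    by (auto simp: bounded_linear_zero)
  then show ?thesis by (rule bounded_linear_imp_has_derivative)
qed

lemma rot_differentiable: "(\<lambda>y. rot y $ i) differentiable (at q)"
  using rot_nth_derivative unfolding differentiable_def by blast

lemma partial_rot: "partial k (\<lambda>y. rot y $ i) q = rot (axis k 1) $ i"
  using frechet_derivative_at[OF rot_nth_derivative, symmetric] by (simp add: partial_def)

lemma metric_differentiable:
  assumes q: "q \<in> anderson"
  shows "(\<lambda>y. anderson_metric y $ i $ j) differentiable (at q)"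
proof -
  have d1: "(\<lambda>y. if i = j then 1 / (bdef y)\<^sup>2 else 0) differentiable (at q)"
    using axi_deriv_differentiable[OF axi_deriv_inv_bdef[OF q]] by (cases "i = j") auto
  have d2: "(\<lambda>y. (psi y)\<^sup>2 * (rot y $ i * rot y $ j)) differentiable (at q)"
    by (intro differentiable_mult rot_differentiable axi_deriv_differentiable[OF axi_deriv_psi_sq[OF q]])
  show ?thesis
    by (rule differentiable_transform[OF q _ differentiable_diff[OF d1 d2]]) (simp add: anderson_metric_eq)
qed

lemma partial_diff:
  assumes "f differentiable (at x)" "h differentiable (at x)"
  shows "partial i (\<lambda>y. f y - h y) x = partial i f x - partial i h x"
  using frechet_derivative_at[OF has_derivative_diff[OF assms[unfolded frechet_derivative_works]], symmetric]
  by (simp add: partial_def)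

lemma partial_metric:
  assumes q: "q \<in> anderson"
  shows "partial k (\<lambda>y. anderson_metric y $ i $ j) q =
     (if i = j then partial k (\<lambda>q. 1 / (bdef q)\<^sup>2) q else 0)
     - (partial k (\<lambda>q. (psi q)\<^sup>2) q * (rot q $ i * rot q $ j)
        + (psi q)\<^sup>2 * (rot (axis k 1) $ i * rot q $ j + rot q $ i * rot (axis k 1) $ j))"
proof -
  note dp = axi_deriv_differentiable[OF axi_deriv_psi_sq[OF q]] and db = axi_deriv_differentiable[OF axi_deriv_inv_bdef[OF q]]
  have r: "(\<lambda>y. rot y $ i * rot y $ j) differentiable (at q)" by (intro differentiable_mult rot_differentiable)
  have pc: "partial k (\<lambda>y. 0) q = 0" by (simp add: partial_def frechet_derivative_const)
  have "partial k (\<lambda>y. anderson_metric y $ i $ j) q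
     = partial k (\<lambda>y. (if i = j then 1 / (bdef y)\<^sup>2 else 0) - (psi y)\<^sup>2 * (rot y $ i * rot y $ j)) q"
    by (rule partial_transform[OF q]) (simp add: anderson_metric_eq)
  also have "\<dots> = partial k (\<lambda>y. if i = j then 1 / (bdef y)\<^sup>2 else 0) q - partial k (\<lambda>y. (psi y)\<^sup>2 * (rot y $ i * rot y $ j)) q"
    by (rule partial_diff) (use dp db r in \<open>cases "i = j"; auto intro!: differentiable_mult\<close>)+
  also have "partial k (\<lambda>y. (psi y)\<^sup>2 * (rot y $ i * rot y $ j)) q
     = partial k (\<lambda>q. (psi q)\<^sup>2) q * (rot q $ i * rot q $ j)
        + (psi q)\<^sup>2 * (rot (axis k 1) $ i * rot q $ j + rot q $ i * rot (axis k 1) $ j)"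
    by (simp add: partial_mult[OF dp r] partial_mult[OF rot_differentiable rot_differentiable] partial_rot)
  finally show ?thesis using pc by simp
qed

lemma anderson_metric_sym: "anderson_metric y $ i $ j = anderson_metric y $ j $ i"
proof -
  have swap: "(if b then c * z else c * (a1 * a2 + b1 * b2) + e * (d1 * d2))
      = (if b then c * z else c * (a2 * a1 + b2 * b1) + e * (d2 * d1))"
    for b and c z a1 a2 b1 b2 e d1 d2 :: real by (simp add: mult.commute)
  have "anderson_form y v w = anderson_form y w v" for v w
    unfolding anderson_form_def Let_def inner_commute[of v w] by (rule swap)
  then show ?thesis unfolding anderson_metric_def by simp
qed

definition rsum where "rsum q = rad2 q * pot_b q + q $ 3 * pot_c q" for q :: "real^3"

text \<open>Raising one index of the covariant Hessian of \<open>pot\<close> yields \<open>bdef\<^sup>2\<close> times this matrix.\<close>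

definition mten :: "real^3 \<Rightarrow> real^3^3" where
  "mten q = (\<chi> i j. hesm q $ i $ j - (2 / bdef q) * (q $ i * dpot q $ j + q $ j * dpot q $ i
      - (if i = j then rsum q else 0)) - psi q * tsn q * (rot q $ i * rot q $ j))"

text \<open>The derivatives of the conformal factor give the usual terms for a conformally flat metric.
  The correction along \<open>rot\<close> contributes only a multiple of \<open>rot \<otimes> rot\<close>, because the gradient is
  orthogonal to \<open>rot\<close> and a quarter turn about the axis maps its horizontal part to a multiple of
  \<open>rot\<close>.\<close>

lemma nabla_flat_gfield:
  assumes q: "q \<in> anderson"
  shows "nabla_flat anderson_metric gfield q $ i $ j = mten q $ i $ j - psi q * tsn q * (rot q $ i * rot q $ j)"
proof -
  define D where "D = bdef q"
  have D: "D \<noteq> 0" using coord_bounds[OF q] by (auto simp: D_def)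
  have f: "partial i (\<lambda>y. flat anderson_metric gfield y $ j) q = hesm q $ i $ j" for i j
    using partial_transform[OF q, of "\<lambda>y. flat anderson_metric gfield y $ j" "\<lambda>y. dpot y $ j" i] flat_gfield partial_dpot[OF q]
    by simp
  note n = nabla_flat_eq[OF anderson_metric_inverse(2)[OF q] anderson_metric_sym metric_differentiable[OF q]
      gfield_differentiable[OF q], unfolded f partial_metric[OF q]]
  note pa = axi_deriv_partial[OF axi_deriv_inv_bdef[OF q]] and pw = axi_deriv_partial[OF axi_deriv_psi_sq[OF q]]
  have g: "gfield q $ k = D\<^sup>2 * dpot q $ k" for k using q by (simp add: gfield_def D_def)
  define A W J r U where "A k = partial k (\<lambda>q. 1 / (bdef q)\<^sup>2) q" and "W k = partial k (\<lambda>q. (psi q)\<^sup>2) q"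
    and "J k i = rot (axis k 1) $ i" and "r k = rot q $ k" and "U k = gfield q $ k" for k i
  define b w where "b = D\<^sup>2 * pot_b q" and "w = (psi q)\<^sup>2"
  have A: "A i = 4 * q $ i / D ^ 3" for i
  proof -
    have "\<forall>i. A i = 4 * q $ i / D ^ 3" unfolding forall_3 A_def pa by (simp add: D_def)
    then show ?thesis by blast
  qed
  have rU: "(\<Sum>k\<in>UNIV. r k * U k) = 0" by (simp add: sum_3 r_def U_def g)
  have JU: "(\<Sum>k\<in>UNIV. J i k * U k) = - (b * r i)" and UJ: "(\<Sum>k\<in>UNIV. J k i * U k) = b * r i" for i
  proof -
    have "\<forall>i. (\<Sum>k\<in>UNIV. J i k * U k) = - (b * r i)"
      unfolding forall_3 by (simp add: sum_3 J_def r_def U_def g axis_def b_def)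
    then show "(\<Sum>k\<in>UNIV. J i k * U k) = - (b * r i)" by blast
    have "\<forall>i. (\<Sum>k\<in>UNIV. J k i * U k) = b * r i"
      unfolding forall_3 by (simp add: sum_3 J_def r_def U_def g axis_def b_def)
    then show "(\<Sum>k\<in>UNIV. J k i * U k) = b * r i" by blast
  qed
  have AU: "(\<Sum>k\<in>UNIV. A k * U k) = 4 / D * rsum q"
    using D by (simp add: sum_3 A U_def g rsum_def rad2_def) (simp add: field_simps power2_eq_square eval_nat_numeral)
  have WU: "(\<Sum>k\<in>UNIV. W k * U k) = 2 * psi q * D\<^sup>2 * dpsi q"
    by (simp add: sum_3 W_def pw U_def g dpsi_def rad2_def) (simp add: algebra_simps power2_eq_square)
  have s1: "(\<Sum>k\<in>UNIV. ((if j = k then A i else 0) - (W i * (r j * r k) + w * (J i j * r k + r j * J i k))) * U k)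
     = A i * U j + w * b * (r i * r j)" for i j
  proof -
    have "(\<Sum>k\<in>UNIV. ((if j = k then A i else 0) - (W i * (r j * r k) + w * (J i j * r k + r j * J i k))) * U k)
      = (\<Sum>k\<in>UNIV. (if j = k then A i * U k else 0)) - (W i * r j + w * J i j) * (\<Sum>k\<in>UNIV. r k * U k)
        - w * r j * (\<Sum>k\<in>UNIV. J i k * U k)"
      unfolding sum_distrib_left sum_subtractf[symmetric]
      by (rule sum.cong[OF refl]) (simp add: algebra_simps)
    then show ?thesis unfolding rU JU by simp
  qed
  have s3: "(\<Sum>k\<in>UNIV. ((if i = j then A k else 0) - (W k * (r i * r j) + w * (J k i * r j + r i * J k j))) * U k)
     = (if i = j then 4 / D * rsum q else 0) - (2 * psi q * D\<^sup>2 * dpsi q + 2 * w * b) * (r i * r j)" for i j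
  proof -
    have "(\<Sum>k\<in>UNIV. ((if i = j then A k else 0) - (W k * (r i * r j) + w * (J k i * r j + r i * J k j))) * U k)
      = (if i = j then 1 else 0) * (\<Sum>k\<in>UNIV. A k * U k) - (r i * r j) * (\<Sum>k\<in>UNIV. W k * U k)
        - w * r j * (\<Sum>k\<in>UNIV. J k i * U k) - w * r i * (\<Sum>k\<in>UNIV. J k j * U k)"
      unfolding sum_distrib_left sum_subtractf[symmetric]
      by (rule sum.cong[OF refl]) (simp add: algebra_simps)
    then show ?thesis unfolding AU WU UJ by (simp add: algebra_simps)
  qed
  have "nabla_flat anderson_metric gfield q $ i $ j = hesm q $ i $ j
     - 1/2 * ((A i * U j + w * b * (r i * r j)) + (A j * U i + w * b * (r j * r i))
       - ((if i = j then 4 / D * rsum q else 0) - (2 * psi q * D\<^sup>2 * dpsi q + 2 * w * b) * (r i * r j)))"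
    unfolding n A_def[symmetric] W_def[symmetric] J_def[symmetric] r_def[symmetric] U_def[symmetric] w_def[symmetric]
    unfolding s1[symmetric] s3[symmetric] sum.distrib[symmetric] sum_subtractf[symmetric]
    by (simp only: distrib_right left_diff_distrib)
  also have "\<dots> = mten q $ i $ j - psi q * tsn q * (rot q $ i * rot q $ j)"
  proof -
    have AU2: "A i * U j = 4 / D * (q $ i * dpot q $ j)" for i j
      using D by (simp add: A U_def g field_simps power2_eq_square eval_nat_numeral)
    show ?thesis unfolding AU2 using D
      by (simp add: mten_def D_def[symmetric] tsn_def r_def b_def w_def) (simp add: field_simps power2_eq_square)
  qed
  finally show ?thesis .
qed

text \<open>The derivative of the constant function \<open>bdef\<^sup>2 * psi * (1 + rad2 * psi)\<close> in the direction of
  \<open>dpot\<close>.\<close>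

lemma psi_relation:
  assumes q: "q \<in> anderson"
  shows "bdef q * dpsi q * (1 + 2 * rad2 q * psi q)
    = 4 * rsum q * psi q * (1 + rad2 q * psi q) - 2 * bdef q * (psi q)\<^sup>2 * rad2 q * pot_b q"
proof -
  define D where "D = bdef q"
  have D: "D \<noteq> 0" using coord_bounds[OF q] by (auto simp: D_def)
  define b c where "b = D\<^sup>2 * psi q * (rad2 q * psi_b q + 2 * psi q) + (D\<^sup>2 * psi_b q + 2 * D * (- 2) * psi q) * (1 + rad2 q * psi q)"
    and "c = D\<^sup>2 * psi q * (rad2 q * psi_c q) + (D\<^sup>2 * psi_c q + 2 * D * (- 2 * q $ 3) * psi q) * (1 + rad2 q * psi q)"
  have "axi_deriv (\<lambda>q. (bdef q)\<^sup>2 * psi q * (1 + rad2 q * psi q)) b c q"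
    by (rule axi_deriv_eq[OF axi_deriv_mult[OF axi_deriv_mult[OF axi_deriv_power[OF axi_deriv_bdef, where n=2] axi_deriv_psi[OF q]]
          axi_deriv_add[OF axi_deriv_const axi_deriv_mult[OF axi_deriv_rad2 axi_deriv_psi[OF q]]]]])
      (simp_all add: b_def c_def D_def)
  then have "((\<lambda>q. (bdef q)\<^sup>2 * psi q * (1 + rad2 q * psi q)) has_derivative
      (\<lambda>v. b * (q $ 1 * v $ 1 + q $ 2 * v $ 2) + c * v $ 3)) (at q)" by (simp add: axi_deriv_def)
  moreover have "((\<lambda>q. (bdef q)\<^sup>2 * psi q * (1 + rad2 q * psi q)) has_derivative (\<lambda>v. 0)) (at q)"
    by (rule has_derivative_transform_within_open[OF has_derivative_const open_anderson q])
      (simp add: psi_facts)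
  ultimately have "(\<lambda>v::real^3. b * (q $ 1 * v $ 1 + q $ 2 * v $ 2) + c * v $ 3) = (\<lambda>v. 0)"
    by (rule has_derivative_unique)
  from fun_cong[OF this, of "dpot q"] have "b * (rad2 q * pot_b q) + c * pot_c q = 0"
    by (simp add: rad2_def power2_eq_square algebra_simps)
  then have "D * (D * dpsi q * (1 + 2 * rad2 q * psi q)) = D * (4 * rsum q * psi q * (1 + rad2 q * psi q) - 2 * D * (psi q)\<^sup>2 * rad2 q * pot_b q)"
    by (simp add: b_def c_def dpsi_def rsum_def power2_eq_square algebra_simps)
  then show ?thesis using D by (simp add: D_def)
qed

lemma tsn_eigenvalue:
  assumes q: "q \<in> anderson"
  shows "tsn q * (1 + 2 * rad2 q * psi q) = pot_b q + 2 / bdef q * rsum q"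
proof -
  define D where "D = bdef q"
  have D: "D \<noteq> 0" using coord_bounds[OF q] by (auto simp: D_def)
  have e: "D\<^sup>2 * psi q * (1 + rad2 q * psi q) = 1" using psi_facts(2)[OF q] by (simp add: D_def)
  have "tsn q * (1 + 2 * rad2 q * psi q) = D\<^sup>2 * psi q * pot_b q * (1 + 2 * rad2 q * psi q)
      + 1/2 * D * (D * dpsi q * (1 + 2 * rad2 q * psi q))"
    by (simp add: tsn_def D_def power2_eq_square algebra_simps)
  also have "\<dots> = D\<^sup>2 * psi q * (1 + rad2 q * psi q) * pot_b q + 2 * (D\<^sup>2 * psi q * (1 + rad2 q * psi q)) / D * rsum q"
    unfolding psi_relation[OF q, folded D_def] using D by (simp add: power2_eq_square field_simps)
  finally show ?thesis unfolding e by (simp add: D_def)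
qed

lemma mten_sym: "mten q $ i $ j = mten q $ j $ i"
proof -
  have "\<forall>i j. hesm q $ i $ j = hesm q $ j $ i" unfolding forall_3 by (simp add: hesm_def)
  then show ?thesis by (simp add: mten_def algebra_simps)
qed

lemma mten_rot:
  assumes q: "q \<in> anderson"
  shows "(\<Sum>l\<in>UNIV. mten q $ k $ l * rot q $ l) = tsn q * (1 + rad2 q * psi q) * rot q $ k"
proof -
  have "(\<Sum>l\<in>UNIV. mten q $ k $ l * rot q $ l) = (pot_b q + 2 / bdef q * rsum q - psi q * tsn q * rad2 q) * rot q $ k"
  proof -
    have "\<forall>k. (\<Sum>l\<in>UNIV. mten q $ k $ l * rot q $ l) = (pot_b q + 2 / bdef q * rsum q - psi q * tsn q * rad2 q) * rot q $ k"
      unfolding forall_3 by (simp add: sum_3 mten_def hesm_def rad2_def power2_eq_square algebra_simps)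
    then show ?thesis by blast
  qed
  also have "pot_b q + 2 / bdef q * rsum q - psi q * tsn q * rad2 q = tsn q * (1 + rad2 q * psi q)"
    unfolding tsn_eigenvalue[OF q, symmetric] by (simp add: algebra_simps)
  finally show ?thesis .
qed

lemma rot_norm: "(\<Sum>l\<in>UNIV. rot q $ l * rot q $ l) = rad2 q"
  by (simp add: sum_3 rad2_def power2_eq_square)

lemma nabla_flat_rot:
  assumes q: "q \<in> anderson"
  shows "(\<Sum>l\<in>UNIV. nabla_flat anderson_metric gfield q $ k $ l * rot q $ l) = tsn q * rot q $ k"
proof -
  have "(\<Sum>l\<in>UNIV. nabla_flat anderson_metric gfield q $ k $ l * rot q $ l)
    = (\<Sum>l\<in>UNIV. mten q $ k $ l * rot q $ l) - psi q * tsn q * rot q $ k * (\<Sum>l\<in>UNIV. rot q $ l * rot q $ l)"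
    by (simp add: nabla_flat_gfield[OF q] sum_distrib_left sum_subtractf algebra_simps)
  then show ?thesis unfolding mten_rot[OF q] rot_norm by (simp add: algebra_simps)
qed

lemma nabla_flat_sym:
  assumes q: "q \<in> anderson"
  shows "nabla_flat anderson_metric gfield q $ i $ j = nabla_flat anderson_metric gfield q $ j $ i"
  by (simp add: nabla_flat_gfield[OF q] mten_sym[of q i j] mult.commute)

lemma ginv_nabla_flat:
  assumes q: "q \<in> anderson"
  shows "(\<Sum>l\<in>UNIV. ginv q $ j $ l * nabla_flat anderson_metric gfield q $ k $ l) = (bdef q)\<^sup>2 * mten q $ k $ j"
proof -
  let ?T = "nabla_flat anderson_metric gfield q"
  have "(\<Sum>l\<in>UNIV. ginv q $ j $ l * ?T $ k $ l)
     = (\<Sum>l\<in>UNIV. (if j = l then (bdef q)\<^sup>2 * ?T $ k $ l else 0)) + (bdef q)\<^sup>2 * psi q * rot q $ j * (\<Sum>l\<in>UNIV. ?T $ k $ l * rot q $ l)"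
    unfolding sum_distrib_left sum.distrib[symmetric]
    by (rule sum.cong[OF refl]) (simp add: ginv_def algebra_simps)
  also have "\<dots> = (bdef q)\<^sup>2 * mten q $ k $ j"
    unfolding nabla_flat_rot[OF q] by (simp add: nabla_flat_gfield[OF q] algebra_simps)
  finally show ?thesis .
qed

text \<open>The divergence is the trace of \<open>bdef\<^sup>2 mten\<close>; the eigenvalue identity and the equation for the
  potential make it vanish.\<close>

lemma gfield_divergence:
  assumes q: "q \<in> anderson"
  shows "divergence anderson_metric gfield q = 0"
proof -
  define D L where "D = bdef q" and "L = 2 * pot_b q + rad2 q * hes_bb q + hes_cc q"
  have D: "D \<noteq> 0" using coord_bounds[OF q] by (auto simp: D_def)
  have e: "D\<^sup>2 * psi q * (1 + rad2 q * psi q) = 1" using psi_facts(2)[OF q] by (simp add: D_def)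
  have p: "psi q > 0" using psi_facts(1)[OF q] .
  have "divergence anderson_metric gfield q = (\<Sum>i\<in>UNIV. D\<^sup>2 * mten q $ i $ i)"
    by (simp add: divergence_eq_trace[of anderson_metric q, OF anderson_metric_inverse(2)[OF q]] anderson_metric_inverse(1)[OF q] ginv_nabla_flat[OF q] D_def)
  also have "\<dots> = D\<^sup>2 * (L + 2 / D * rsum q - psi q * tsn q * rad2 q)"
    by (simp add: sum_3 mten_def hesm_def rsum_def rad2_def L_def D_def power2_eq_square algebra_simps add_divide_distrib diff_divide_distrib)
  also have "2 / D * rsum q = tsn q * (1 + 2 * rad2 q * psi q) - pot_b q"
    unfolding tsn_eigenvalue[OF q] by (simp add: D_def)
  also have "L + (tsn q * (1 + 2 * rad2 q * psi q) - pot_b q) - psi q * tsn q * rad2 q = L - pot_b q + tsn q * (1 + rad2 q * psi q)"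
    by (simp add: algebra_simps)
  also have "tsn q = D\<^sup>2 * psi q * (pot_b q - L)"
    unfolding tsn_def pot_pde[OF q] L_def D_def by (simp add: algebra_simps)
  also have "L - pot_b q + D\<^sup>2 * psi q * (pot_b q - L) * (1 + rad2 q * psi q) = L - pot_b q + (D\<^sup>2 * psi q * (1 + rad2 q * psi q)) * (pot_b q - L)"
    by (simp only: mult_ac)
  also have "\<dots> = 0" unfolding e by simp
  finally show ?thesis by simp
qed

text \<open>Since \<open>rot\<close> is an eigenvector of the symmetric matrix \<open>nabla_flat\<close>, raising either index gives
  the same matrix \<open>bdef\<^sup>2 mten\<close>, and the norm is the Euclidean norm of that matrix.\<close>

lemma tensor_inner_nabla_flat:
  assumes q: "q \<in> anderson"
  shows "tensor_inner anderson_metric q (nabla_flat anderson_metric gfield q) (nabla_flat anderson_metric gfield q)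
    = (bdef q) ^ 4 * (\<Sum>k\<in>UNIV. \<Sum>j\<in>UNIV. (mten q $ k $ j)\<^sup>2)"
proof -
  let ?T = "nabla_flat anderson_metric gfield q" and ?G = "ginv q"
  have Gs: "?G $ i $ k = ?G $ k $ i" for i k by (simp add: ginv_def mult_ac)
  have "tensor_inner anderson_metric q ?T ?T
     = (\<Sum>i\<in>UNIV. \<Sum>j\<in>UNIV. \<Sum>k\<in>UNIV. \<Sum>l\<in>UNIV. (?G $ i $ k * ?T $ i $ j) * (?G $ j $ l * ?T $ k $ l))"
    unfolding tensor_inner_def anderson_metric_inverse(1)[OF q] by (simp add: mult_ac)
  also have "\<dots> = (\<Sum>i\<in>UNIV. \<Sum>j\<in>UNIV. \<Sum>k\<in>UNIV. (?G $ i $ k * ?T $ i $ j) * ((bdef q)\<^sup>2 * mten q $ k $ j))"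
    unfolding sum_distrib_left[symmetric] ginv_nabla_flat[OF q] ..
  also have "\<dots> = (\<Sum>j\<in>UNIV. \<Sum>i\<in>UNIV. \<Sum>k\<in>UNIV. (?G $ i $ k * ?T $ i $ j) * ((bdef q)\<^sup>2 * mten q $ k $ j))"
    by (rule sum.swap)
  also have "\<dots> = (\<Sum>j\<in>UNIV. \<Sum>k\<in>UNIV. \<Sum>i\<in>UNIV. (?G $ i $ k * ?T $ i $ j) * ((bdef q)\<^sup>2 * mten q $ k $ j))"
    by (rule sum.cong[OF refl], rule sum.swap)
  also have "\<dots> = (\<Sum>j\<in>UNIV. \<Sum>k\<in>UNIV. ((bdef q)\<^sup>2 * mten q $ j $ k) * ((bdef q)\<^sup>2 * mten q $ k $ j))"
    unfolding sum_distrib_right[symmetric]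
    by (simp only: Gs[of _ k for k] nabla_flat_sym[OF q, of _ j for j] ginv_nabla_flat[OF q])
  also have "\<dots> = (\<Sum>j\<in>UNIV. \<Sum>k\<in>UNIV. (bdef q) ^ 4 * (mten q $ k $ j)\<^sup>2)"
    by (intro sum.cong refl) (simp add: mten_sym[of q _ "_::3"] power2_eq_square eval_nat_numeral)
  also have "\<dots> = (\<Sum>k\<in>UNIV. \<Sum>j\<in>UNIV. (bdef q) ^ 4 * (mten q $ k $ j)\<^sup>2)" by (rule sum.swap)
  finally show ?thesis by (simp add: sum_distrib_left)
qed

text \<open>The energy density of the gradient field.\<close>

definition eden where "eden q = (bdef q)\<^sup>2 * (rad2 q * (pot_b q)\<^sup>2 + (pot_c q)\<^sup>2)"

lemma vec_inner_gfield:
  assumes q: "q \<in> anderson"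
  shows "vec_inner anderson_metric q (gfield q) (gfield q) = eden q"
proof -
  have "vec_inner anderson_metric q (gfield q) (gfield q) = (\<Sum>i\<in>UNIV. gfield q $ i * flat anderson_metric gfield q $ i)"
    by (simp add: vec_inner_def flat_def matrix_vector_mult_def sum_distrib_left mult_ac)
  also have "\<dots> = eden q"
    unfolding flat_gfield[OF q] using q
    by (simp add: sum_3 gfield_def eden_def rad2_def power2_eq_square algebra_simps)
  finally show ?thesis .
qed

lemma Ck_eden: "Ck_on k anderson eden"
  unfolding eden_def[abs_def] by (intro Ck_closure Ck_bdef Ck_rad2 Ck_pot_b Ck_pot_c)

lemma partial_eden:
  assumes q: "q \<in> anderson"
  shows "1/2 * partial j eden q = (\<Sum>i\<in>UNIV. gfield q $ i * nabla_flat anderson_metric gfield q $ i $ j)"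
proof -
  define D where "D = bdef q"
  have D: "D \<noteq> 0" using coord_bounds[OF q] by (auto simp: D_def)
  note b = axi_deriv_pot_b[OF q] and c = axi_deriv_pot_c[OF q]
  have "axi_deriv eden
     (2 * D * (- 2) * (rad2 q * (pot_b q)\<^sup>2 + (pot_c q)\<^sup>2)
        + D\<^sup>2 * (2 * (pot_b q)\<^sup>2 + 2 * rad2 q * pot_b q * hes_bb q + 2 * pot_c q * hes_bc q))
     (2 * D * (- 2 * q $ 3) * (rad2 q * (pot_b q)\<^sup>2 + (pot_c q)\<^sup>2)
        + D\<^sup>2 * (2 * rad2 q * pot_b q * hes_bc q + 2 * pot_c q * hes_cc q)) q"
    unfolding eden_def[abs_def]
    by (rule axi_deriv_eq[OF axi_deriv_mult[OF axi_deriv_power[OF axi_deriv_bdef, where n=2]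
         axi_deriv_add[OF axi_deriv_mult[OF axi_deriv_rad2 axi_deriv_power[OF b, where n=2]] axi_deriv_power[OF c, where n=2]]]])
      (simp_all add: D_def algebra_simps)
  note pe = axi_deriv_partial[OF this]
  have "\<forall>j. 1/2 * partial j eden q = (\<Sum>i\<in>UNIV. gfield q $ i * nabla_flat anderson_metric gfield q $ i $ j)"
    unfolding forall_3 nabla_flat_gfield[OF q] using q D
    by (simp add: pe sum_3 gfield_def D_def[symmetric] mten_def hesm_def rsum_def rad2_def)
      (simp add: field_simps power2_eq_square)
  then show ?thesis by blast
qed

text \<open>For a gradient field the convective term is the gradient of half the squared length, because
  its covariant derivative is symmetric.\<close>

lemma cov_deriv_gfield:
  assumes q: "q \<in> anderson"
  shows "cov_deriv anderson_metric gfield gfield q = (1/2) *\<^sub>R grad anderson_metric eden q"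
proof -
  let ?g = "anderson_metric q" and ?w = "cov_deriv anderson_metric gfield gfield q"
  have "?g *v ?w = (1/2) *\<^sub>R ext_d0 eden q"
    unfolding vec_eq_iff metric_mult_cov_deriv partial_eden[OF q, symmetric] by (simp add: ext_d0_def)
  then have "ginv q *v (?g *v ?w) = (1/2) *\<^sub>R (ginv q *v ext_d0 eden q)"
    by (simp add: matrix_vector_mult_scaleR)
  then show ?thesis
    using anderson_metric_inverse(3)[OF q]
    by (simp add: matrix_vector_mul_assoc grad_def sharp_def anderson_metric_inverse(1)[OF q])
qed

text \<open>The entries of \<open>mten\<close> grow at most like \<open>1 / bdef\<close>. For the terms along \<open>rot\<close> this uses
  \<open>bdef * psi * rad2 \<le> 1\<close>, a consequence of the quadratic equation for \<open>psi\<close>.\<close>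

lemma mten_bound:
  "\<exists>C\<ge>0. \<forall>q\<in>anderson. eden q / (bdef q)\<^sup>2 * (ipd q)\<^sup>2 \<le> C \<and>
     (\<forall>k j. (bdef q * ipd q)\<^sup>2 * (mten q $ k $ j)\<^sup>2 \<le> C)"
proof -
  obtain C where C: "C \<ge> 0" "\<And>q. q \<in> anderson \<Longrightarrow> 2 * ipd q * \<bar>pot_b q\<bar> \<le> C \<and> 2 * ipd q * \<bar>pot_c q\<bar> \<le> C
     \<and> 2 * ipd q * (bdef q * \<bar>hes_bb q\<bar>) \<le> C \<and> 2 * ipd q * (bdef q * \<bar>hes_bc q\<bar>) \<le> C
     \<and> 2 * ipd q * (bdef q * \<bar>hes_cc q\<bar>) \<le> C \<and> 2 * ipd q * \<bar>tsn q\<bar> \<le> C"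
    using potential_bounds by blast
  define B where "B = (20 * C)\<^sup>2"
  have "eden q / (bdef q)\<^sup>2 * (ipd q)\<^sup>2 \<le> B \<and> (\<forall>k j. (bdef q * ipd q)\<^sup>2 * (mten q $ k $ j)\<^sup>2 \<le> B)" if q: "q \<in> anderson" for q
  proof -
    define i D where "i = ipd q" and "D = bdef q"
    have i: "i > 0" and D: "0 < D" "D \<le> 1" using ipd_facts[OF q] coord_bounds[OF q] by (auto simp: i_def D_def)
    have X: "0 \<le> rad2 q" "rad2 q < 1" and y: "\<bar>q $ 3\<bar> \<le> 1" using coord_bounds[OF q] rad2_nonneg[of q] by auto
    have x12: "\<bar>q $ 1\<bar> \<le> 1" "\<bar>q $ 2\<bar> \<le> 1"
    proof -
      have "(q $ 1)\<^sup>2 \<le> 1" "(q $ 2)\<^sup>2 \<le> 1" using X zero_le_power2[of "q $ 1"] zero_le_power2[of "q $ 2"]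
        unfolding rad2_def by linarith+
      then show "\<bar>q $ 1\<bar> \<le> 1" "\<bar>q $ 2\<bar> \<le> 1" by (simp_all add: abs_square_le_1)
    qed
    have qk: "\<forall>k. \<bar>q $ k\<bar> \<le> 1" unfolding forall_3 using x12 y by simp
    define b c t where "b = i * pot_b q" and "c = i * pot_c q" and "t = i * tsn q"
    define hb hc hm where "hb = i * (D * hes_bb q)" and "hc = i * (D * hes_cc q)" and "hm = i * (D * hes_bc q)"
    have bd: "\<bar>b\<bar> \<le> C" "\<bar>c\<bar> \<le> C" "\<bar>t\<bar> \<le> C" "\<bar>hb\<bar> \<le> C" "\<bar>hc\<bar> \<le> C" "\<bar>hm\<bar> \<le> C"
    proof -
      have "\<bar>i * x\<bar> \<le> C" if "2 * i * \<bar>x\<bar> \<le> C" for x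
      proof -
        have "0 \<le> i * \<bar>x\<bar>" using i by simp
        then have "i * \<bar>x\<bar> \<le> C" using that by linarith
        then show ?thesis using i by (simp add: abs_mult)
      qed
      note h = this
      have aD: "D * \<bar>x\<bar> = \<bar>D * x\<bar>" for x using D by (simp add: abs_mult)
      note c = C(2)[OF q, folded i_def D_def, unfolded aD]
      show "\<bar>b\<bar> \<le> C" "\<bar>c\<bar> \<le> C" "\<bar>t\<bar> \<le> C" "\<bar>hb\<bar> \<le> C" "\<bar>hc\<bar> \<le> C" "\<bar>hm\<bar> \<le> C"
        unfolding b_def c_def t_def hb_def hc_def hm_def
        by (rule h; use c in blast)+
    qed
    have m1: "\<bar>x * z\<bar> \<le> K" if "\<bar>x\<bar> \<le> K" "\<bar>z\<bar> \<le> 1" for x z K :: real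
    proof -
      have "\<bar>x\<bar> * \<bar>z\<bar> \<le> K * 1" using that by (intro mult_mono) auto
      then show ?thesis by (simp add: abs_mult)
    qed
    have "eden q / (bdef q)\<^sup>2 * (ipd q)\<^sup>2 = rad2 q * b\<^sup>2 + c\<^sup>2"
    proof -
      have "eden q / (bdef q)\<^sup>2 = rad2 q * (pot_b q)\<^sup>2 + (pot_c q)\<^sup>2"
        using D by (simp add: eden_def D_def)
      then show ?thesis by (simp add: b_def c_def i_def power_mult_distrib algebra_simps)
    qed
    also have "\<dots> \<le> 1 * C\<^sup>2 + C\<^sup>2"
    proof (intro mult_mono add_mono)
      show "b\<^sup>2 \<le> C\<^sup>2" "c\<^sup>2 \<le> C\<^sup>2" using bd C(1) by (simp_all add: power2_le_iff_abs_le)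
    qed (use X C(1) in auto)
    also have "\<dots> \<le> B" using C(1) by (simp add: B_def power_mult_distrib)
    finally have E: "eden q / (bdef q)\<^sup>2 * (ipd q)\<^sup>2 \<le> B" .
    have F: "\<forall>k. \<bar>i * dpot q $ k\<bar> \<le> C"
      unfolding forall_3 using m1[OF bd(1) x12(1)] m1[OF bd(1) x12(2)] bd(2) by (simp add: b_def c_def mult.assoc)
    have S: "\<bar>i * rsum q\<bar> \<le> 2 * C"
    proof -
      have "i * rsum q = b * rad2 q + c * q $ 3" by (simp add: rsum_def b_def c_def algebra_simps)
      then show ?thesis using m1[OF bd(1), of "rad2 q"] m1[OF bd(2) y] X by linarith
    qed
    have H: "\<forall>k j. \<bar>i * D * hesm q $ k $ j\<bar> \<le> 2 * C"
    proof -
      have bD: "\<bar>b * D\<bar> \<le> C" using m1[OF bd(1), of D] D by simp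
      have two: "\<bar>hb * (q $ k * q $ l)\<bar> \<le> C" "\<bar>hm * q $ k\<bar> \<le> C" for k l
        using m1[OF bd(4), of "q $ k * q $ l"] m1[of "q $ k" 1 "q $ l"] m1[OF bd(6), of "q $ k"] qk by auto
      have ev: "i * D * (pot_b q + hes_bb q * q $ k * q $ l) = b * D + hb * (q $ k * q $ l)"
        "i * D * (hes_bb q * q $ k * q $ l) = hb * (q $ k * q $ l)"
        "i * D * (hes_bc q * q $ k) = hm * q $ k" "i * D * hes_cc q = hc" for k l
        by (simp_all add: b_def hb_def hm_def hc_def algebra_simps)
      have tri: "\<bar>b * D + hb * (q $ k * q $ l)\<bar> \<le> 2 * C" for k l using two(1)[of k l] bD by linarith
      have one: "\<bar>hb * (q $ k * q $ l)\<bar> \<le> 2 * C" "\<bar>hm * q $ k\<bar> \<le> 2 * C" "\<bar>hc\<bar> \<le> 2 * C" for k l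
        using two(1)[of k l] two(2)[of k] bd C(1) by linarith+
      show ?thesis unfolding forall_3 hesm_def vector_3 ev using tri one by blast
    qed
    have R: "\<bar>D * psi q * (rot q $ k * rot q $ j)\<bar> \<le> 1" for k j
    proof -
      have sq: "(rot q $ k)\<^sup>2 \<le> rad2 q" for k
      proof -
        have "\<forall>k. (rot q $ k)\<^sup>2 \<le> rad2 q" unfolding forall_3 by (simp add: rad2_def)
        then show ?thesis by blast
      qed
      have "(rot q $ k * rot q $ j)\<^sup>2 \<le> rad2 q * rad2 q"
        unfolding power_mult_distrib using sq X by (intro mult_mono) auto
      then have "(rot q $ k * rot q $ j)\<^sup>2 \<le> (rad2 q)\<^sup>2" by (simp only: power2_eq_square)
      then have rr: "\<bar>rot q $ k * rot q $ j\<bar> \<le> rad2 q" using X power2_le_iff_abs_le by blast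
      have p: "psi q > 0" "D\<^sup>2 * psi q * (1 + rad2 q * psi q) = 1" using psi_facts[OF q] by (auto simp: D_def)
      have "(D * psi q * rad2 q)\<^sup>2 = (D\<^sup>2 * psi q * (rad2 q * psi q)) * rad2 q" by (simp add: power2_eq_square)
      also have "\<dots> \<le> 1 * 1"
      proof (rule mult_mono)
        have "D\<^sup>2 * psi q * (rad2 q * psi q) \<le> D\<^sup>2 * psi q * (1 + rad2 q * psi q)"
          using p(1) by (intro mult_left_mono) auto
        then show "D\<^sup>2 * psi q * (rad2 q * psi q) \<le> 1" using p(2) by simp
      qed (use X p(1) in auto)
      finally have "(D * psi q * rad2 q)\<^sup>2 \<le> 1" by simp
      then have "D * psi q * rad2 q \<le> 1" by (simp add: abs_square_le_1)
      moreover have "\<bar>D * psi q\<bar> * \<bar>rot q $ k * rot q $ j\<bar> \<le> \<bar>D * psi q\<bar> * rad2 q" using rr by (intro mult_left_mono) auto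
      moreover have "\<bar>D * psi q\<bar> = D * psi q" using D p(1) by simp
      ultimately show ?thesis unfolding abs_mult[of "D * psi q"] by linarith
    qed
    have "(bdef q * ipd q)\<^sup>2 * (mten q $ k $ j)\<^sup>2 \<le> B" for k j
    proof -
      define h where "h = i * D * hesm q $ k $ j"
      define f1 f2 f3 where "f1 = i * dpot q $ j * q $ k" and "f2 = i * dpot q $ k * q $ j"
        and "f3 = (if k = j then i * rsum q else 0)"
      define r where "r = t * (D * psi q * (rot q $ k * rot q $ j))"
      have "D * i * mten q $ k $ j = h - 2 * (f1 + f2 - f3) - r"
        using D unfolding mten_def h_def f1_def f2_def f3_def r_def t_def D_def[symmetric]
        by (simp add: field_simps)
      moreover have "\<bar>h - 2 * (f1 + f2 - f3) - r\<bar> \<le> 20 * C"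
      proof -
      have "\<bar>h\<bar> \<le> 2 * C" using H by (simp add: h_def)
      moreover have "\<bar>f1\<bar> \<le> C" "\<bar>f2\<bar> \<le> C" using m1 F qk by (auto simp: f1_def f2_def)
      moreover have "\<bar>f3\<bar> \<le> 2 * C" using S C(1) by (simp add: f3_def)
      moreover have "\<bar>r\<bar> \<le> C" unfolding r_def by (rule m1[OF bd(3) R])
      moreover have "\<bar>f1 + f2 - f3\<bar> \<le> \<bar>f1\<bar> + \<bar>f2\<bar> + \<bar>f3\<bar>" by linarith
      moreover have "\<bar>h - 2 * f - r\<bar> \<le> \<bar>h\<bar> + 2 * \<bar>f\<bar> + \<bar>r\<bar>" for f by linarith
      from this[of "f1 + f2 - f3"]
      have "\<bar>h - 2 * (f1 + f2 - f3) - r\<bar> \<le> \<bar>h\<bar> + 2 * \<bar>f1 + f2 - f3\<bar> + \<bar>r\<bar>" .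
      ultimately show ?thesis using C(1) by linarith
      qed
      ultimately have "\<bar>D * i * mten q $ k $ j\<bar> \<le> 20 * C" by simp
      then have "(D * i * mten q $ k $ j)\<^sup>2 \<le> B"
        unfolding B_def using C(1) by (subst power2_le_iff_abs_le) auto
      then show ?thesis by (simp add: D_def i_def power_mult_distrib)
    qed
    then show ?thesis using E by blast
  qed
  moreover have "B \<ge> 0" by (simp add: B_def)
  ultimately show ?thesis by blast
qed

section \<open>Integration on the Anderson manifold\<close>

text \<open>The shell where \<open>bdef \<le> 4\<^sup>-\<^sup>k\<close> has volume of order \<open>4\<^sup>-\<^sup>k\<close>, and where \<open>bdef > 4\<^sup>-\<^sup>k\<^sup>-\<^sup>1\<close> the integrand
  is at most \<open>2\<^sup>k\<^sup>+\<^sup>1\<close>, so the integral is dominated by a geometric series.\<close>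

lemma nn_integral_shell_finite:
  "(\<integral>\<^sup>+x. ennreal (if x \<in> anderson then 1 / sqrt (bdef x) else 0) \<partial>lborel) < \<infinity>"
proof -
  define A where "A k = {x \<in> anderson. bdef x \<le> (1/4) ^ k}" for k :: nat
  define r where "r k = sqrt (1 - (1/4::real) ^ k)" for k :: nat
  define V where "V = unit_ball_vol (real DIM(real^3))"
  have V: "V \<ge> 0" by (simp add: V_def)
  have q4: "(0::real) < (1/4) ^ k" "(1/4::real) ^ k \<le> 1" for k by (auto simp: power_le_one)
  have r: "0 \<le> r k" "r k \<le> 1" for k using q4[of k] by (auto simp: r_def)
  have Aeq: "A k = ball 0 1 - ball 0 (r k)" for k
  proof (intro set_eqI)
    fix x :: "real^3"
    have "bdef x \<le> (1/4) ^ k \<longleftrightarrow> 1 - (1/4) ^ k \<le> (norm x)\<^sup>2" by (auto simp: bdef_def norm_sq_3)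
    also have "\<dots> \<longleftrightarrow> r k \<le> norm x" unfolding r_def by (metis norm_ge_zero real_le_lsqrt real_sqrt_le_iff real_sqrt_abs abs_norm_cancel)
    finally show "x \<in> A k \<longleftrightarrow> x \<in> ball 0 1 - ball 0 (r k)" by (auto simp: A_def anderson_def not_less)
  qed
  have meas: "A k \<in> sets lborel" for k by (simp add: Aeq)
  have em: "emeasure lborel (A k) \<le> ennreal (2 * V * (1/4) ^ k)" for k
  proof -
    have "emeasure lborel (A k) = emeasure lborel (ball (0::real^3) 1) - emeasure lborel (ball (0::real^3) (r k))"
      unfolding Aeq using r[of k] by (intro emeasure_Diff) (auto simp: emeasure_ball)
    also have "\<dots> = ennreal (V * 1 ^ 3) - ennreal (V * r k ^ 3)"
      using r[of k] by (simp add: emeasure_ball V_def)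
    also have "\<dots> = ennreal (V * (1 - r k ^ 3))" using V r[of k] by (simp add: ennreal_minus algebra_simps)
    also have "\<dots> \<le> ennreal (2 * V * (1/4) ^ k)"
    proof (rule ennreal_leI)
      have "(r k)\<^sup>2 = 1 - (1/4) ^ k" using q4[of k] by (simp add: r_def)
      then have "r k ^ 4 = (1 - (1/4) ^ k)\<^sup>2" by (metis mult_2 numeral_Bit0 power_add power2_eq_square)
      moreover have "r k ^ 4 \<le> r k ^ 3" using r[of k] by (intro power_decreasing) auto
      moreover have "(1 - (1/4::real) ^ k)\<^sup>2 \<ge> 1 - 2 * (1/4) ^ k" by (simp add: power2_eq_square algebra_simps)
      ultimately have "1 - r k ^ 3 \<le> 2 * (1/4) ^ k" by linarith
      from mult_left_mono[OF this V] show "V * (1 - r k ^ 3) \<le> 2 * V * (1/4) ^ k" by (simp add: mult_ac)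
    qed
    finally show ?thesis .
  qed
  have pt: "ennreal (if x \<in> anderson then 1 / sqrt (bdef x) else 0) \<le> (\<Sum>k. ennreal (2 * 2 ^ k) * indicator (A k) x)" for x
  proof (cases "x \<in> anderson")
    case True
    have D: "0 < bdef x" "bdef x \<le> 1" using coord_bounds[OF True] by auto
    obtain m where "(1/4::real) ^ m < bdef x" using real_arch_pow_inv[OF D(1), of "1/4"] by auto
    define n where "n = (LEAST m. (1/4::real) ^ m < bdef x)"
    have n: "(1/4::real) ^ n < bdef x" unfolding n_def by (rule LeastI) fact
    have "n \<noteq> 0" using n D by (intro notI) simp
    then obtain k where k: "n = Suc k" by (cases n) auto
    have "bdef x \<le> (1/4) ^ k" using not_less_Least[of k "\<lambda>m. (1/4::real) ^ m < bdef x"] k unfolding n_def[symmetric] by simp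
    then have xA: "x \<in> A k" using True by (simp add: A_def)
    have "1 / sqrt (bdef x) \<le> 1 / sqrt ((1/4) ^ n)" using n q4[of n] D by (intro divide_left_mono mult_pos_pos) auto
    also have "sqrt ((1/4) ^ n) = (1/2) ^ n" by (simp add: real_sqrt_power real_sqrt_divide)
    also have "1 / (1/2) ^ n = (2 * 2 ^ k :: real)" by (simp add: k power_divide)
    finally have "ennreal (1 / sqrt (bdef x)) \<le> ennreal (2 * 2 ^ k) * indicator (A k) x" using xA by (simp add: ennreal_leI)
    also have "\<dots> \<le> (\<Sum>k. ennreal (2 * 2 ^ k) * indicator (A k) x)"
    proof -
      have "t k \<le> (\<Sum>k. t k)" for t :: "nat \<Rightarrow> ennreal" using sum_le_suminf[of t "{k}"] by simp
      then show ?thesis .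
    qed
    finally show ?thesis using True by simp
  qed simp
  have "(\<integral>\<^sup>+x. ennreal (if x \<in> anderson then 1 / sqrt (bdef x) else 0) \<partial>lborel)
     \<le> (\<integral>\<^sup>+x. (\<Sum>k. ennreal (2 * 2 ^ k) * indicator (A k) x) \<partial>lborel)"
    by (rule nn_integral_mono) (rule pt)
  also have "\<dots> = (\<Sum>k. \<integral>\<^sup>+x. ennreal (2 * 2 ^ k) * indicator (A k) x \<partial>lborel)"
    by (rule nn_integral_suminf) (use meas in measurable)
  also have "\<dots> = (\<Sum>k. ennreal (2 * 2 ^ k) * emeasure lborel (A k))"
    using meas by (simp add: nn_integral_cmult_indicator)
  also have "\<dots> \<le> (\<Sum>k. ennreal (4 * V * (1/2) ^ k))"
  proof (rule suminf_le)
    fix k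
    have "ennreal (2 * 2 ^ k) * emeasure lborel (A k) \<le> ennreal (2 * 2 ^ k) * ennreal (2 * V * (1/4) ^ k)"
      by (rule mult_left_mono[OF em]) simp
    also have "\<dots> = ennreal (4 * V * (1/2) ^ k)"
    proof -
      have "(2::real) ^ k * (1/4) ^ k = (1/2) ^ k" by (simp flip: power_mult_distrib)
      then have "2 * 2 ^ k * (2 * V * (1/4) ^ k) = 4 * V * (1/2) ^ k" by (simp add: mult_ac)
      then show ?thesis using V by (simp flip: ennreal_mult)
    qed
    finally show "ennreal (2 * 2 ^ k) * emeasure lborel (A k) \<le> ennreal (4 * V * (1/2) ^ k)" .
  qed auto
  also have "\<dots> = ennreal (\<Sum>k. 4 * V * (1/2) ^ k)"
    using V by (intro suminf_ennreal2 summable_mult summable_geometric) auto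
  also have "\<dots> < \<infinity>" by simp
  finally show ?thesis .
qed

text \<open>The Riemannian volume density, extended by 0.\<close>

definition vdens :: "real^3 \<Rightarrow> real" where
  "vdens q = (if q \<in> anderson then sqrt (psi q) / (bdef q)\<^sup>2 else 0)"

lemma Ck_on_continuous: "Ck_on k S f \<Longrightarrow> continuous_on S f"
  by (induction k) (auto dest: Ck_on_SucD simp del: Ck_on.simps(2))

lemma continuous_sqrt_psi_bdef: "continuous_on anderson (\<lambda>q. sqrt (psi q) / (bdef q)\<^sup>2)"
proof -
  have "bdef q \<noteq> 0" if "q \<in> anderson" for q using coord_bounds(1)[OF that] by simp
  then show ?thesis
    using Ck_on_continuous[OF Ck_psi] Ck_on_continuous[OF Ck_bdef] by (auto intro!: continuous_intros)
qed

lemma anderson_borel [measurable]: "anderson \<in> sets borel"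
  by (simp add: anderson_def)

lemma borel_measurable_extend_zero:
  fixes f :: "real^3 \<Rightarrow> real"
  assumes "continuous_on anderson f"
  shows "(\<lambda>q. if q \<in> anderson then f q else 0) \<in> borel_measurable borel"
  using assms by (intro borel_measurable_continuous_on_if) auto

lemma vdens_measurable [measurable]: "vdens \<in> borel_measurable borel"
  unfolding vdens_def[abs_def] by (rule borel_measurable_extend_zero[OF continuous_sqrt_psi_bdef])

lemma vdens_nonneg: "vdens q \<ge> 0"
  using psi_facts by (auto simp: vdens_def less_imp_le)

lemma vol_anderson: "vol anderson anderson_metric = density lborel (\<lambda>q. ennreal (vdens q))"
proof -
  have "indicator anderson q * ennreal (sqrt (det (anderson_metric q))) = ennreal (vdens q)" for q
  proof (cases "q \<in> anderson")
    case True
    have "sqrt (det (anderson_metric q)) = sqrt (psi q) / (bdef q)\<^sup>2"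
      unfolding det_anderson_metric[OF True]
      by (simp add: real_sqrt_divide) (metis abs_power2 numeral_Bit0 power_add power2_eq_square real_sqrt_abs)
    then show ?thesis using True by (simp add: vdens_def)
  qed (simp add: vdens_def)
  then show ?thesis by (simp add: vol_def)
qed

lemma AE_vol_anderson: "AE q in vol anderson anderson_metric. q \<in> anderson"
proof -
  have m: "(\<lambda>q. ennreal (vdens q)) \<in> borel_measurable lborel" by measurable
  show ?thesis unfolding vol_anderson AE_density[OF m] by (auto simp: vdens_def)
qed

text \<open>Only the values of the integrand inside the ball matter, so measurability is needed only for
  the continuous function that represents it there.\<close>

lemma nn_integral_vol:
  assumes c: "continuous_on anderson h" and eq: "\<And>q. q \<in> anderson \<Longrightarrow> F q = ennreal (h q)"
  shows "(\<integral>\<^sup>+q. F q \<partial>vol anderson anderson_metric) = (\<integral>\<^sup>+q. ennreal (h q * vdens q) \<partial>lborel)"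
proof -
  note m = borel_measurable_extend_zero[OF c]
  have "(\<integral>\<^sup>+q. F q \<partial>vol anderson anderson_metric)
     = (\<integral>\<^sup>+q. ennreal (if q \<in> anderson then h q else 0) \<partial>vol anderson anderson_metric)"
    using AE_vol_anderson by (intro nn_integral_cong_AE) (auto simp: eq)
  also have "\<dots> = (\<integral>\<^sup>+q. ennreal (vdens q) * ennreal (if q \<in> anderson then h q else 0) \<partial>lborel)"
    unfolding vol_anderson using m by (intro nn_integral_density) auto
  also have "\<dots> = (\<integral>\<^sup>+q. ennreal (h q * vdens q) \<partial>lborel)"
    by (intro nn_integral_cong) (auto simp: vdens_def ennreal_mult'' mult.commute psi_facts less_imp_le)
  finally show ?thesis .
qed

text \<open>Near the boundary and away from the end points of \<open>L\<close> the volume density is of order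
  \<open>bdef\<^sup>-\<^sup>5\<^sup>/\<^sup>2\<close>, so a factor \<open>bdef\<^sup>2\<close> in the integrand reduces the claim to the integrability of
  \<open>bdef\<^sup>-\<^sup>1\<^sup>/\<^sup>2\<close>. The power of \<open>ipd\<close> in the hypothesis absorbs the additional singularity at these
  points.\<close>

lemma nn_integral_vol_finite:
  assumes c: "continuous_on anderson h" and eq: "\<And>q. q \<in> anderson \<Longrightarrow> F q = ennreal (h q)"
    and C: "C \<ge> 0" "\<And>q. q \<in> anderson \<Longrightarrow> h q / (bdef q)\<^sup>2 * (ipd q)\<^sup>2 \<le> C"
  shows "(\<integral>\<^sup>+q. F q \<partial>vol anderson anderson_metric) < \<infinity>"
proof -
  have le: "h q * vdens q \<le> 8 * C * (if q \<in> anderson then 1 / sqrt (bdef q) else 0)" for q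
  proof (cases "q \<in> anderson")
    case True
    define i D where "i = ipd q" and "D = bdef q"
    have i: "i \<ge> 1/2" and D: "D > 0" and p: "psi q > 0" "D * psi q \<le> 2 * i"
      using ipd_facts[OF True] coord_bounds[OF True] psi_facts[OF True] by (auto simp: i_def D_def)
    have "sqrt (psi q) \<le> 8 * i\<^sup>2 / sqrt D"
    proof (rule real_le_lsqrt)
      have "psi q \<le> 2 * i / D" using p(2) D by (simp add: field_simps)
      also have "2 * i / D \<le> 64 * i ^ 4 / D"
      proof (rule divide_right_mono)
        have "(1/2) ^ 3 \<le> i ^ 3" using i by (intro power_mono) auto
        then have "1/8 \<le> i ^ 3" by (simp add: power3_eq_cube)
        then have "2 * i * 1 \<le> 2 * i * (32 * i ^ 3)" using i by (intro mult_left_mono) auto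
        then show "2 * i \<le> 64 * i ^ 4" by (simp add: eval_nat_numeral)
      qed (use D in simp)
      also have "\<dots> = (8 * i\<^sup>2 / sqrt D)\<^sup>2" using D by (simp add: power_divide power_mult_distrib)
      finally show "psi q \<le> (8 * i\<^sup>2 / sqrt D)\<^sup>2" .
    qed (use D p in auto)
    then have s: "sqrt (psi q) / i\<^sup>2 \<le> 8 / sqrt D" using i D by (simp add: field_simps)
    have "h q * vdens q = (h q / D\<^sup>2 * i\<^sup>2) * (sqrt (psi q) / i\<^sup>2)"
      using True i by (simp add: vdens_def D_def)
    also have "\<dots> \<le> C * (sqrt (psi q) / i\<^sup>2)"
      using C(2)[OF True] p by (intro mult_right_mono) (auto simp: i_def D_def)
    also have "\<dots> \<le> C * (8 / sqrt D)" using s C(1) by (rule mult_left_mono)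
    finally show ?thesis using True by (simp add: D_def mult.commute)
  qed (simp add: vdens_def)
  have m: "(\<lambda>q. if q \<in> anderson then 1 / sqrt (bdef q) else 0) \<in> borel_measurable borel"
  proof -
    have "bdef q \<noteq> 0" if "q \<in> anderson" for q using coord_bounds(1)[OF that] by simp
    then show ?thesis
      using Ck_on_continuous[OF Ck_bdef]
      by (intro borel_measurable_extend_zero) (auto intro!: continuous_intros)
  qed
  have "(\<integral>\<^sup>+q. F q \<partial>vol anderson anderson_metric) = (\<integral>\<^sup>+q. ennreal (h q * vdens q) \<partial>lborel)"
    by (rule nn_integral_vol[OF c eq])
  also have "\<dots> \<le> (\<integral>\<^sup>+q. ennreal (8 * C) * ennreal (if q \<in> anderson then 1 / sqrt (bdef q) else 0) \<partial>lborel)"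
    using C(1) le by (intro nn_integral_mono) (simp only: ennreal_mult'[symmetric] ennreal_leI mult_nonneg_nonneg)
  also have "\<dots> = ennreal (8 * C) * (\<integral>\<^sup>+q. ennreal (if q \<in> anderson then 1 / sqrt (bdef q) else 0) \<partial>lborel)"
    using m by (intro nn_integral_cmult) auto
  also have "\<dots> < \<infinity>" using nn_integral_shell_finite by (simp add: ennreal_mult_less_top)
  finally show ?thesis .
qed

lemma Ck_on_union:
  assumes "open S" "open T"
  shows "Ck_on k S f \<Longrightarrow> Ck_on k T f \<Longrightarrow> Ck_on k (S \<union> T) f"
proof (induction k arbitrary: f)
  case 0
  then show ?case using assms by (simp add: continuous_on_open_Un)
next
  case (Suc k)
  then show ?case by auto
qed

text \<open>Difference quotients of an integrable function integrate to 0 because Lebesgue measure is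
  translation invariant. They converge to the derivative and are dominated by a multiple of the
  indicator function of a ball.\<close>

lemma integral_derivative_eq_0:
  fixes f :: "'a::euclidean_space \<Rightarrow> real"
  assumes f: "Ck_on 1 UNIV f" and K: "compact K" "\<And>x. x \<notin> K \<Longrightarrow> f x = 0"
  shows "integral\<^sup>L lborel (\<lambda>x. frechet_derivative f (at x) e) = 0"
    and "integrable lborel (\<lambda>x. frechet_derivative f (at x) e)"
proof -
  define g where "g x = frechet_derivative f (at x) e" for x
  have d: "(f has_derivative frechet_derivative f (at x)) (at x)" for x
    using Ck_on_Suc_has_derivative[of 0 UNIV f x] f by simp
  have cg: "continuous_on UNIV g" using f by (auto simp: g_def)
  have cf: "continuous_on UNIV f" using d by (auto simp: continuous_on_eq_continuous_within intro: has_derivative_continuous)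
  have g0: "g x = 0" if "x \<notin> K" for x
  proof -
    have "(f has_derivative (\<lambda>v. 0)) (at x)"
      by (rule has_derivative_transform_within_open[OF has_derivative_const, of "- K"])
        (use K that in \<open>auto simp: compact_imp_closed open_Compl\<close>)
    then show ?thesis unfolding g_def using frechet_derivative_at by metis
  qed
  have int0: "integrable lborel h" if "continuous_on UNIV h" "\<And>x. x \<notin> K \<Longrightarrow> h x = 0" for h :: "'a \<Rightarrow> real"
  proof -
    have "integrable lborel (\<lambda>x. indicator K x *\<^sub>R h x)"
      by (rule borel_integrable_compact[OF K(1)]) (use that(1) continuous_on_subset in blast)
    moreover have "(\<lambda>x. indicator K x *\<^sub>R h x) = h" using that(2) by (auto simp: indicator_def fun_eq_iff)
    ultimately show ?thesis by simp
  qed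
  show "integrable lborel (\<lambda>x. frechet_derivative f (at x) e)" using int0[OF cg g0] by (simp add: g_def)
  obtain B where B: "\<And>x. \<bar>g x\<bar> \<le> B"
  proof -
    have "bounded (g ` K)" using K(1) cg by (intro compact_imp_bounded compact_continuous_image) (auto intro: continuous_on_subset)
    then obtain B where B: "\<And>x. x \<in> K \<Longrightarrow> \<bar>g x\<bar> \<le> B" by (auto simp: bounded_iff)
    have "\<bar>g x\<bar> \<le> max B 0" for x using B[of x] g0[of x] by (cases "x \<in> K") auto
    then show ?thesis using that by blast
  qed
  have line: "((\<lambda>t. f (x + t *\<^sub>R e)) has_real_derivative g (x + t *\<^sub>R e)) (at t)" for x t
  proof -
    have "((\<lambda>t. x + t *\<^sub>R e) has_derivative (\<lambda>h. h *\<^sub>R e)) (at t)" by (auto intro!: derivative_eq_intros)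
    from has_derivative_compose[OF this d]
    have "((\<lambda>t. f (x + t *\<^sub>R e)) has_derivative (\<lambda>h. frechet_derivative f (at (x + t *\<^sub>R e)) (h *\<^sub>R e))) (at t)" .
    moreover have "frechet_derivative f (at (x + t *\<^sub>R e)) (h *\<^sub>R e) = g (x + t *\<^sub>R e) * h" for h
      using linear_scale[OF has_derivative_linear[OF d]] by (simp add: g_def mult.commute)
    ultimately show ?thesis by (simp add: has_field_derivative_def)
  qed
  define s where "s n x = (f (x + (1 / real (Suc n)) *\<^sub>R e) - f x) / (1 / real (Suc n))" for n x
  obtain R where R: "\<And>x. x \<in> K \<Longrightarrow> norm x \<le> R" using compact_imp_bounded[OF K(1)] by (auto simp: bounded_iff)
  define L where "L = cball (0::'a) (R + norm e)"
  have sb: "norm (s n x) \<le> B * indicator L x" for n x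
  proof (cases "x \<in> L")
    case True
    define h where "h = 1 / real (Suc n)"
    have h: "0 < h" by (simp add: h_def)
    obtain z where "f (x + h *\<^sub>R e) - f (x + 0 *\<^sub>R e) = (h - 0) * g (x + z *\<^sub>R e)"
      using MVT2[OF h line] by blast
    then have "s n x = g (x + z *\<^sub>R e)" unfolding s_def h_def[symmetric] using h by simp
    then show ?thesis using B True by simp
  next
    case False
    have "norm ((1 / real (Suc n)) *\<^sub>R e) \<le> norm e"
      using mult_left_mono[of 1 "1 + real n" "norm e"] by (simp add: divide_le_eq)
    moreover have "R + norm e < norm x" using False by (simp add: L_def not_le)
    ultimately have "R < norm (x + (1 / real (Suc n)) *\<^sub>R e)" "R < norm x"
      using norm_diff_ineq[of x "(1 / real (Suc n)) *\<^sub>R e"] norm_ge_zero[of e] by linarith+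
    then have "x + (1 / real (Suc n)) *\<^sub>R e \<notin> K" "x \<notin> K" using R by force+
    then show ?thesis using K(2) False by (simp add: s_def)
  qed
  have trans: "integrable lborel (\<lambda>x. f (x + a))" "integral\<^sup>L lborel (\<lambda>x. f (x + a)) = integral\<^sup>L lborel f" for a
  proof -
    have fm: "f \<in> borel_measurable borel" using cf by (rule borel_measurable_continuous_onI)
    have "integrable (distr lborel borel ((+) a)) f" unfolding lborel_distr_plus by (rule int0[OF cf K(2)])
    then show "integrable lborel (\<lambda>x. f (x + a))" using fm by (subst (asm) integrable_distr_eq) (auto simp: add.commute)
    have "integral\<^sup>L (distr lborel borel ((+) a)) f = integral\<^sup>L lborel (\<lambda>x. f (a + x))"
      using fm by (intro integral_distr) auto
    then show "integral\<^sup>L lborel (\<lambda>x. f (x + a)) = integral\<^sup>L lborel f" by (simp add: lborel_distr_plus add.commute)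
  qed
  have "(\<lambda>n. integral\<^sup>L lborel (s n)) \<longlonglongrightarrow> integral\<^sup>L lborel g"
  proof (rule integral_dominated_convergence[where w="\<lambda>x. B * indicator L x"])
    show "g \<in> borel_measurable lborel" using cg by (simp add: borel_measurable_continuous_onI)
    have "f \<in> borel_measurable borel" using cf by (rule borel_measurable_continuous_onI)
    then show "s n \<in> borel_measurable lborel" for n unfolding s_def[abs_def] by measurable
    show "integrable lborel (\<lambda>x. B * indicator L x)"
      by (intro integrable_mult_right integrable_real_indicator) (use emeasure_bounded_finite[of L] in \<open>auto simp: L_def\<close>)
    show "AE x in lborel. norm (s n x) \<le> B * indicator L x" for n using sb by simp
    show "AE x in lborel. (\<lambda>n. s n x) \<longlonglongrightarrow> g x"
    proof (rule AE_I2)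
      fix x
      have "((\<lambda>h. (f (x + h *\<^sub>R e) - f x) / h) \<longlongrightarrow> g x) (at 0)"
        using line[of x 0] by (simp add: DERIV_def)
      moreover have "filterlim (\<lambda>n. 1 / real (Suc n)) (at 0) sequentially"
        unfolding filterlim_at using LIMSEQ_inverse_real_of_nat by (auto simp: inverse_eq_divide)
      ultimately show "(\<lambda>n. s n x) \<longlonglongrightarrow> g x" unfolding s_def by (rule filterlim_compose)
    qed
  qed
  moreover have "integral\<^sup>L lborel (s n) = 0" for n
    unfolding s_def using trans int0[OF cf K(2)] by simp
  ultimately have "(\<lambda>n. 0) \<longlonglongrightarrow> integral\<^sup>L lborel g" by simp
  from LIMSEQ_unique[OF this tendsto_const]
  show "integral\<^sup>L lborel (\<lambda>x. frechet_derivative f (at x) e) = 0" by (simp only: g_def[abs_def])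
qed

section \<open>Vanishing of the Hodge Laplacian\<close>

lemma smooth_on_open_iff:
  assumes "open S"
  shows "smooth_on S f \<longleftrightarrow> (\<forall>k. Ck_on k S f)"
proof
  assume "smooth_on S f"
  then obtain T h where h: "open T" "S \<subseteq> T" "\<And>k. Ck_on k T h" "\<And>x. x \<in> S \<Longrightarrow> h x = f x"
    unfolding smooth_on_def by blast
  have "Ck_on k S h" for k using h(3) h(2) by (rule Ck_on_subset)
  then show "\<forall>k. Ck_on k S f" using Ck_on_cong[OF assms, of h f] h(4) by blast
qed (use assms in \<open>auto simp: smooth_on_def\<close>)

lemma Ck_dpot: "Ck_on k anderson (\<lambda>q. dpot q $ i)"
proof -
  have "\<forall>i. Ck_on k anderson (\<lambda>q. dpot q $ i)"
    unfolding forall_3 dpot_nth by (intro conjI Ck_closure Ck_pot_b Ck_pot_c)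
  then show ?thesis by blast
qed

lemma Ck_sqrt_psi: "Ck_on k anderson (\<lambda>q. sqrt (psi q))"
proof -
  have "Ck_on k anderson (\<lambda>q. psi q powr (1/2))"
    by (rule Ck_on_powr[OF open_anderson psi_facts(1) Ck_psi])
  then show ?thesis
    by (subst Ck_on_cong[OF open_anderson, where g="\<lambda>q. psi q powr (1/2)"])
      (simp_all add: powr_half_sqrt psi_facts less_imp_le)
qed

lemma Ck_on_1_differentiable: "Ck_on 1 S f \<Longrightarrow> x \<in> S \<Longrightarrow> f differentiable (at x)"
  by simp

text \<open>The equation for the potential, in divergence form.\<close>

lemma pot_divergence_form:
  assumes q: "q \<in> anderson"
  shows "(\<Sum>i\<in>UNIV. partial i (\<lambda>q. sqrt (psi q) * dpot q $ i) q) = 0"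
proof -
  have p: "psi q > 0" using psi_facts(1)[OF q] .
  have "axi_deriv (\<lambda>q. sqrt (psi q)) (inverse (sqrt (psi q)) / 2 * psi_b q) (inverse (sqrt (psi q)) / 2 * psi_c q) q"
    by (rule axi_deriv_compose[OF axi_deriv_psi[OF q] DERIV_real_sqrt[OF p]])
  note a = this axi_deriv_partial[OF this]
  have pi: "partial i (\<lambda>q. sqrt (psi q) * dpot q $ i) q
      = partial i (\<lambda>q. sqrt (psi q)) q * dpot q $ i + sqrt (psi q) * hesm q $ i $ i" for i
    using partial_mult[OF axi_deriv_differentiable[OF a(1)] dpot_differentiable[OF q]] partial_dpot[OF q] by simp
  have "(\<Sum>i\<in>UNIV. partial i (\<lambda>q. sqrt (psi q) * dpot q $ i) q)
     = inverse (sqrt (psi q)) * (1/2 * dpsi q) + sqrt (psi q) * (2 * pot_b q + rad2 q * hes_bb q + hes_cc q)"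
    unfolding pi sum_3 a(2-4)
    by (simp add: dpsi_def hesm_def rad2_def algebra_simps power2_eq_square add_divide_distrib)
  also have "\<dots> = (sqrt (psi q) - inverse (sqrt (psi q)) * psi q) * (2 * pot_b q + rad2 q * hes_bb q + hes_cc q)"
    unfolding pot_pde[OF q] by (simp add: algebra_simps)
  also have "inverse (sqrt (psi q)) * psi q = sqrt (psi q)"
    using p by (simp add: real_div_sqrt flip: divide_inverse_commute)
  finally show ?thesis by simp
qed

text \<open>The vector field \<open>\<phi> sqrt psi \<nabla>pot\<close>, extended by 0, has compact support, and its divergence is
  the integrand because \<open>sqrt psi \<nabla>pot\<close> is divergence free.\<close>

lemma integral_vol_test:
  assumes \<phi>: "test_on anderson \<phi>"
  shows "(\<integral>q. (bdef q)\<^sup>2 * (\<Sum>i\<in>UNIV. partial i \<phi> q * dpot q $ i) * vdens q \<partial>lborel) = 0"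
proof -
  obtain K where K: "compact K" "K \<subseteq> anderson" "\<And>x. x \<in> anderson - K \<Longrightarrow> \<phi> x = 0"
    using \<phi> unfolding test_on_def by blast
  have C\<phi>: "Ck_on k anderson \<phi>" for k using \<phi> smooth_on_open_iff[OF open_anderson] unfolding test_on_def by blast
  define V where "V i q = (if q \<in> anderson then sqrt (psi q) * dpot q $ i * \<phi> q else 0)" for i q
  have V0: "V i q = 0" if "q \<notin> K" for i q using that K(3) by (auto simp: V_def)
  have oK: "open (- K)" using K(1) by (simp add: compact_imp_closed open_Compl)
  have CV: "Ck_on 1 UNIV (V i)" for i
  proof -
    have "Ck_on 1 anderson (\<lambda>q. sqrt (psi q) * dpot q $ i * \<phi> q)"
      by (intro Ck_closure Ck_sqrt_psi Ck_dpot C\<phi>)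
    then have "Ck_on 1 anderson (V i)" by (subst Ck_on_cong[OF open_anderson]) (auto simp: V_def)
    moreover have "Ck_on 1 (- K) (V i)"
      by (subst Ck_on_cong[OF oK, of _ "\<lambda>_. 0"]) (auto simp: V0 intro: Ck_on_const[OF oK] simp del: Ck_on.simps One_nat_def)
    ultimately have "Ck_on 1 (anderson \<union> - K) (V i)" by (rule Ck_on_union[OF open_anderson oK])
    moreover have "anderson \<union> - K = UNIV" using K(2) by auto
    ultimately show ?thesis by simp
  qed
  have eq: "(bdef q)\<^sup>2 * (\<Sum>i\<in>UNIV. partial i \<phi> q * dpot q $ i) * vdens q
      = (\<Sum>i\<in>UNIV. frechet_derivative (V i) (at q) (axis i 1))" for q
  proof (cases "q \<in> anderson")
    case True
    have d1: "(\<lambda>q. sqrt (psi q) * dpot q $ i) differentiable (at q)" for i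
      by (rule Ck_on_1_differentiable[OF _ True]) (intro Ck_closure Ck_sqrt_psi Ck_dpot)
    have d2: "\<phi> differentiable (at q)" using Ck_on_1_differentiable[OF C\<phi> True] .
    have "frechet_derivative (V i) (at q) (axis i 1)
       = partial i (\<lambda>q. sqrt (psi q) * dpot q $ i) q * \<phi> q + sqrt (psi q) * dpot q $ i * partial i \<phi> q" for i
    proof -
      have "partial i (V i) q = partial i (\<lambda>q. (sqrt (psi q) * dpot q $ i) * \<phi> q) q"
        by (rule partial_transform[OF True]) (simp add: V_def)
      also have "\<dots> = partial i (\<lambda>q. sqrt (psi q) * dpot q $ i) q * \<phi> q + sqrt (psi q) * dpot q $ i * partial i \<phi> q"
        by (rule partial_mult[OF d1 d2])
      finally show ?thesis by (simp add: partial_def)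
    qed
    then have "(\<Sum>i\<in>UNIV. frechet_derivative (V i) (at q) (axis i 1))
       = (\<Sum>i\<in>UNIV. partial i (\<lambda>q. sqrt (psi q) * dpot q $ i) q) * \<phi> q + sqrt (psi q) * (\<Sum>i\<in>UNIV. partial i \<phi> q * dpot q $ i)"
      by (simp add: sum.distrib sum_distrib_left sum_distrib_right mult_ac)
    also have "\<dots> = sqrt (psi q) * (\<Sum>i\<in>UNIV. partial i \<phi> q * dpot q $ i)" by (simp add: pot_divergence_form[OF True])
    finally show ?thesis using True coord_bounds(1)[OF True] by (simp add: vdens_def)
  next
    case False
    have "frechet_derivative (V i) (at q) (axis i 1) = 0" for i
    proof -
      have "(V i has_derivative (\<lambda>v. 0)) (at q)"
        by (rule has_derivative_transform_within_open[OF has_derivative_const oK, of q 0]) (use False K(2) V0 in auto)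
      from frechet_derivative_at[OF this, symmetric] show ?thesis by simp
    qed
    then show ?thesis using False by (simp add: vdens_def)
  qed
  have "(\<integral>q. (\<Sum>i\<in>UNIV. frechet_derivative (V i) (at q) (axis i 1)) \<partial>lborel)
     = (\<Sum>i\<in>UNIV. \<integral>q. frechet_derivative (V i) (at q) (axis i 1) \<partial>lborel)"
    by (rule Bochner_Integration.integral_sum) (rule integral_derivative_eq_0(2)[OF CV K(1) V0])
  also have "\<dots> = 0" by (simp add: integral_derivative_eq_0(1)[OF CV K(1) V0])
  finally show ?thesis unfolding eq .
qed

lemma flat_scale: "flat g (\<lambda>x. c *\<^sub>R u x) x = c *\<^sub>R flat g u x"
  by (simp add: flat_def matrix_vector_mult_scaleR)

text \<open>A test function may be arbitrary outside the ball, so the integrand need not be a measurable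
  function on the whole space. In that case its integral is 0 by convention; otherwise it is
  computed from a continuous representative on the ball.\<close>

lemma is_codiff1_gfield:
  "is_codiff1 anderson anderson_metric (flat anderson_metric (\<lambda>x. c *\<^sub>R gfield x)) (\<lambda>x. 0)"
proof -
  let ?V = "vol anderson anderson_metric"
  have "(\<integral>x. cov_inner anderson_metric x (ext_d0 \<phi> x) (flat anderson_metric (\<lambda>x. c *\<^sub>R gfield x) x) \<partial>?V) = 0"
    if \<phi>: "test_on anderson \<phi>" for \<phi>
  proof -
    define f where "f x = cov_inner anderson_metric x (ext_d0 \<phi> x) (flat anderson_metric (\<lambda>x. c *\<^sub>R gfield x) x)" for x
    define h where "h q = c * ((bdef q)\<^sup>2 * (\<Sum>i\<in>UNIV. partial i \<phi> q * dpot q $ i))" for q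
    define h0 where "h0 q = (if q \<in> anderson then h q else 0)" for q
    have C\<phi>: "Ck_on k anderson \<phi>" for k using \<phi> smooth_on_open_iff[OF open_anderson] unfolding test_on_def by blast
    have "continuous_on anderson (\<lambda>q. partial i \<phi> q)" for i
      using C\<phi>[of 1] by (simp add: partial_def)
    then have "continuous_on anderson h"
      unfolding h_def using Ck_on_continuous[OF Ck_bdef] Ck_on_continuous[OF Ck_dpot]
      by (intro continuous_on_mult continuous_on_power continuous_on_sum continuous_on_const) auto
    then have mh: "h0 \<in> borel_measurable borel" unfolding h0_def[abs_def] by (rule borel_measurable_extend_zero)
    have fh: "f q = h q" if q: "q \<in> anderson" for q
    proof -
      have "f q = (\<Sum>i\<in>UNIV. partial i \<phi> q * (c * (ginv q *v dpot q) $ i))"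
        unfolding f_def cov_inner_def flat_scale flat_gfield[OF q] anderson_metric_inverse(1)[OF q]
        by (simp add: ext_d0_def matrix_vector_mult_def sum_distrib_left mult_ac)
      also have "ginv q *v dpot q = gfield q"
      proof -
        have "ginv q *v flat anderson_metric gfield q = (ginv q ** anderson_metric q) *v gfield q"
          by (simp add: flat_def matrix_vector_mul_assoc)
        then show ?thesis using anderson_metric_inverse(3)[OF q] flat_gfield[OF q] by simp
      qed
      finally show ?thesis using q by (simp add: gfield_def h_def sum_distrib_left mult_ac)
    qed
    have ae: "AE q in ?V. f q = h0 q" using AE_vol_anderson by eventually_elim (simp add: fh h0_def)
    have "integral\<^sup>L ?V h0 = (\<integral>q. vdens q *\<^sub>R h0 q \<partial>lborel)"
      unfolding vol_anderson using mh vdens_nonneg by (intro integral_density) auto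
    also have "\<dots> = (\<integral>q. c * ((bdef q)\<^sup>2 * (\<Sum>i\<in>UNIV. partial i \<phi> q * dpot q $ i) * vdens q) \<partial>lborel)"
      by (rule Bochner_Integration.integral_cong) (auto simp: h0_def h_def vdens_def)
    also have "\<dots> = 0" using integral_vol_test[OF \<phi>] by simp
    finally have h0: "integral\<^sup>L ?V h0 = 0" .
    have "integral\<^sup>L ?V f = 0"
    proof (cases "integrable ?V f")
      case True
      have "h0 \<in> borel_measurable ?V" using mh by (simp add: vol_anderson)
      then show ?thesis using integral_cong_AE[OF borel_measurable_integrable[OF True] _ ae] h0 by simp
    qed (simp add: not_integrable_integral_eq)
    then show ?thesis unfolding f_def[abs_def] .
  qed
  moreover have "smooth_on anderson (\<lambda>x::real^3. 0::real)"
    using smooth_on_open_iff[OF open_anderson] Ck_on_const[OF open_anderson] by blast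
  ultimately show ?thesis by (simp add: is_codiff1_def)
qed

lemma hesm_sym: "hesm q $ i $ j = hesm q $ j $ i"
proof -
  have "\<forall>i j. hesm q $ i $ j = hesm q $ j $ i" unfolding forall_3 by (simp add: hesm_def)
  then show ?thesis by blast
qed

lemma partial_cmult:
  assumes "f differentiable (at x)"
  shows "partial i (\<lambda>y. c * f y) x = c * partial i f x"
  using partial_mult[OF differentiable_const assms, of i c] by (simp add: partial_def frechet_derivative_const)

lemma ext_d1_gfield:
  assumes q: "q \<in> anderson"
  shows "ext_d1 (flat anderson_metric (\<lambda>x. c *\<^sub>R gfield x)) q = 0"
proof -
  have "partial i (\<lambda>y. flat anderson_metric (\<lambda>x. c *\<^sub>R gfield x) y $ j) q = c * hesm q $ i $ j" for i j
  proof -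
    have "partial i (\<lambda>y. flat anderson_metric (\<lambda>x. c *\<^sub>R gfield x) y $ j) q = partial i (\<lambda>y. c * dpot y $ j) q"
      by (rule partial_transform[OF q]) (simp add: flat_scale flat_gfield)
    then show ?thesis using partial_cmult[OF dpot_differentiable[OF q]] partial_dpot[OF q] by simp
  qed
  then show ?thesis by (simp add: ext_d1_def vec_eq_iff hesm_sym[of q] )
qed

lemma is_codiff2_gfield:
  "is_codiff2 anderson anderson_metric (ext_d1 (flat anderson_metric (\<lambda>x. c *\<^sub>R gfield x))) (\<lambda>x. 0)"
proof -
  have "smooth_on anderson (\<lambda>x::real^3. 0::real^3)"
    using smooth_on_open_iff[OF open_anderson] Ck_on_const[OF open_anderson] by blast
  moreover have "(\<integral>x. (1/2) * tensor_inner anderson_metric x (ext_d1 \<psi> x) (ext_d1 (flat anderson_metric (\<lambda>x. c *\<^sub>R gfield x)) x) \<partial>vol anderson anderson_metric) = 0" for \<psi>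
    by (rule integral_eq_zero_AE) (use AE_vol_anderson in eventually_elim, simp add: ext_d1_gfield tensor_inner_def)
  ultimately show ?thesis by (simp add: is_codiff2_def cov_inner_def)
qed

lemma is_hodge_laplacian_gfield:
  "is_hodge_laplacian anderson anderson_metric (\<lambda>x. c *\<^sub>R gfield x) (\<lambda>x. 0)"
  unfolding is_hodge_laplacian_def
  by (rule exI[of _ "\<lambda>x. 0"], rule exI[of _ "\<lambda>x. 0"])
    (simp add: is_codiff1_gfield is_codiff2_gfield sharp_def ext_d0_def partial_def frechet_derivative_const
      matrix_vector_mult_def vec_eq_iff)

lemma nabla_scale:
  assumes "(\<lambda>y. u y $ k) differentiable (at x)"
  shows "nabla g (\<lambda>y. c *\<^sub>R u y) i k x = c * nabla g u i k x"
  using partial_cmult[OF assms] by (simp add: nabla_def algebra_simps sum_distrib_left)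

lemma gfield_scale:
  assumes q: "q \<in> anderson"
  shows "nabla_flat anderson_metric (\<lambda>x. c *\<^sub>R gfield x) q = c *\<^sub>R nabla_flat anderson_metric gfield q"
    and "divergence anderson_metric (\<lambda>x. c *\<^sub>R gfield x) q = 0"
    and "cov_deriv anderson_metric (\<lambda>x. c *\<^sub>R gfield x) (\<lambda>x. c *\<^sub>R gfield x) q = c\<^sup>2 *\<^sub>R cov_deriv anderson_metric gfield gfield q"
    and "deformation anderson_metric (\<lambda>x. c *\<^sub>R gfield x) q = c *\<^sub>R nabla_flat anderson_metric gfield q"
proof -
  note s = nabla_scale[OF gfield_differentiable[OF q]]
  show n: "nabla_flat anderson_metric (\<lambda>x. c *\<^sub>R gfield x) q = c *\<^sub>R nabla_flat anderson_metric gfield q"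
    by (simp add: nabla_flat_def vec_eq_iff s sum_distrib_left mult_ac)
  show "divergence anderson_metric (\<lambda>x. c *\<^sub>R gfield x) q = 0"
    using gfield_divergence[OF q] by (simp add: divergence_def s flip: sum_distrib_left)
  show "cov_deriv anderson_metric (\<lambda>x. c *\<^sub>R gfield x) (\<lambda>x. c *\<^sub>R gfield x) q = c\<^sup>2 *\<^sub>R cov_deriv anderson_metric gfield gfield q"
    by (simp add: cov_deriv_def vec_eq_iff s sum_distrib_left power2_eq_square mult_ac)
  have "transpose (nabla_flat anderson_metric gfield q) = nabla_flat anderson_metric gfield q"
    by (simp add: transpose_def vec_eq_iff nabla_flat_sym[OF q])
  then show "deformation anderson_metric (\<lambda>x. c *\<^sub>R gfield x) q = c *\<^sub>R nabla_flat anderson_metric gfield q"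
    unfolding deformation_def n transpose_scalar by (simp add: scaleR_2[symmetric])
qed

section \<open>Finite energy and the family of decaying flows\<close>

lemma nn_integral_vol_scale:
  assumes c: "continuous_on anderson h" and k: "k \<ge> 0"
    and F: "\<And>q. q \<in> anderson \<Longrightarrow> F q = ennreal (h q)" and G: "\<And>q. q \<in> anderson \<Longrightarrow> G q = ennreal (k * h q)"
  shows "(\<integral>\<^sup>+q. G q \<partial>vol anderson anderson_metric) = ennreal k * (\<integral>\<^sup>+q. F q \<partial>vol anderson anderson_metric)"
proof -
  have "(\<lambda>q. (if q \<in> anderson then h q else 0) * vdens q) \<in> borel_measurable borel"
    using borel_measurable_extend_zero[OF c] by measurable
  moreover have "(\<lambda>q. (if q \<in> anderson then h q else 0) * vdens q) = (\<lambda>q. h q * vdens q)"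
    by (auto simp: vdens_def)
  ultimately have m: "(\<lambda>q. h q * vdens q) \<in> borel_measurable borel" by simp
  have ck: "continuous_on anderson (\<lambda>q. k * h q)" using c by (intro continuous_intros)
  have "(\<integral>\<^sup>+q. G q \<partial>vol anderson anderson_metric) = (\<integral>\<^sup>+q. ennreal (k * h q * vdens q) \<partial>lborel)"
    by (rule nn_integral_vol[OF ck G])
  also have "\<dots> = (\<integral>\<^sup>+q. ennreal k * ennreal (h q * vdens q) \<partial>lborel)"
    using k by (intro nn_integral_cong) (simp add: ennreal_mult' mult.assoc)
  also have "\<dots> = ennreal k * (\<integral>\<^sup>+q. ennreal (h q * vdens q) \<partial>lborel)"
    using m by (intro nn_integral_cmult) auto
  also have "(\<integral>\<^sup>+q. ennreal (h q * vdens q) \<partial>lborel) = (\<integral>\<^sup>+q. F q \<partial>vol anderson anderson_metric)"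
    by (rule nn_integral_vol[OF c F, symmetric])
  finally show ?thesis .
qed

definition tden :: "real^3 \<Rightarrow> real" where
  "tden q = (bdef q) ^ 4 * (\<Sum>k\<in>UNIV. \<Sum>j\<in>UNIV. (mten q $ k $ j)\<^sup>2)"

lemma continuous_eden: "continuous_on anderson eden"
  by (rule Ck_on_continuous[OF Ck_eden])

lemma Ck_on_partial: "Ck_on (Suc k) S f \<Longrightarrow> Ck_on k S (partial i f)"
  by (simp add: partial_def[abs_def])

lemma continuous_mten: "continuous_on anderson (\<lambda>q. mten q $ k $ j)"
proof -
  have h: "continuous_on anderson (\<lambda>q. hesm q $ k $ j)" for k j
  proof -
    have "continuous_on anderson (partial k (\<lambda>y. dpot y $ j))"
      by (rule Ck_on_continuous[of 0], rule Ck_on_partial, rule Ck_dpot)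
    then show ?thesis by (rule continuous_on_eq) (simp add: partial_dpot)
  qed
  have D: "bdef q \<noteq> 0" if "q \<in> anderson" for q using coord_bounds(1)[OF that] by simp
  note c = Ck_on_continuous[OF Ck_bdef] Ck_on_continuous[OF Ck_rad2] Ck_on_continuous[OF Ck_pot_b] Ck_on_continuous[OF Ck_pot_c]
    Ck_on_continuous[OF Ck_psi] Ck_on_continuous[OF Ck_dpot] Ck_on_continuous[OF Ck_on_nth[OF open_anderson]] h
  have r: "continuous_on anderson rsum" unfolding rsum_def[abs_def]
    by (intro continuous_on_add continuous_on_mult c)
  have L: "continuous_on anderson (\<lambda>q. \<Sum>i\<in>UNIV. hesm q $ i $ i)" by (intro continuous_on_sum c)
  have t: "continuous_on anderson tsn"
  proof -
    have "tsn q = (bdef q)\<^sup>2 * psi q * (pot_b q - (\<Sum>i\<in>UNIV. hesm q $ i $ i))" if "q \<in> anderson" for q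
      unfolding tsn_def pot_pde[OF that] by (simp add: sum_3 hesm_def rad2_def power2_eq_square algebra_simps)
    moreover have "continuous_on anderson (\<lambda>q. (bdef q)\<^sup>2 * psi q * (pot_b q - (\<Sum>i\<in>UNIV. hesm q $ i $ i)))"
      by (intro continuous_on_mult continuous_on_power continuous_on_diff c L)
    ultimately show ?thesis using continuous_on_eq by (metis (no_types, lifting))
  qed
  have rr: "continuous_on anderson (\<lambda>q. rot q $ k)" for k
    by (rule has_derivative_continuous_on[OF has_derivative_at_withinI[OF rot_nth_derivative]])
  have i: "continuous_on anderson (\<lambda>q. if k = j then rsum q else 0)" using r by (cases "k = j") auto
  show ?thesis unfolding mten_def vec_lambda_beta
    by (intro continuous_on_diff continuous_on_add continuous_on_mult continuous_on_divide continuous_on_const c r t rr i)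
      (use D in auto)
qed

lemma continuous_tden: "continuous_on anderson tden"
  unfolding tden_def[abs_def]
  by (intro continuous_on_mult continuous_on_power continuous_on_sum continuous_mten Ck_on_continuous[OF Ck_bdef])

lemma gfield_energy:
  "L2_sq_vec anderson anderson_metric gfield < \<infinity>"
  "L2_sq_tensor anderson anderson_metric (nabla_flat anderson_metric gfield) < \<infinity>"
proof -
  obtain C where C: "C \<ge> 0" "\<And>q. q \<in> anderson \<Longrightarrow> eden q / (bdef q)\<^sup>2 * (ipd q)\<^sup>2 \<le> C"
      "\<And>q k j. q \<in> anderson \<Longrightarrow> (bdef q * ipd q)\<^sup>2 * (mten q $ k $ j)\<^sup>2 \<le> C"
    using mten_bound by metis
  show "L2_sq_vec anderson anderson_metric gfield < \<infinity>" unfolding L2_sq_vec_def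
    by (rule nn_integral_vol_finite[OF continuous_eden _ C(1,2)]) (simp add: vec_inner_gfield)
  have C9: "0 \<le> 9 * C" using C(1) by simp
  show "L2_sq_tensor anderson anderson_metric (nabla_flat anderson_metric gfield) < \<infinity>" unfolding L2_sq_tensor_def
  proof (rule nn_integral_vol_finite[OF continuous_tden _ C9])
    fix q assume q: "q \<in> anderson"
    show "ennreal (tensor_inner anderson_metric q (nabla_flat anderson_metric gfield q) (nabla_flat anderson_metric gfield q)) = ennreal (tden q)"
      by (simp add: tensor_inner_nabla_flat[OF q] tden_def)
    have D: "bdef q \<noteq> 0" using coord_bounds(1)[OF q] by simp
    have "tden q / (bdef q)\<^sup>2 * (ipd q)\<^sup>2 = (\<Sum>k\<in>UNIV. \<Sum>j\<in>UNIV. (bdef q * ipd q)\<^sup>2 * (mten q $ k $ j)\<^sup>2)"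
      using D by (simp add: tden_def sum_distrib_left[symmetric] power_mult_distrib power2_eq_square eval_nat_numeral)
    also have "\<dots> \<le> (\<Sum>k\<in>(UNIV::3 set). \<Sum>j\<in>(UNIV::3 set). C)" by (intro sum_mono C(3)[OF q])
    finally show "tden q / (bdef q)\<^sup>2 * (ipd q)\<^sup>2 \<le> 9 * C" by (simp add: sum_3)
  qed
qed

lemma energy_scale:
  "L2_sq_vec anderson anderson_metric (\<lambda>x. c *\<^sub>R gfield x) = ennreal (c\<^sup>2) * L2_sq_vec anderson anderson_metric gfield"
  "L2_sq_tensor anderson anderson_metric (nabla_flat anderson_metric (\<lambda>x. c *\<^sub>R gfield x))
    = ennreal (c\<^sup>2) * L2_sq_tensor anderson anderson_metric (nabla_flat anderson_metric gfield)"
  "L2_sq_tensor anderson anderson_metric (deformation anderson_metric (\<lambda>x. c *\<^sub>R gfield x))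
    = ennreal (c\<^sup>2) * L2_sq_tensor anderson anderson_metric (nabla_flat anderson_metric gfield)"
proof -
  have v: "vec_inner g x (c *\<^sub>R u) (c *\<^sub>R u) = c\<^sup>2 * vec_inner g x u u" for g and x u :: "real^3"
    by (simp add: vec_inner_def sum_distrib_left power2_eq_square mult_ac)
  have t: "tensor_inner g x (c *\<^sub>R T) (c *\<^sub>R T) = c\<^sup>2 * tensor_inner g x T T" for g and x :: "real^3" and T
    by (simp add: tensor_inner_def sum_distrib_left power2_eq_square mult_ac)
  show "L2_sq_vec anderson anderson_metric (\<lambda>x. c *\<^sub>R gfield x) = ennreal (c\<^sup>2) * L2_sq_vec anderson anderson_metric gfield"
    unfolding L2_sq_vec_def
    by (rule nn_integral_vol_scale[OF continuous_eden]) (simp_all add: v vec_inner_gfield)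
  show "L2_sq_tensor anderson anderson_metric (nabla_flat anderson_metric (\<lambda>x. c *\<^sub>R gfield x))
    = ennreal (c\<^sup>2) * L2_sq_tensor anderson anderson_metric (nabla_flat anderson_metric gfield)"
    unfolding L2_sq_tensor_def
    by (rule nn_integral_vol_scale[OF continuous_tden]) (simp_all add: t gfield_scale(1) tensor_inner_nabla_flat tden_def)
  show "L2_sq_tensor anderson anderson_metric (deformation anderson_metric (\<lambda>x. c *\<^sub>R gfield x))
    = ennreal (c\<^sup>2) * L2_sq_tensor anderson anderson_metric (nabla_flat anderson_metric gfield)"
    unfolding L2_sq_tensor_def
    by (rule nn_integral_vol_scale[OF continuous_tden]) (simp_all add: t gfield_scale(4) tensor_inner_nabla_flat tden_def)
qed

text \<open>On the axis the potential is the Gaussian of \<open>lon\<close>, which is stationary only at the origin.\<close>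

definition axis_point :: "real^3" where "axis_point = vector [0, 0, 1/2]"

lemma pot_c_axis_point: "axis_point \<in> anderson" "pot_c axis_point \<noteq> 0"
proof -
  let ?q = axis_point
  have c: "?q $ 1 = 0" "?q $ 2 = 0" "?q $ 3 = 1/2" by (simp_all add: axis_point_def)
  have X: "rad2 ?q = 0" and D: "bdef ?q = 3/4" by (simp_all add: rad2_def bdef_def c power2_eq_square)
  show q: "?q \<in> anderson" using anderson_iff_bdef_pos[of ?q] D by simp
  have N: "pdist4 ?q = (3/4)\<^sup>2" by (simp add: pdist4_def X D)
  have I: "ipd ?q = 4/3"
  proof -
    have "(ipd ?q)\<^sup>2 = (4/3)\<^sup>2" using ipd2_eq[OF q] by (simp add: N power2_eq_square)
    moreover have "0 \<le> ipd ?q" using ipd_facts(1)[OF q] by simp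
    ultimately show ?thesis by (rule power2_eq_imp_eq) simp
  qed
  have lat: "lat ?q = 0" by (simp add: lat_def D I)
  have lon: "lon ?q \<noteq> 0" by (simp add: lon_def X c power2_eq_square)
  have "pot_c ?q = gauss_deriv 1 (lon ?q) * lon_c ?q"
    by (simp add: pot_c_def lat_c_def X Phi_def lat strip_sol_axis)
  moreover have "gauss_deriv 1 (lon ?q) \<noteq> 0" using lon by (simp only: gauss_deriv_1) simp
  moreover have "lon_c ?q \<noteq> 0" by (simp add: lon_c_def X D I)
  ultimately show "pot_c ?q \<noteq> 0" by simp
qed

text \<open>The energy density is positive on a nonempty open set.\<close>

lemma gfield_energy_pos: "L2_sq_vec anderson anderson_metric gfield > 0"
proof (rule ccontr)
  assume "\<not> ?thesis"
  then have z: "(\<integral>\<^sup>+q. ennreal (eden q * vdens q) \<partial>lborel) = 0"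
    using nn_integral_vol[OF continuous_eden, of "\<lambda>q. ennreal (vec_inner anderson_metric q (gfield q) (gfield q))"]
    by (simp add: L2_sq_vec_def vec_inner_gfield)
  have "(\<lambda>q. (if q \<in> anderson then eden q else 0) * vdens q) \<in> borel_measurable borel"
    using borel_measurable_extend_zero[OF continuous_eden] by measurable
  moreover have "(\<lambda>q. (if q \<in> anderson then eden q else 0) * vdens q) = (\<lambda>q. eden q * vdens q)"
    by (auto simp: vdens_def)
  ultimately have m: "(\<lambda>q. eden q * vdens q) \<in> borel_measurable borel" by simp
  have ae: "AE q in lborel. eden q * vdens q \<le> 0"
    using z m by (simp add: nn_integral_0_iff_AE ennreal_eq_0_iff)
  define S where "S = {q \<in> anderson. pot_c q \<noteq> 0}"
  have "open S"
  proof -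
    have "open (pot_c -` (- {0}) \<inter> anderson)"
      using Ck_on_continuous[OF Ck_pot_c] open_anderson continuous_on_open_vimage by blast
    then show ?thesis by (simp add: S_def Collect_conj_eq vimage_def Int_commute)
  qed
  have pos: "eden q * vdens q > 0" if "q \<in> S" for q
  proof -
    have q: "q \<in> anderson" "pot_c q \<noteq> 0" using that by (auto simp: S_def)
    have D: "bdef q > 0" using coord_bounds(1)[OF q(1)] .
    have "rad2 q * (pot_b q)\<^sup>2 + (pot_c q)\<^sup>2 > 0" using q(2) rad2_nonneg[of q] by (intro add_nonneg_pos) auto
    then have "eden q > 0" using D by (simp add: eden_def)
    moreover have "vdens q > 0" using q(1) D psi_facts(1)[OF q(1)] by (simp add: vdens_def)
    ultimately show ?thesis by simp
  qed
  have "AE q in lborel. q \<notin> S" using ae by eventually_elim (use pos in force)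
  then have "S \<in> null_sets lborel" using \<open>open S\<close> by (simp add: AE_iff_null_sets)
  then have "negligible S" by (simp add: negligible_iff_null_sets null_sets_completionI)
  moreover have "axis_point \<in> S" using pot_c_axis_point by (simp add: S_def)
  ultimately show False using open_not_negligible[OF \<open>open S\<close>] by blast
qed

definition decay_flow :: "real \<Rightarrow> real \<Rightarrow> real^3 \<Rightarrow> real^3" where
  "decay_flow C t x = exp (- C * t) *\<^sub>R gfield x"

text \<open>The first term balances the time derivative of \<open>decay_flow\<close>, the second its convective term.\<close>

definition decay_pressure :: "real \<Rightarrow> real \<Rightarrow> real^3 \<Rightarrow> real" where
  "decay_pressure C t x = C * exp (- C * t) * pot x - 1/2 * (exp (- C * t))\<^sup>2 * eden x"

lemma Ck_gfield: "Ck_on k anderson gfield"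
proof (rule Ck_on_vec[OF open_anderson])
  fix i
  have "Ck_on k anderson (\<lambda>q. (bdef q)\<^sup>2 * dpot q $ i)" by (intro Ck_closure Ck_bdef Ck_dpot)
  then show "Ck_on k anderson (\<lambda>q. gfield q $ i)"
    by (subst Ck_on_cong[OF open_anderson]) (auto simp: gfield_def)
qed

lemma Ck_on_exp_fst: "Ck_on k (UNIV \<times> S) (\<lambda>z :: real \<times> 'a::real_normed_vector. exp (- C * fst z))" if "open S" for S
proof (induction k)
  case 0
  show ?case by (auto intro!: continuous_intros)
next
  case (Suc k)
  have o: "open (UNIV \<times> S :: (real \<times> 'a) set)" using that by (simp add: open_Times)
  show ?case
  proof (rule Ck_on_SucI[OF o])
    show "((\<lambda>z :: real \<times> 'a. exp (- C * fst z)) has_derivative (\<lambda>v. exp (- C * fst x) * (- C * fst v))) (at x)" for x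
      by (auto intro!: derivative_eq_intros)
    show "Ck_on k (UNIV \<times> S) (\<lambda>x. exp (- C * fst x) * (- C * fst v))" for v :: "real \<times> 'a"
      by (intro Ck_on_bilinear[OF bounded_bilinear_mult o Suc] Ck_on_const[OF o])
  qed
qed

lemma smooth_on_time_space:
  assumes "\<And>k. Ck_on k (UNIV \<times> anderson) h"
  shows "smooth_on ({0..} \<times> anderson) h"
  unfolding smooth_on_def
  by (rule exI[of _ "UNIV \<times> anderson"], rule exI[of _ h]) (auto simp: open_Times open_anderson assms)

lemma decay_smooth:
  "smooth_on ({0..} \<times> anderson) (\<lambda>(t, x). decay_flow C t x)"
  "smooth_on ({0..} \<times> anderson) (\<lambda>(t, x). decay_pressure C t x)"
proof -
  have o: "open (UNIV \<times> anderson :: (real \<times> (real^3)) set)" by (simp add: open_Times open_anderson)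
  have sp: "Ck_on k (UNIV \<times> anderson) (\<lambda>z :: real \<times> (real^3). f (snd z))" if "Ck_on k anderson f"
    for k and f :: "real^3 \<Rightarrow> 'b::real_normed_vector"
    by (rule Ck_on_compose_linear[OF bounded_linear_snd open_anderson o _ that]) auto
  note e = Ck_on_exp_fst[OF open_anderson]
  show "smooth_on ({0..} \<times> anderson) (\<lambda>(t, x). decay_flow C t x)"
  proof (rule smooth_on_time_space)
    show "Ck_on k (UNIV \<times> anderson) (\<lambda>(t, x). decay_flow C t x)" for k
      unfolding decay_flow_def case_prod_unfold
      by (rule Ck_on_bilinear[OF bounded_bilinear_scaleR o e sp[OF Ck_gfield]])
  qed
  show "smooth_on ({0..} \<times> anderson) (\<lambda>(t, x). decay_pressure C t x)"
  proof (rule smooth_on_time_space)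
    show "Ck_on k (UNIV \<times> anderson) (\<lambda>(t, x). decay_pressure C t x)" for k
      unfolding decay_pressure_def case_prod_unfold
      by (intro Ck_on_diff_real[OF o] Ck_on_bilinear[OF bounded_bilinear_mult o] Ck_on_power_real[OF o]
          Ck_on_const[OF o] e sp[OF Ck_pot] sp[OF Ck_eden])
  qed
qed

lemma grad_pot:
  assumes q: "q \<in> anderson"
  shows "grad anderson_metric pot q = gfield q"
proof -
  have "ext_d0 pot q = anderson_metric q *v gfield q"
    using flat_gfield[OF q] by (simp add: ext_d0_def partial_pot[OF q] vec_eq_iff flat_def)
  then show ?thesis
    by (simp add: grad_def sharp_def anderson_metric_inverse(1)[OF q] matrix_vector_mul_assoc anderson_metric_inverse(3)[OF q])
qed

lemma grad_decay_pressure: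
  assumes q: "q \<in> anderson"
  shows "grad anderson_metric (decay_pressure C t) q
    = (C * exp (- C * t)) *\<^sub>R gfield q - (exp (- C * t))\<^sup>2 *\<^sub>R ((1/2) *\<^sub>R grad anderson_metric eden q)"
proof -
  have dp: "pot differentiable (at q)" and de: "eden differentiable (at q)"
    using Ck_on_1_differentiable[OF Ck_pot q] Ck_on_1_differentiable[OF Ck_eden q] .
  have "partial i (decay_pressure C t) q = C * exp (- C * t) * partial i pot q - 1/2 * (exp (- C * t))\<^sup>2 * partial i eden q" for i
    unfolding decay_pressure_def[abs_def]
    by (subst partial_diff) (use dp de in \<open>simp_all only: partial_cmult differentiable_mult[OF differentiable_const]\<close>)
  then have "ext_d0 (decay_pressure C t) q = (C * exp (- C * t)) *\<^sub>R ext_d0 pot q - (1/2 * (exp (- C * t))\<^sup>2) *\<^sub>R ext_d0 eden q"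
    by (simp add: ext_d0_def vec_eq_iff)
  then show ?thesis
    unfolding grad_pot[OF q, symmetric]
    by (simp add: grad_def sharp_def matrix_vector_mult_diff_distrib matrix_vector_mult_scaleR)
qed

lemma decay_navier_stokes: "navier_stokes anderson anderson_metric \<nu> gfield (decay_flow C) (decay_pressure C)"
  unfolding navier_stokes_def
proof (intro conjI allI impI ballI)
  fix t :: real assume t: "t \<ge> 0"
  have fl: "decay_flow C t = (\<lambda>x. exp (- C * t) *\<^sub>R gfield x)" by (auto simp: decay_flow_def)
  show "\<exists>w. is_hodge_laplacian anderson anderson_metric (decay_flow C t) w \<and>
      (\<forall>x\<in>anderson. vector_derivative (\<lambda>s. decay_flow C s x) (at t within {0..})
        + cov_deriv anderson_metric (decay_flow C t) (decay_flow C t) x - \<nu> *\<^sub>R w x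
        + grad anderson_metric (decay_pressure C t) x = 0)"
  proof (intro exI[of _ "\<lambda>x. 0"] conjI ballI)
    show "is_hodge_laplacian anderson anderson_metric (decay_flow C t) (\<lambda>x. 0)"
      unfolding fl by (rule is_hodge_laplacian_gfield)
    fix x assume x: "x \<in> anderson"
    have "at t within {0..} \<noteq> bot"
    proof -
      have "at_right t \<le> at t within {0..}" using t by (intro at_le) auto
      then show ?thesis using trivial_limit_at_right_real[of t] by (metis bot.extremum_uniqueI)
    qed
    moreover have "((\<lambda>s. decay_flow C s x) has_vector_derivative (- C * exp (- C * t)) *\<^sub>R gfield x) (at t within {0..})"
      unfolding decay_flow_def by (auto intro!: derivative_eq_intros)
    ultimately have "vector_derivative (\<lambda>s. decay_flow C s x) (at t within {0..}) = (- C * exp (- C * t)) *\<^sub>R gfield x"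
      by (rule vector_derivative_within)
    then show "vector_derivative (\<lambda>s. decay_flow C s x) (at t within {0..})
        + cov_deriv anderson_metric (decay_flow C t) (decay_flow C t) x - \<nu> *\<^sub>R 0
        + grad anderson_metric (decay_pressure C t) x = 0"
      unfolding fl gfield_scale(3)[OF x] cov_deriv_gfield[OF x] grad_decay_pressure[OF x] by simp
  qed
  show "divergence anderson_metric (decay_flow C t) x = 0" if "x \<in> anderson" for x
    unfolding fl by (rule gfield_scale(2)[OF that])
next
  show "decay_flow C 0 x = gfield x" for x by (simp add: decay_flow_def)
qed

lemma exp_decay_nn_integral:
  assumes C: "C > 0" and t: "t \<ge> 0"
  shows "(\<integral>\<^sup>+s\<in>{0..t}. ennreal ((exp (- C * s))\<^sup>2) \<partial>lborel) = ennreal ((1 - (exp (- C * t))\<^sup>2) / (2 * C))"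
    and "(\<integral>\<^sup>+s\<in>{0..}. ennreal ((exp (- C * s))\<^sup>2) \<partial>lborel) = ennreal (1 / (2 * C))"
proof -
  define F where "F s = - (exp (- C * s))\<^sup>2 / (2 * C)" for s
  have F: "(F has_real_derivative (exp (- C * s))\<^sup>2) (at s)" for s
    unfolding F_def[abs_def] using C by (auto intro!: derivative_eq_intros simp: power2_eq_square)
  have m: "(\<lambda>s. (exp (- C * s))\<^sup>2) \<in> borel_measurable borel" by measurable
  have "(\<integral>\<^sup>+s\<in>{0..t}. ennreal ((exp (- C * s))\<^sup>2) \<partial>lborel) = ennreal (F t - F 0)"
    by (rule nn_integral_FTC_Icc[OF m _ _ t]) (use F in \<open>auto intro: has_field_derivative_at_within\<close>)
  then show "(\<integral>\<^sup>+s\<in>{0..t}. ennreal ((exp (- C * s))\<^sup>2) \<partial>lborel) = ennreal ((1 - (exp (- C * t))\<^sup>2) / (2 * C))"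
    by (simp add: F_def diff_divide_distrib)
  have "((\<lambda>s. exp (- C * s)) \<longlongrightarrow> 0) at_top"
  proof -
    have "filterlim (\<lambda>s. C * s) at_top at_top" using C by (intro filterlim_tendsto_pos_mult_at_top[OF tendsto_const]) (auto simp: filterlim_ident)
    then have "filterlim (\<lambda>s. - C * s) at_bot at_top" by (simp add: filterlim_uminus_at_bot)
    then show ?thesis by (rule filterlim_compose[OF exp_at_bot])
  qed
  then have "(F \<longlongrightarrow> - 0\<^sup>2 / (2 * C)) at_top" unfolding F_def by (intro tendsto_intros) (use C in auto)
  then have l: "(F \<longlongrightarrow> 0) at_top" by simp
  have "(\<integral>\<^sup>+s\<in>{0..}. ennreal ((exp (- C * s))\<^sup>2) \<partial>lborel) = ennreal (0 - F 0)"
    by (rule nn_integral_FTC_atLeast[OF m F _ l]) simp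
  then show "(\<integral>\<^sup>+s\<in>{0..}. ennreal ((exp (- C * s))\<^sup>2) \<partial>lborel) = ennreal (1 / (2 * C))"
    by (simp add: F_def)
qed

text \<open>With \<open>a = \<parallel>u\<^sub>0\<parallel>\<^sup>2\<close> and \<open>b = \<parallel>\<nabla>u\<^sub>0\<parallel>\<^sup>2\<close>, the energy inequality at time \<open>t\<close> reads
  \<open>(1 - exp (-2Ct)) (a - 2b/C) \<ge> 0\<close>, so it holds once \<open>C \<ge> 2b/a\<close>.\<close>

lemma decay_leray_hopf:
  "\<exists>C0>0. \<forall>C\<ge>C0. leray_hopf anderson anderson_metric gfield (decay_flow C)"
proof -
  let ?A = "L2_sq_vec anderson anderson_metric gfield"
  let ?B = "L2_sq_tensor anderson anderson_metric (nabla_flat anderson_metric gfield)"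
  obtain a b where a: "?A = ennreal a" "a > 0" and b: "?B = ennreal b" "b \<ge> 0"
    using gfield_energy gfield_energy_pos by (cases ?A; cases ?B) auto
  define C0 where "C0 = 2 * b / a + 1"
  have C0: "C0 > 0" using a(2) b(2) by (simp add: C0_def add_nonneg_pos)
  have "leray_hopf anderson anderson_metric gfield (decay_flow C)" if "C \<ge> C0" for C
  proof -
    have C: "C > 0" using that C0 by linarith
    have fl: "decay_flow C t = (\<lambda>x. exp (- C * t) *\<^sub>R gfield x)" for t by (auto simp: decay_flow_def)
    define e where "e t = (exp (- C * t))\<^sup>2" for t
    have e: "0 \<le> e t" for t by (simp add: e_def)
    have e1: "e t \<le> 1" if "t \<ge> 0" for t using C that by (simp add: e_def power_le_one)
    have m: "(\<lambda>t. ennreal (e t) * indicator S t) \<in> borel_measurable lborel" if "S \<in> sets borel" for S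
      using that unfolding e_def by measurable
    have V: "L2_sq_vec anderson anderson_metric (decay_flow C t) = ennreal (e t * a)" for t
      unfolding fl energy_scale a(1) e_def using a(2) by (simp add: ennreal_mult)
    have N: "(\<integral>\<^sup>+t\<in>S. L2_sq_tensor anderson anderson_metric (nabla_flat anderson_metric (decay_flow C t)) \<partial>lborel)
        = ennreal b * (\<integral>\<^sup>+t\<in>S. ennreal (e t) \<partial>lborel)" if "S \<in> sets borel" for S
      unfolding fl energy_scale b(1) e_def[symmetric] nn_integral_cmult[OF m[OF that], symmetric] by (simp add: mult_ac)
    have De: "(\<integral>\<^sup>+t\<in>S. L2_sq_tensor anderson anderson_metric (deformation anderson_metric (decay_flow C t)) \<partial>lborel)
        = ennreal b * (\<integral>\<^sup>+t\<in>S. ennreal (e t) \<partial>lborel)" if "S \<in> sets borel" for S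
      unfolding fl energy_scale b(1) e_def[symmetric] nn_integral_cmult[OF m[OF that], symmetric] by (simp add: mult_ac)
    show ?thesis unfolding leray_hopf_def
    proof (intro conjI allI impI)
      show "\<exists>C'. AE t in lborel. t \<ge> 0 \<longrightarrow> L2_sq_vec anderson anderson_metric (decay_flow C t) \<le> ennreal C'"
        unfolding V using e1 a(2) by (intro exI[of _ a] AE_I2 impI ennreal_leI) (simp add: mult_left_le_one_le e)
      show "(\<integral>\<^sup>+t\<in>{0..}. L2_sq_tensor anderson anderson_metric (nabla_flat anderson_metric (decay_flow C t)) \<partial>lborel) < \<infinity>"
        unfolding N[OF atLeast_borel] unfolding e_def exp_decay_nn_integral(2)[OF C order_refl]
        by (simp add: ennreal_mult_less_top)
      show "?A < \<infinity>" by (rule gfield_energy(1))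
      fix t :: real assume t: "t \<ge> 0"
      have s: "{0..t} \<in> sets borel" by simp
      have "L2_sq_vec anderson anderson_metric (decay_flow C t)
        + 4 * (\<integral>\<^sup>+s\<in>{0..t}. L2_sq_tensor anderson anderson_metric (deformation anderson_metric (decay_flow C s)) \<partial>lborel)
        = ennreal (e t * a) + 4 * (ennreal b * ennreal ((1 - e t) / (2 * C)))"
        unfolding V De[OF s] unfolding e_def exp_decay_nn_integral(1)[OF C t] ..
      also have "\<dots> = ennreal (e t * a + 4 * (b * ((1 - e t) / (2 * C))))"
      proof -
        have "0 \<le> (1 - e t) / (2 * C)" using e1[OF t] C by simp
        moreover define c where "c = (1 - e t) / (2 * C)"
        ultimately have c: "0 \<le> c" by simp
        have "4 * (ennreal b * ennreal c) = ennreal 4 * ennreal (b * c)" using b(2) c by (simp add: ennreal_mult)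
        also have "\<dots> = ennreal (4 * (b * c))" using b(2) c by (intro ennreal_mult[symmetric]) auto
        finally have "ennreal (e t * a) + 4 * (ennreal b * ennreal c) = ennreal (e t * a + 4 * (b * c))"
          using a(2) b(2) c e[of t] by (simp only: ennreal_plus[symmetric] mult_nonneg_nonneg less_imp_le zero_le_numeral)
        then show ?thesis by (simp only: c_def)
      qed
      also have "\<dots> \<le> ?A" unfolding a(1)
      proof (rule ennreal_leI)
        have "2 * b / a \<le> C" using that by (simp add: C0_def)
        then have "2 * b / C \<le> a" using a(2) C by (simp add: field_simps)
        then have "(1 - e t) * (2 * b / C) \<le> (1 - e t) * a" using e1[OF t] by (intro mult_left_mono) auto
        then show "e t * a + 4 * (b * ((1 - e t) / (2 * C))) \<le> a" using C by (simp add: field_simps)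
      qed
      finally show "L2_sq_vec anderson anderson_metric (decay_flow C t)
        + 4 * (\<integral>\<^sup>+s\<in>{0..t}. L2_sq_tensor anderson anderson_metric (deformation anderson_metric (decay_flow C s)) \<partial>lborel) \<le> ?A" .
    qed
  qed
  then show ?thesis using C0 by blast
qed

text \<open>All flows \<open>decay_flow C\<close> with large \<open>C\<close> start from the same field and differ at time 1
  wherever that field does not vanish.\<close>

theorem theorem1p3:
  fixes \<nu> :: real
  assumes "\<nu> > 0"
  shows "\<exists>u0 :: real^3 \<Rightarrow> real^3. smooth_on anderson u0 \<and>
    infinite ((\<lambda>u. restrict (\<lambda>(t, x). u t x) ({0..} \<times> anderson)) `
      {u :: real \<Rightarrow> real^3 \<Rightarrow> real^3.
        smooth_on ({0..} \<times> anderson) (\<lambda>(t, x). u t x) \<and>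
        leray_hopf anderson anderson_metric u0 u \<and>
        (\<exists>p :: real \<Rightarrow> real^3 \<Rightarrow> real.
          smooth_on ({0..} \<times> anderson) (\<lambda>(t, x). p t x) \<and>
          navier_stokes anderson anderson_metric \<nu> u0 u p)})"
proof (intro exI[of _ gfield] conjI)
  show "smooth_on anderson gfield" using smooth_on_open_iff[OF open_anderson] Ck_gfield by blast
  obtain C0 where C0: "\<And>C. C \<ge> C0 \<Longrightarrow> leray_hopf anderson anderson_metric gfield (decay_flow C)"
    using decay_leray_hopf by blast
  let ?r = "\<lambda>u. restrict (\<lambda>(t, x). u t x) ({0..} \<times> anderson) :: real \<times> (real^3) \<Rightarrow> real^3"
  let ?S = "{u :: real \<Rightarrow> real^3 \<Rightarrow> real^3.
        smooth_on ({0..} \<times> anderson) (\<lambda>(t, x). u t x) \<and>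
        leray_hopf anderson anderson_metric gfield u \<and>
        (\<exists>p :: real \<Rightarrow> real^3 \<Rightarrow> real.
          smooth_on ({0..} \<times> anderson) (\<lambda>(t, x). p t x) \<and>
          navier_stokes anderson anderson_metric \<nu> gfield u p)}"
  define w where "w n = decay_flow (C0 + real n)" for n :: nat
  have "w n \<in> ?S" for n
    unfolding w_def mem_Collect_eq
    by (intro conjI exI[of _ "decay_pressure (C0 + real n)"] decay_smooth decay_navier_stokes C0) simp
  then have sub: "range (\<lambda>n. ?r (w n)) \<subseteq> ?r ` ?S" by blast
  have "inj (\<lambda>n. ?r (w n))"
  proof (rule injI)
    fix m n assume "?r (w m) = ?r (w n)"
    from fun_cong[OF this, of "(1, axis_point)"] have "w m 1 axis_point = w n 1 axis_point"
      using pot_c_axis_point(1) by simp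
    moreover have "gfield axis_point \<noteq> 0"
    proof
      assume "gfield axis_point = 0"
      then have "flat anderson_metric gfield axis_point = 0" by (simp add: flat_def)
      then have "dpot axis_point $ 3 = 0" using flat_gfield[OF pot_c_axis_point(1)] by simp
      then show False using pot_c_axis_point(2) by simp
    qed
    ultimately show "m = n" by (simp add: w_def decay_flow_def)
  qed
  then have "infinite (range (\<lambda>n. ?r (w n)))" by (rule range_inj_infinite)
  then show "infinite (?r ` ?S)" using sub infinite_super by blast
qed

end
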